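(* Let $L>0$, let $\mathfrak a\in C^1([0,L];\mathbb R)$, let $\mathfrak b:[0,L]\to\mathbb R$ be continuous, and set $T_{\mathfrak a}:=\int_0^L\frac{ds}{|\mathfrak a(s)|}\in(0,+\infty]$. Then for every $T>0$, $$T<T_{\mathfrak a}\quad\Longrightarrow\quad\liminf_{\varepsilon\to0^+}\mathcal C_0(T,\varepsilon)=+\infty .$$
   Context: Control problem. For $T,\varepsilon>0$, $y_0\in L^2(0,L)$ and $h\in L^2(0,T)$ consider $$(\partial_t+\mathfrak a\,\partial_x+\mathfrak b-\varepsilon\partial_x^2)y=0\ \text{ in }(0,T)\times(0,L),\quad y(t,0)=h(t),\ y(t,L)=0,\quad y(0,\cdot)=y_0 .$$ It has a unique solution $y\in C^0([0,T];L^2(0,L))$ in the sense of transposition, i.e. for all $\tau\in[0,T]$ and $u_0\in H^1_0(0,L)$, $(u(\tau),y_0)_{L^2}-(u_0,y(\tau))_{L^2}+\int_0^\tau\varepsilon\,\partial_xu(t,0)\,h(\tau-t)\,dt=0$, where $u$ solves $(\partial_t-\mathfrak a\partial_x-(\mathfrak a'-\mathfrak b)-\varepsilon\partial_x^2)u=0$, $u(t,0)=u(t,L)=0$, $u(0)=u_0$. Cost. For $y_0\in L^2(0,L)$ let $U(y_0)$ be the set of $h\in L^2(0,T)$ such that $y(T)=0$. Then $\mathcal C_0(T,\varepsilon)=\sup_{\|y_0\|_{L^2(0,L)}\le1}\inf_{h\in U(y_0)}\|h\|_{L^2(0,T)}\in[0,+\infty]$. *)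

theory Defs
  imports "HOL-Analysis.Analysis"
begin

text \<open>Elements of \<open>L\<^sup>2(a,b)\<close> are represented by functions, read up to equality almost everywhere.\<close>

definition L2 :: "real \<Rightarrow> real \<Rightarrow> (real \<Rightarrow> real) set" where
  "L2 a b = {f \<in> borel_measurable (lebesgue_on {a..b}).
               integrable (lebesgue_on {a..b}) (\<lambda>x. (f x)\<^sup>2)}"

definition L2_ip :: "real \<Rightarrow> real \<Rightarrow> (real \<Rightarrow> real) \<Rightarrow> (real \<Rightarrow> real) \<Rightarrow> real" where
  "L2_ip a b f g = (LINT x|lebesgue_on {a..b}. f x * g x)"

definition L2_nrm :: "real \<Rightarrow> real \<Rightarrow> (real \<Rightarrow> real) \<Rightarrow> real" where
  "L2_nrm a b f = sqrt (L2_ip a b f f)"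

definition C0_L2 :: "real \<Rightarrow> real \<Rightarrow> (real \<Rightarrow> real \<Rightarrow> real) \<Rightarrow> bool" where
  "C0_L2 T L y \<longleftrightarrow> (\<forall>t\<in>{0..T}. y t \<in> L2 0 L \<and>
     ((\<lambda>s. L2_nrm 0 L (\<lambda>x. y s x - y t x)) \<longlongrightarrow> 0) (at t within {0..T}))"

definition test_fun :: "real \<Rightarrow> (real \<Rightarrow> real) \<Rightarrow> bool" where
  "test_fun L \<phi> \<longleftrightarrow> (\<forall>n x. (deriv ^^ n) \<phi> field_differentiable at x) \<and>
     (\<exists>c d. 0 < c \<and> d < L \<and> (\<forall>x. x \<notin> {c..d} \<longrightarrow> \<phi> x = 0))"

definition weak_deriv :: "real \<Rightarrow> (real \<Rightarrow> real) \<Rightarrow> (real \<Rightarrow> real) \<Rightarrow> bool" where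
  "weak_deriv L f g \<longleftrightarrow> f \<in> L2 0 L \<and> g \<in> L2 0 L \<and>
     (\<forall>\<phi>. test_fun L \<phi> \<longrightarrow> L2_ip 0 L f (deriv \<phi>) = - L2_ip 0 L g \<phi>)"

text \<open>Every class in \<open>H\<^sup>1(0,L)\<close> has exactly one representative that is continuous on \<open>[0,L]\<close>;
  it is the one used here, so that the boundary values can be read off pointwise.\<close>

definition H1_0 :: "real \<Rightarrow> (real \<Rightarrow> real) set" where
  "H1_0 L = {f. continuous_on {0..L} f \<and> (\<exists>g. weak_deriv L f g) \<and> f 0 = 0 \<and> f L = 0}"

text \<open>\<open>u\<close> solves
  \<open>u\<^sub>t - a u\<^sub>x - (a' - b) u - \<epsilon> u\<^sub>x\<^sub>x = 0\<close>, \<open>u(t,0) = u(t,L) = 0\<close>, \<open>u(0) = u\<^sub>0\<close> on \<open>[0,T]\<close>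
  as an evolution equation in \<open>L\<^sup>2(0,L)\<close>: \<open>u(t)\<close> lies in the domain \<open>H\<^sup>2 \<inter> H\<^sup>1\<^sub>0\<close> for \<open>t > 0\<close>, and
  the time derivative is the limit of difference quotients in \<open>L\<^sup>2(0,L)\<close>.  The generated
  semigroup is analytic, so such a \<open>u\<close> exists for every initial value; it is unique by the energy
  estimate, and for \<open>u\<^sub>0 \<in> H\<^sup>1\<^sub>0\<close> it is the usual solution in
  \<open>C([0,T];H\<^sup>1\<^sub>0) \<inter> L\<^sup>2(0,T;H\<^sup>2) \<inter> H\<^sup>1(0,T;L\<^sup>2)\<close>.
  The argument \<open>v\<close> is \<open>u\<^sub>x\<close>; since \<open>v(t)\<close> is the continuous representative of an \<open>H\<^sup>1\<close> function,
  \<open>v t 0\<close> is the trace of \<open>u\<^sub>x(t)\<close> at \<open>0\<close>.\<close>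

definition adjoint_sol ::
  "real \<Rightarrow> (real \<Rightarrow> real) \<Rightarrow> (real \<Rightarrow> real) \<Rightarrow> (real \<Rightarrow> real) \<Rightarrow> real \<Rightarrow> real \<Rightarrow> (real \<Rightarrow> real) \<Rightarrow>
     (real \<Rightarrow> real \<Rightarrow> real) \<Rightarrow> (real \<Rightarrow> real \<Rightarrow> real) \<Rightarrow> bool" where
  "adjoint_sol L a a' b T \<epsilon> u0 u v \<longleftrightarrow>
     C0_L2 T L u \<and> (AE x in lebesgue_on {0..L}. u 0 x = u0 x) \<and>
     (\<forall>t\<in>{0<..T}. u t \<in> H1_0 L \<and> weak_deriv L (u t) (v t) \<and> continuous_on {0..L} (v t) \<and>
        (\<exists>w. weak_deriv L (v t) w \<and>
           ((\<lambda>s. L2_nrm 0 L (\<lambda>x. (u s x - u t x) / (s - t)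
                - (a x * v t x + (a' x - b x) * u t x + \<epsilon> * w x))) \<longlongrightarrow> 0) (at t within {0..T})))"

definition transposition_sol ::
  "real \<Rightarrow> (real \<Rightarrow> real) \<Rightarrow> (real \<Rightarrow> real) \<Rightarrow> (real \<Rightarrow> real) \<Rightarrow> real \<Rightarrow> real \<Rightarrow> (real \<Rightarrow> real) \<Rightarrow>
     (real \<Rightarrow> real) \<Rightarrow> (real \<Rightarrow> real \<Rightarrow> real) \<Rightarrow> bool" where
  "transposition_sol L a a' b T \<epsilon> y0 h y \<longleftrightarrow> C0_L2 T L y \<and>
     (\<forall>\<tau>\<in>{0..T}. \<forall>u0\<in>H1_0 L. \<forall>u v. adjoint_sol L a a' b T \<epsilon> u0 u v \<longrightarrow>
        L2_ip 0 L (u \<tau>) y0 - L2_ip 0 L u0 (y \<tau>)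
          + (LINT t|lebesgue_on {0..\<tau>}. \<epsilon> * v t 0 * h (\<tau> - t)) = 0)"

definition null_controls ::
  "real \<Rightarrow> (real \<Rightarrow> real) \<Rightarrow> (real \<Rightarrow> real) \<Rightarrow> (real \<Rightarrow> real) \<Rightarrow> real \<Rightarrow> real \<Rightarrow> (real \<Rightarrow> real) \<Rightarrow>
     (real \<Rightarrow> real) set" where
  "null_controls L a a' b T \<epsilon> y0 = {h \<in> L2 0 T. \<exists>y. transposition_sol L a a' b T \<epsilon> y0 h y \<and>
     (AE x in lebesgue_on {0..L}. y T x = 0)}"

text \<open>The infimum over the empty set is \<open>\<infinity>\<close>.\<close>

definition control_cost ::
  "real \<Rightarrow> (real \<Rightarrow> real) \<Rightarrow> (real \<Rightarrow> real) \<Rightarrow> (real \<Rightarrow> real) \<Rightarrow> real \<Rightarrow> real \<Rightarrow> ennreal" where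
  "control_cost L a a' b T \<epsilon> =
     (SUP y0\<in>{y0 \<in> L2 0 L. L2_nrm 0 L y0 \<le> 1}.
        INF h\<in>null_controls L a a' b T \<epsilon> y0. ennreal (L2_nrm 0 T h))"

text \<open>In \<^typ>\<open>ennreal\<close> one has \<open>1 / 0 = \<infinity>\<close>, so zeros of \<open>a\<close> contribute as intended.\<close>

definition transport_time :: "real \<Rightarrow> (real \<Rightarrow> real) \<Rightarrow> ennreal" where
  "transport_time L a = (\<integral>\<^sup>+ s. 1 / ennreal \<bar>a s\<bar> \<partial>lebesgue_on {0..L})"

end

theory Submission imports Defs begin

text \<open>
  By duality, the cost is at least \<open>\<parallel>u(T)\<parallel> / \<parallel>\<epsilon> u\<^sub>x(\<cdot>,0)\<parallel>\<close> for every solution \<open>u\<close> of the adjoint equation, so it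
  is enough to exhibit, for small \<open>\<epsilon>\<close>, one solution whose flux at \<open>0\<close> is much smaller than its final state.
  Since \<open>T < T\<^sub>a\<close>, there is a characteristic \<open>X' = -a(X)\<close> that stays at a positive distance \<open>2d\<close> from the
  boundary during \<open>[0,T]\<close>.  The initial state is a bump of width \<open>\<surd>s\<close> around \<open>X(0)\<close>.  Gaussians moving along
  the characteristic, with exponentially growing or shrinking width, are super- and subsolutions once
  \<open>\<epsilon>\<close> is small compared with \<open>s\<close>.  The supersolution shows that \<open>u\<close>, hence also its flux, is of order
  \<open>exp (- \<gamma> / s)\<close> near the boundary; the subsolution bounds \<open>u(T)\<close> from below by a constant on an interval of
  length comparable to \<open>\<surd>s\<close>.  Letting \<open>s \<rightarrow> 0\<close> gives the claim.

  The adjoint solutions themselves come from a Hille--Yosida argument: the substitution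
  \<open>u = exp (- \<integral> a / (2 \<epsilon>)) z\<close> removes the drift, and the resolvent of \<open>\<epsilon> z'' - p z\<close> is obtained by a
  contraction argument from the explicit solution for \<open>p = 0\<close> and bounded by the maximum principle.
\<close>

section \<open>Bounded operators as a Banach algebra\<close>

text \<open>The transposition identity constrains a state only through adjoint solutions that exist,
  so one has to be constructed rather than assumed. The estimates come from the maximum principle,
  so it has to be controlled pointwise: the semigroup lives on bounded continuous functions with the
  sup norm, where the Dirichlet domain is not dense.

  The order of the choices decides the argument. The target \<open>M\<close> fixes the width
  \<open>s\<close>, and only then is \<epsilon> taken small compared with \<open>s\<close>;
  \<epsilon> does not occur in the resulting bounds for flux and final state. The gap that wins is
  \<open>exp (- (\<gamma> / s))\<close> against \<open>sqrt s\<close>. Quantities that blow up as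
  \<epsilon> tends to 0, such as the potential left by the removed drift or the resolvent parameter,
  affect only the existence of the solution; the defect \<delta> of its initial value can still be
  prescribed freely.

  The comparison principles require a nonpositive zero-order coefficient. A factor
  \<open>exp (\<omega> * t)\<close> provides it, at a price independent of \<epsilon> and
  \<open>s\<close>.\<close>

typedef (overloaded) 'a endo = "UNIV :: ('a::{banach,perfect_space} \<Rightarrow>\<^sub>L 'a) set"
  morphisms op_of Endo
  by simp

setup_lifting type_definition_endo

text \<open>Composition is a multiplication only when domain and codomain agree, hence a type of its
  own: as a Banach algebra it carries powers and \<open>exp\<close>. \<open>perfect_space\<close>
  rules out the zero space, so the unit is nonzero and has norm 1.\<close>

instantiation endo :: ("{banach,perfect_space}") real_algebra_1
begin

lift_definition zero_endo :: "'a endo" is "0" .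
lift_definition one_endo :: "'a endo" is "id_blinfun" .
lift_definition plus_endo :: "'a endo \<Rightarrow> 'a endo \<Rightarrow> 'a endo" is "(+)" .
lift_definition minus_endo :: "'a endo \<Rightarrow> 'a endo \<Rightarrow> 'a endo" is "(-)" .
lift_definition uminus_endo :: "'a endo \<Rightarrow> 'a endo" is "uminus" .
lift_definition scaleR_endo :: "real \<Rightarrow> 'a endo \<Rightarrow> 'a endo" is "scaleR" .
lift_definition times_endo :: "'a endo \<Rightarrow> 'a endo \<Rightarrow> 'a endo" is "blinfun_compose" .

instance
proof
  fix f g h :: "'a endo" and r s :: real
  show "f + g + h = f + (g + h)" by transfer (simp add: add.assoc)
  show "f + g = g + f" by transfer (simp add: add.commute)
  show "0 + f = f" by transfer simp
  show "- f + f = 0" by transfer simp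
  show "f - g = f + - g" by transfer simp
  show "f * g * h = f * (g * h)" by transfer (rule blinfun_eqI, simp)
  show "(f + g) * h = f * h + g * h" by transfer (rule blinfun_eqI, simp add: blinfun.bilinear_simps)
  show "f * (g + h) = f * g + f * h" by transfer (rule blinfun_eqI, simp add: blinfun.bilinear_simps)
  show "1 * f = f" by transfer (rule blinfun_eqI, simp)
  show "f * 1 = f" by transfer (rule blinfun_eqI, simp)
  show "(0::'a endo) \<noteq> 1"
    by transfer (metis norm_blinfun_id norm_zero zero_neq_one)
  show "r *\<^sub>R (f + g) = r *\<^sub>R f + r *\<^sub>R g" by transfer (simp add: scaleR_add_right)
  show "(r + s) *\<^sub>R f = r *\<^sub>R f + s *\<^sub>R f" by transfer (simp add: scaleR_add_left)
  show "r *\<^sub>R s *\<^sub>R f = (r * s) *\<^sub>R f" by transfer simp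
  show "1 *\<^sub>R f = f" by transfer simp
  show "r *\<^sub>R f * g = r *\<^sub>R (f * g)" by transfer (rule blinfun_eqI, simp add: blinfun.bilinear_simps)
  show "f * r *\<^sub>R g = r *\<^sub>R (f * g)" by transfer (rule blinfun_eqI, simp add: blinfun.bilinear_simps)
qed

end

instantiation endo :: ("{banach,perfect_space}") real_normed_algebra_1
begin

lift_definition norm_endo :: "'a endo \<Rightarrow> real" is norm .
definition dist_endo :: "'a endo \<Rightarrow> 'a endo \<Rightarrow> real" where "dist_endo f g = norm (f - g)"
definition sgn_endo :: "'a endo \<Rightarrow> 'a endo" where "sgn_endo f = f /\<^sub>R norm f"
definition uniformity_endo :: "('a endo \<times> 'a endo) filter"
  where "uniformity_endo = (INF e\<in>{0<..}. principal {(x, y). dist x y < e})"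
definition open_endo :: "'a endo set \<Rightarrow> bool"
  where "open_endo U = (\<forall>x\<in>U. \<forall>\<^sub>F (x', y) in uniformity. x' = x \<longrightarrow> y \<in> U)"

instance
proof
  fix f g :: "'a endo" and r :: real
  show "norm (1::'a endo) = 1" by transfer simp
  show "(norm f = 0) = (f = 0)" by transfer simp
  show "norm (f + g) \<le> norm f + norm g" by transfer (rule norm_triangle_ineq)
  show "norm (r *\<^sub>R f) = \<bar>r\<bar> * norm f" by transfer simp
  show "norm (f * g) \<le> norm f * norm g" by transfer (rule norm_blinfun_compose)
qed (rule dist_endo_def sgn_endo_def uniformity_endo_def open_endo_def)+

end

instance endo :: ("{banach,perfect_space}") banach
proof
  fix F :: "nat \<Rightarrow> 'a endo" assume "Cauchy F"
  have d: "dist f g = dist (op_of f) (op_of g)" for f g :: "'a endo"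
    unfolding dist_norm by transfer simp
  have "Cauchy (\<lambda>n. op_of (F n))"
    using \<open>Cauchy F\<close> unfolding Cauchy_def d .
  then obtain G where "(\<lambda>n. op_of (F n)) \<longlonglongrightarrow> G"
    by (auto simp: Cauchy_convergent_iff convergent_def)
  then have "F \<longlonglongrightarrow> Endo G"
    unfolding tendsto_iff d by (simp add: Endo_inverse)
  then show "convergent F" by (auto simp: convergent_def)
qed

lemma op_of_simps [simp]:
  "op_of 0 x = 0" "op_of 1 x = x" "op_of (f + g) x = op_of f x + op_of g x"
  "op_of (f - g) x = op_of f x - op_of g x" "op_of (- f) x = - op_of f x"
  "op_of (r *\<^sub>R f) x = r *\<^sub>R op_of f x" "op_of (f * g) x = op_of f (op_of g x)"
  by (transfer, simp add: blinfun.bilinear_simps)+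

lemma norm_op_of_le: "norm (op_of f x) \<le> norm f * norm x"
  by transfer (rule norm_blinfun)

lemma bounded_linear_op_of_apply: "bounded_linear (\<lambda>f. op_of f x)"
  by (rule bounded_linear_intro[where K="norm x"]) (simp_all add: norm_op_of_le)

lemma bounded_linear_op_of: "bounded_linear (op_of f)"
  by (rule blinfun.bounded_linear_right)

section \<open>Evolution equations for resolvent families\<close>

lemma exp_commute:
  fixes X Y :: "'a::{real_normed_algebra_1,banach}"
  assumes "X * Y = Y * X"
  shows "exp X * Y = Y * exp X"
proof -
  have p: "X ^ n * Y = Y * X ^ n" for n
    by (induction n) (simp_all add: assms mult.assoc, metis assms mult.assoc)
  have "(\<lambda>n. (X ^ n /\<^sub>R fact n) * Y) sums (exp X * Y)"
    by (intro sums_mult2 exp_converges)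
  moreover have "(\<lambda>n. Y * (X ^ n /\<^sub>R fact n)) sums (Y * exp X)"
    by (intro sums_mult exp_converges)
  moreover have "(\<lambda>n. (X ^ n /\<^sub>R fact n) * Y) = (\<lambda>n. Y * (X ^ n /\<^sub>R fact n))"
    by (simp add: p)
  ultimately show ?thesis by (metis sums_unique2)
qed

text \<open>As in the Hille--Yosida theorem, the evolution is the limit of the exponentials of the Yosida
  approximations \<open>n\<^sup>2 R\<^sub>n - n\<close>.  Only initial values in the range of a power of the resolvent are
  treated, so that no density argument is needed.\<close>

locale resolvent_family =
  fixes R :: "real \<Rightarrow> 'a::{banach,perfect_space} endo" and P :: real
  assumes P_nonneg: "0 \<le> P"
    and norm_R: "\<And>r. P < r \<Longrightarrow> norm (R r) \<le> 1 / r"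
    and resolvent_id: "\<And>r s. P < r \<Longrightarrow> P < s \<Longrightarrow> R r - R s = (s - r) *\<^sub>R (R r * R s)"
begin

section \<open>Yosida approximations and their exponentials\<close>

lemma R_commute:
  assumes "P < r" "P < s" shows "R r * R s = R s * R r"
proof (cases "r = s")
  case False
  have "(s - r) *\<^sub>R (R r * R s) = (s - r) *\<^sub>R (R s * R r)"
    using resolvent_id[OF assms] resolvent_id[OF assms(2,1)]
    by (metis minus_diff_eq scaleR_minus_left)
  with False show ?thesis by simp
qed simp

definition yosida :: "real \<Rightarrow> 'a endo" where
  "yosida n = n\<^sup>2 *\<^sub>R R n - n *\<^sub>R 1"

lemma yosida_commute:
  assumes "P < r" "P < s"
  shows "yosida r * yosida s = yosida s * yosida r" "yosida r * R s = R s * yosida r"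
  using R_commute[OF assms] by (simp_all add: yosida_def algebra_simps)

text \<open>The exponential splits into the scalar \<open>exp (- (t * n))\<close> and a factor of
  norm at most \<open>exp (t * n)\<close>. The constant 1 in \<open>norm_R\<close> matters: a larger
  one would leave a factor growing with \<open>n\<close> in this estimate.\<close>

lemma norm_exp_yosida:
  assumes "P < n" "0 \<le> t" shows "norm (exp (t *\<^sub>R yosida n)) \<le> 1"
proof -
  have "0 < n" using assms P_nonneg by simp
  have "t *\<^sub>R yosida n = (t * n\<^sup>2) *\<^sub>R R n + (- (t * n)) *\<^sub>R 1"
    by (simp add: yosida_def algebra_simps)
  then have "exp (t *\<^sub>R yosida n) = exp ((t * n\<^sup>2) *\<^sub>R R n) * exp ((- (t * n)) *\<^sub>R 1)"
    by (simp only:) (rule exp_add_commuting, simp)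
  also have "exp ((- (t * n)) *\<^sub>R (1::'a endo)) = exp (- (t * n)) *\<^sub>R 1"
    using exp_of_real[of "- (t * n)", where 'a="'a endo"] by (simp add: of_real_def)
  finally have "norm (exp (t *\<^sub>R yosida n)) = exp (- (t * n)) * norm (exp ((t * n\<^sup>2) *\<^sub>R R n))"
    by simp
  also have "\<dots> \<le> exp (- (t * n)) * exp (norm ((t * n\<^sup>2) *\<^sub>R R n))"
    by (intro mult_left_mono norm_exp) simp
  also have "norm ((t * n\<^sup>2) *\<^sub>R R n) \<le> t * n"
  proof -
    have "t * n\<^sup>2 * norm (R n) \<le> t * n\<^sup>2 * (1 / n)"
      using assms by (intro mult_left_mono norm_R) auto
    then show ?thesis using assms \<open>0 < n\<close> by (simp add: power2_eq_square)
  qed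
  finally show ?thesis by (simp flip: exp_add)
qed

text \<open>\<open>gen r\<close> is \<open>A R\<^sub>r\<close> for the operator \<open>A\<close> with resolvents \<open>R\<close>.\<close>

definition gen :: "real \<Rightarrow> 'a endo" where
  "gen r = r *\<^sub>R R r - 1"

text \<open>With \<open>A\<close> the generator, \<open>yosida n\<close> is \<open>n A R n\<close>;
  the identity expresses this through bounded operators only.\<close>

lemma yosida_R:
  assumes "P < n" "P < r"
  shows "yosida n * R r = n *\<^sub>R (R n * gen r)"
proof -
  have "(n - r) *\<^sub>R (R n * R r) = R r - R n"
    using resolvent_id[OF assms(2,1)] R_commute[OF assms] by simp
  then have "n *\<^sub>R ((n - r) *\<^sub>R (R n * R r)) = n *\<^sub>R (R r - R n)" by simp
  then show ?thesis
    by (simp add: yosida_def gen_def algebra_simps power2_eq_square)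
qed

lemma R_gen_commute: "P < r \<Longrightarrow> P < s \<Longrightarrow> R r * gen s = gen s * R r"
  using R_commute by (simp add: gen_def algebra_simps)

lemma yosida_gen_commute: "P < r \<Longrightarrow> P < s \<Longrightarrow> yosida r * gen s = gen s * yosida r"
  using yosida_commute by (simp add: gen_def algebra_simps)

text \<open>The right-hand side is of order \<open>1 / n\<close>, so \<open>n R n\<close> tends to
  the identity on the range of \<open>R r\<close>.\<close>

lemma approx_R:
  assumes "P < n" "P < r"
  shows "n *\<^sub>R (R n * R r) - R r = R n * gen r"
proof -
  have "n \<noteq> 0" using assms P_nonneg by simp
  have "n *\<^sub>R (n *\<^sub>R (R n * R r) - R r) = yosida n * R r"
    by (simp add: yosida_def algebra_simps power2_eq_square)
  then show ?thesis using yosida_R[OF assms] \<open>n \<noteq> 0\<close> by (metis scaleR_left_imp_eq)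
qed

text \<open>On the range of \<open>R r * R r\<close> the Yosida approximation differs from the
  generator by a term of order \<open>1 / n\<close>. Two resolvents occur because each of the two
  factors \<open>gen r\<close> uses up one.\<close>

lemma yosida_RR_diff:
  assumes "P < n" "P < r"
  shows "yosida n * (R r * R r) - gen r * R r = R n * (gen r * gen r)"
proof -
  have "yosida n * (R r * R r) = n *\<^sub>R (R n * (gen r * R r))"
    using yosida_R[OF assms] by (simp flip: mult.assoc)
  also have "\<dots> = (n *\<^sub>R (R n * R r)) * gen r"
    using R_gen_commute[OF assms(2) assms(2)] by (simp add: mult.assoc)
  also have "n *\<^sub>R (R n * R r) = R r + R n * gen r"
    using approx_R[OF assms] by (simp add: algebra_simps)
  finally show ?thesis
    using R_gen_commute[OF assms(2) assms(2)] by (simp add: algebra_simps)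
qed

text \<open>The path \<open>f\<close> joins the two exponentials. Its values are contractions, and
  its derivative contains \<open>D\<close> applied to the squared resolvent, which is of order
  \<open>1 / n + 1 / m\<close>; the mean value theorem concludes.\<close>

lemma exp_yosida_diff:
  assumes n: "P < n" and m: "P < m" and r: "P < r" and t: "0 \<le> t"
  shows "norm (exp (t *\<^sub>R yosida n) * (R r * R r) - exp (t *\<^sub>R yosida m) * (R r * R r))
         \<le> t * ((1 / n + 1 / m) * (norm (gen r))\<^sup>2)"
proof -
  define D where "D = yosida n - yosida m"
  define f where "f s = exp (t *\<^sub>R yosida m + s *\<^sub>R D)" for s
  have comm: "yosida m * D = D * yosida m"
    using yosida_commute[OF n m] by (simp add: D_def algebra_simps)
  \<comment> \<open>This factorisation shows that \<open>f s\<close> is a contraction for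
    \<open>s\<close> in \<open>{0..t}\<close>; the one in \<open>fs'\<close> is suited to
    differentiation in \<open>s\<close>.\<close>
  have fs: "f s = exp ((t - s) *\<^sub>R yosida m) * exp (s *\<^sub>R yosida n)" for s
  proof -
    have "t *\<^sub>R yosida m + s *\<^sub>R D = (t - s) *\<^sub>R yosida m + s *\<^sub>R yosida n"
      by (simp add: D_def algebra_simps)
    then show ?thesis unfolding f_def
      by (simp only:) (rule exp_add_commuting, simp add: yosida_commute[OF n m])
  qed
  have fs': "f s = exp (t *\<^sub>R yosida m) * exp (s *\<^sub>R D)" for s
    unfolding f_def by (rule exp_add_commuting) (simp add: comm)
  have der: "((\<lambda>s. f s * (R r * R r)) has_vector_derivative f s * (D * (R r * R r))) (at s within {0..t})" for s
    unfolding fs' mult.assoc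
    by (rule bounded_linear.has_vector_derivative[OF bounded_linear_mult_right])
      (use bounded_linear.has_vector_derivative[OF bounded_linear_mult_left[of "R r * R r"]
        exp_scaleR_has_vector_derivative_right[of D s "{0..t}"]] in \<open>simp add: mult.assoc\<close>)
  have DRR: "D * (R r * R r) = (R n - R m) * (gen r * gen r)"
    using yosida_RR_diff[OF n r] yosida_RR_diff[OF m r] by (simp add: D_def algebra_simps)
  have nb: "norm (D * (R r * R r)) \<le> (1 / n + 1 / m) * (norm (gen r))\<^sup>2"
  proof -
    have "norm (D * (R r * R r)) \<le> norm (R n - R m) * norm (gen r * gen r)"
      unfolding DRR by (rule norm_mult_ineq)
    also have "\<dots> \<le> (1 / n + 1 / m) * (norm (gen r))\<^sup>2"
    proof (intro mult_mono)
      show "norm (R n - R m) \<le> 1 / n + 1 / m"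
        using norm_triangle_ineq4[of "R n" "R m"] norm_R[OF n] norm_R[OF m] by linarith
      show "norm (gen r * gen r) \<le> (norm (gen r))\<^sup>2"
        by (simp add: power2_eq_square norm_mult_ineq)
      show "0 \<le> 1 / n + 1 / m" using n m P_nonneg by simp
    qed simp
    finally show ?thesis .
  qed
  have fbound: "norm (f s * (D * (R r * R r))) \<le> (1 / n + 1 / m) * (norm (gen r))\<^sup>2" if "s \<in> {0..t}" for s
  proof -
    have "norm (f s) \<le> 1 * 1"
      unfolding fs using that norm_exp_yosida[OF n] norm_exp_yosida[OF m]
      by (intro order_trans[OF norm_mult_ineq] mult_mono) auto
    have "norm (f s * (D * (R r * R r))) \<le> norm (f s) * norm (D * (R r * R r))"
      by (rule norm_mult_ineq)
    also have "\<dots> \<le> 1 * norm (D * (R r * R r))"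
      using \<open>norm (f s) \<le> 1 * 1\<close> by (intro mult_right_mono) auto
    finally show ?thesis using nb by simp
  qed
  have "norm (f t * (R r * R r) - f 0 * (R r * R r)) \<le> ((1 / n + 1 / m) * (norm (gen r))\<^sup>2) * norm (t - 0)"
    by (rule differentiable_bound[of "{0..t}"])
      (use der t fbound in \<open>auto simp: has_vector_derivative_def abs_mult mult.commute intro!: onorm_le mult_left_mono\<close>)
  then show ?thesis using t by (simp add: fs mult.commute)
qed

text \<open>The exponentials applied to \<open>R r * R r\<close> form a uniform Cauchy sequence, but
  their limit is only shown to be continuous. One more resolvent makes it differentiable, and the
  derivative \<open>r *\<^sub>R op_of (R r) (w t) - w t\<close> is the generator applied to
  \<open>op_of (R r) (w t)\<close>.\<close>

theorem evolution:
  assumes r: "P < r" and T: "0 \<le> T"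
  obtains w where "continuous_on {0..T} w" "w 0 = op_of (R r) (op_of (R r) g)"
    "\<And>t. t \<in> {0..T} \<Longrightarrow>
      ((\<lambda>t. op_of (R r) (w t)) has_vector_derivative r *\<^sub>R op_of (R r) (w t) - w t) (at t within {0..T})"
proof -
  define E where "E n t = exp (t *\<^sub>R yosida (real n)) * (R r * R r)" for n t
  define G where "G = (norm (gen r))\<^sup>2"
  obtain N0 :: nat where N0: "P < N0" using reals_Archimedean2 by blast
  have big: "P < real n" if "n \<ge> N0" for n using N0 that by (meson less_le_trans of_nat_le_iff)
  have inv: "1 / real n \<le> 1 / real N" if "n \<ge> N" "N > 0" for n N :: nat
    using that by (simp add: frac_le)
  have "uniformly_Cauchy_on {0..T} E"
    unfolding uniformly_Cauchy_on_def
  proof (intro allI impI)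
    fix e :: real assume "0 < e"
    obtain N :: nat where "max 1 (2 * T * G / e) < N"
      using reals_Archimedean2 by blast
    then have N: "N > 0" "2 * T * G / e < N" by auto
    have "dist (E m t) (E n t) < e" if "t \<in> {0..T}" "m \<ge> max N N0" "n \<ge> max N N0" for m n t
    proof -
      have "dist (E m t) (E n t) \<le> t * ((1 / m + 1 / n) * G)"
        unfolding E_def dist_norm G_def using that by (intro exp_yosida_diff big r) auto
      also have "\<dots> \<le> T * ((1 / N + 1 / N) * G)"
        using that N inv by (intro mult_mono add_mono mult_nonneg_nonneg) (auto simp: G_def)
      also have "\<dots> < e" using N \<open>0 < e\<close> by (simp add: field_simps)
      finally show ?thesis .
    qed
    then show "\<exists>M. \<forall>x\<in>{0..T}. \<forall>m\<ge>M. \<forall>n\<ge>M. dist (E m x) (E n x) < e" by blast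
  qed
  then have "uniformly_convergent_on {0..T} E"
    by (rule Cauchy_uniformly_convergent)
  then obtain W where W: "uniform_limit {0..T} E W sequentially"
    by (auto simp: uniformly_convergent_on_def)
  have derE: "((\<lambda>t. E n t) has_vector_derivative yosida n * E n t) (at t within {0..T})" for n t
    using bounded_linear.has_vector_derivative[OF bounded_linear_mult_left[of "R r * R r"]
        exp_scaleR_has_vector_derivative_right[of "yosida n" t "{0..T}"]]
    unfolding E_def exp_times_scaleR_commute by (simp only: mult.assoc)
  have contW: "continuous_on {0..T} W"
    by (rule uniform_limit_theorem[OF _ W])
      (auto intro!: always_eventually continuous_on_vector_derivative derE)
  have ptW: "(\<lambda>n. E n t) \<longlonglongrightarrow> W t" if "t \<in> {0..T}" for t
    using W that by (rule tendsto_uniform_limitI)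
  \<comment> \<open>The two resolvents in \<open>E\<close> are spent on the Cauchy estimate; the
    additional factor \<open>R r\<close> makes the derivatives converge uniformly as well.\<close>
  have "\<exists>g. \<forall>t\<in>{0..T}. (\<lambda>n. R r * E n t) \<longlonglongrightarrow> g t \<and>
         (g has_derivative (\<lambda>h. h *\<^sub>R (gen r * W t))) (at t within {0..T})"
  proof (rule has_derivative_sequence[where f'="\<lambda>n t h. h *\<^sub>R (R r * (yosida n * E n t))"])
    show "((\<lambda>t. R r * E n t) has_derivative (\<lambda>h. h *\<^sub>R (R r * (yosida n * E n t)))) (at t within {0..T})" for n t
      using bounded_linear.has_vector_derivative[OF bounded_linear_mult_right derE]
      by (simp add: has_vector_derivative_def)
    show "\<forall>\<^sub>F n in sequentially. \<forall>t\<in>{0..T}. \<forall>h.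
        norm (h *\<^sub>R (R r * (yosida n * E n t)) - h *\<^sub>R (gen r * W t)) \<le> e * norm h"
      if "e > 0" for e
    proof -
      define K where "K = G * norm (R r)"
      have "(\<lambda>n. K * (1 / real n)) \<longlonglongrightarrow> 0"
        by (intro tendsto_mult_right_zero lim_1_over_n)
      then have 1: "\<forall>\<^sub>F n in sequentially. K * (1 / real n) < e / 2"
        using that by (intro order_tendstoD) auto
      have "e / (2 * (norm (gen r) + 1)) > 0" using that by (auto intro!: divide_pos_pos add_nonneg_pos)
      from uniform_limitD[OF W this]
      have 2: "\<forall>\<^sub>F n in sequentially. \<forall>t\<in>{0..T}. dist (E n t) (W t) < e / (2 * (norm (gen r) + 1))" .
      have 3: "\<forall>\<^sub>F n in sequentially. n \<ge> max N0 1" by (rule eventually_ge_at_top)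
      show ?thesis
      proof (use 1 2 3 in eventually_elim, intro ballI allI)
        fix n t and h :: real
        assume *: "K * (1 / real n) < e / 2"
          "\<forall>t\<in>{0..T}. dist (E n t) (W t) < e / (2 * (norm (gen r) + 1))" "max N0 1 \<le> n" "t \<in> {0..T}"
        have n: "P < real n" using * big by simp
        define X where "X = exp (t *\<^sub>R yosida n)"
        have cX: "R r * X = X * R r"
          unfolding X_def using yosida_commute(2)[OF n r]
          by (intro exp_commute[symmetric]) simp
        have cg: "gen r * X = X * gen r"
          unfolding X_def using yosida_gen_commute[OF n r]
          by (intro exp_commute[symmetric]) simp
        have cy: "yosida n * X = X * yosida n"
          unfolding X_def by (simp add: exp_times_scaleR_commute)
        \<comment> \<open>All factors commute with the exponential \<open>X\<close>, so what remains
          is the error of \<open>yosida_RR_diff\<close>, of order \<open>1 / n\<close>.\<close>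
        have "R r * (yosida n * E n t) - gen r * E n t
          = X * ((yosida n * (R r * R r) - gen r * R r) * R r)"
        proof -
          have "R r * (yosida n * E n t) = R r * (yosida n * (X * (R r * R r)))"
            by (simp add: E_def X_def)
          also have "\<dots> = (R r * X) * (yosida n * (R r * R r))"
            using cy by (metis mult.assoc)
          also have "\<dots> = X * (R r * yosida n * (R r * R r))"
            unfolding cX by (simp add: mult.assoc)
          also have "\<dots> = X * ((yosida n * (R r * R r)) * R r)"
            using yosida_commute(2)[OF n r] by (metis mult.assoc)
          finally have 1: "R r * (yosida n * E n t) = X * ((yosida n * (R r * R r)) * R r)" .
          have "gen r * E n t = (gen r * X) * (R r * R r)"
            by (simp add: E_def X_def mult.assoc)
          also have "\<dots> = X * ((gen r * R r) * R r)" unfolding cg by (simp add: mult.assoc)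
          finally show ?thesis using 1 by (simp add: algebra_simps)
        qed
        also have "\<dots> = X * (R n * (gen r * gen r) * R r)"
          by (simp add: yosida_RR_diff[OF n r])
        finally have "norm (R r * (yosida n * E n t) - gen r * E n t) \<le>
            norm X * (norm (R n) * (norm (gen r) * norm (gen r)) * norm (R r))"
          by (auto intro!: order_trans[OF norm_mult_ineq] mult_mono)
        also have "\<dots> \<le> 1 * ((1 / real n) * (norm (gen r) * norm (gen r)) * norm (R r))"
          using norm_exp_yosida[OF n, of t] norm_R[OF n] * unfolding X_def
          by (intro mult_mono mult_nonneg_nonneg) auto
        also have "\<dots> = K * (1 / real n)" by (simp add: K_def G_def power2_eq_square)
        finally have a: "norm (R r * (yosida n * E n t) - gen r * E n t) \<le> e / 2" using *(1) by linarith
        have "norm (gen r * E n t - gen r * W t) \<le> norm (gen r) * dist (E n t) (W t)"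
          by (simp add: dist_norm norm_mult_ineq flip: right_diff_distrib)
        also have "\<dots> \<le> (norm (gen r) + 1) * (e / (2 * (norm (gen r) + 1)))"
          using * by (intro mult_mono) (auto intro: less_imp_le)
        also have "\<dots> = e / 2"
        proof -
          have "norm (gen r) + 1 \<noteq> 0" by (metis add_nonneg_pos less_irrefl norm_ge_zero zero_less_one)
          then show ?thesis by (simp add: field_simps)
        qed
        finally have "norm (R r * (yosida n * E n t) - gen r * W t) \<le> e"
          using a norm_triangle_ineq[of "R r * (yosida n * E n t) - gen r * E n t" "gen r * E n t - gen r * W t"]
          by simp
        then show "norm (h *\<^sub>R (R r * (yosida n * E n t)) - h *\<^sub>R (gen r * W t)) \<le> e * norm h"
          using mult_left_mono[of _ e "\<bar>h\<bar>"] by (simp add: mult.commute[of e] flip: scaleR_diff_right)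
      qed
    qed
    show "(0::real) \<in> {0..T}" using T by simp
    show "(\<lambda>n. R r * E n 0) \<longlonglongrightarrow> R r * W 0"
      using T by (intro tendsto_mult tendsto_const ptW) auto
  qed simp
  then obtain g' where g': "\<And>t. t \<in> {0..T} \<Longrightarrow> (\<lambda>n. R r * E n t) \<longlonglongrightarrow> g' t"
    "\<And>t. t \<in> {0..T} \<Longrightarrow> (g' has_derivative (\<lambda>h. h *\<^sub>R (gen r * W t))) (at t within {0..T})"
    by blast
  have g'_eq: "g' t = R r * W t" if "t \<in> {0..T}" for t
    using g'(1)[OF that] tendsto_mult[OF tendsto_const ptW[OF that], of "R r"]
    by (rule LIMSEQ_unique)
  have derW: "((\<lambda>t. R r * W t) has_vector_derivative (gen r * W t)) (at t within {0..T})"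
    if "t \<in> {0..T}" for t
    unfolding has_vector_derivative_def
    by (rule has_derivative_transform[OF that _ g'(2)[OF that]]) (simp add: g'_eq)
  show thesis
  proof (rule that[of "\<lambda>t. op_of (W t) g"])
    show "continuous_on {0..T} (\<lambda>t. op_of (W t) g)"
      using bounded_linear.continuous_on[OF bounded_linear_op_of_apply contW] .
    have "(\<lambda>n. E n 0) \<longlonglongrightarrow> R r * R r" by (simp add: E_def)
    then have "W 0 = R r * R r" using ptW[of 0] T by (auto intro: LIMSEQ_unique)
    then show "op_of (W 0) g = op_of (R r) (op_of (R r) g)" by simp
    show "((\<lambda>t. op_of (R r) (op_of (W t) g)) has_vector_derivative
        r *\<^sub>R op_of (R r) (op_of (W t) g) - op_of (W t) g) (at t within {0..T})"
      if "t \<in> {0..T}" for t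
      using bounded_linear.has_vector_derivative[OF bounded_linear_op_of_apply[of g] derW[OF that]]
      by (simp add: gen_def)
  qed
qed

end

section \<open>The Dirichlet problem on an interval\<close>

text \<open>If \<open>f2\<close> were negative, \<open>f1\<close> would be negative just to the
  right of its zero \<open>x\<close>, and the mean value theorem would push \<open>f\<close> below
  its minimum.\<close>

lemma interior_min_second_derivative:
  fixes f f1 :: "real \<Rightarrow> real"
  assumes x: "x \<in> {l<..<r}" and min: "\<And>y. y \<in> {l..r} \<Longrightarrow> f x \<le> f y"
    and f1: "\<And>y. y \<in> {l<..<r} \<Longrightarrow> (f has_real_derivative f1 y) (at y)"
    and f2: "(f1 has_real_derivative f2) (at x)"
  shows "f1 x = 0" "0 \<le> f2"
proof -
  define d where "d = min (x - l) (r - x)"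
  have d: "d > 0" using x by (auto simp: d_def)
  show f1x: "f1 x = 0"
    by (rule DERIV_local_min[OF f1[OF x] d]) (auto intro!: min simp: d_def abs_if split: if_splits)
  show "0 \<le> f2"
  proof (rule ccontr)
    assume "\<not> 0 \<le> f2"
    then obtain e where e: "e > 0" "\<And>h. 0 < h \<Longrightarrow> h < e \<Longrightarrow> f1 (x + h) < f1 x"
      using DERIV_neg_dec_right[OF f2] by force
    define h where "h = min d e / 2"
    have h: "0 < h" "h < d" "h < e" using d e by (auto simp: h_def)
    have "\<exists>z. x < z \<and> z < x + h \<and> f (x + h) - f x = (x + h - x) * f1 z"
      using x h by (intro MVT2 f1) (auto simp: d_def)
    then obtain z where z: "x < z" "z < x + h" "f (x + h) - f x = h * f1 z" by auto
    have "f1 z < 0" using e(2)[of "z - x"] z h f1x by auto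
    then have "h * f1 z < 0" using h by (simp add: mult_pos_neg)
    moreover have "f x \<le> f (x + h)" using x h by (intro min) (auto simp: d_def)
    ultimately show False using z by simp
  qed
qed

text \<open>At a negative interior minimum \<open>k * D\<close> is strictly negative and
  \<open>- \<epsilon> * D2\<close> is nonpositive, against \<open>super\<close>.\<close>

lemma elliptic_comparison:
  fixes D D1 D2 k :: "real \<Rightarrow> real"
  assumes L: "0 < L" and \<epsilon>: "0 < \<epsilon>" and cont: "continuous_on {0..L} D"
    and bd: "0 \<le> D 0" "0 \<le> D L"
    and D1: "\<And>x. x \<in> {0<..<L} \<Longrightarrow> (D has_real_derivative D1 x) (at x)"
    and D2: "\<And>x. x \<in> {0<..<L} \<Longrightarrow> (D1 has_real_derivative D2 x) (at x)"
    and k: "\<And>x. x \<in> {0<..<L} \<Longrightarrow> 0 < k x"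
    and super: "\<And>x. x \<in> {0<..<L} \<Longrightarrow> 0 \<le> k x * D x - \<epsilon> * D2 x"
    and x: "x \<in> {0..L}"
  shows "0 \<le> D x"
proof -
  obtain m where m: "m \<in> {0..L}" "\<And>y. y \<in> {0..L} \<Longrightarrow> D m \<le> D y"
    using continuous_attains_inf[OF compact_Icc _ cont] L by auto
  have "0 \<le> D m"
  proof (rule ccontr)
    assume neg: "\<not> 0 \<le> D m"
    then have "m \<noteq> 0" "m \<noteq> L" using bd by auto
    then have mi: "m \<in> {0<..<L}" using m(1) by auto
    have "0 \<le> D2 m"
      by (rule interior_min_second_derivative(2)[OF mi m(2) D1 D2[OF mi]])
    then have "0 \<le> \<epsilon> * D2 m" using \<epsilon> by simp
    moreover have "k m * D m < 0" using k[OF mi] neg by (simp add: mult_pos_neg)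
    ultimately show False using super[OF mi] by linarith
  qed
  then show ?thesis using m(2)[OF x] by linarith
qed

text \<open>The value of \<open>z\<close> outside \<open>[0,L]\<close> is fixed by clamping, so that solutions are unique as elements of
  the Banach space of bounded continuous functions on the line.\<close>

definition bvp :: "real \<Rightarrow> real \<Rightarrow> (real \<Rightarrow> real) \<Rightarrow> real \<Rightarrow> (real \<Rightarrow>\<^sub>C real) \<Rightarrow> (real \<Rightarrow> real) \<Rightarrow> bool" where
  "bvp L \<epsilon> p r z f \<longleftrightarrow> (\<forall>x. z x = z (clamp 0 L x)) \<and> z 0 = 0 \<and> z L = 0 \<and>
     (\<exists>z1 z2. \<forall>x\<in>{0..L}. (apply_bcontfun z has_real_derivative z1 x) (at x within {0..L}) \<and>
        (z1 has_real_derivative z2 x) (at x within {0..L}) \<and> r * z x + p x * z x - \<epsilon> * z2 x = f x)"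

lemma bvpE:
  assumes "bvp L \<epsilon> p r z f"
  obtains z1 z2 where "\<And>x. z x = z (clamp 0 L x)" "z 0 = 0" "z L = 0"
    "\<And>x. x \<in> {0..L} \<Longrightarrow> (apply_bcontfun z has_real_derivative z1 x) (at x within {0..L})"
    "\<And>x. x \<in> {0..L} \<Longrightarrow> (z1 has_real_derivative z2 x) (at x within {0..L})"
    "\<And>x. x \<in> {0..L} \<Longrightarrow> r * z x + p x * z x - \<epsilon> * z2 x = f x"
  using assms unfolding bvp_def by metis

lemma bvpI:
  fixes z :: "real \<Rightarrow>\<^sub>C real"
  assumes "\<And>x. z x = z (clamp 0 L x)" "z 0 = 0" "z L = 0"
    "\<And>x. x \<in> {0..L} \<Longrightarrow> (apply_bcontfun z has_real_derivative z1 x) (at x within {0..L})"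
    "\<And>x. x \<in> {0..L} \<Longrightarrow> (z1 has_real_derivative z2 x) (at x within {0..L})"
    "\<And>x. x \<in> {0..L} \<Longrightarrow> r * z x + p x * z x - \<epsilon> * z2 x = f x"
  shows "bvp L \<epsilon> p r z f"
  using assms unfolding bvp_def by metis

lemma bvp_lincomb:
  assumes "bvp L \<epsilon> p r z f" "bvp L \<epsilon> p r y g"
  shows "bvp L \<epsilon> p r (\<alpha> *\<^sub>R z + \<beta> *\<^sub>R y) (\<lambda>x. \<alpha> * f x + \<beta> * g x)"
proof -
  obtain z1 z2 where z: "\<And>x. z x = z (clamp 0 L x)" "z 0 = 0" "z L = 0"
    "\<And>x. x \<in> {0..L} \<Longrightarrow> (apply_bcontfun z has_real_derivative z1 x) (at x within {0..L})"
    "\<And>x. x \<in> {0..L} \<Longrightarrow> (z1 has_real_derivative z2 x) (at x within {0..L})"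
    "\<And>x. x \<in> {0..L} \<Longrightarrow> r * z x + p x * z x - \<epsilon> * z2 x = f x"
    by (rule bvpE[OF assms(1)]) (rule that)
  obtain y1 y2 where y: "\<And>x. y x = y (clamp 0 L x)" "y 0 = 0" "y L = 0"
    "\<And>x. x \<in> {0..L} \<Longrightarrow> (apply_bcontfun y has_real_derivative y1 x) (at x within {0..L})"
    "\<And>x. x \<in> {0..L} \<Longrightarrow> (y1 has_real_derivative y2 x) (at x within {0..L})"
    "\<And>x. x \<in> {0..L} \<Longrightarrow> r * y x + p x * y x - \<epsilon> * y2 x = g x"
    by (rule bvpE[OF assms(2)]) (rule that)
  have eq: "apply_bcontfun (\<alpha> *\<^sub>R z + \<beta> *\<^sub>R y) = (\<lambda>x. \<alpha> * z x + \<beta> * y x)"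
    by (auto simp: fun_eq_iff)
  show ?thesis
  proof (rule bvpI[where ?z1.0="\<lambda>x. \<alpha> * z1 x + \<beta> * y1 x" and ?z2.0="\<lambda>x. \<alpha> * z2 x + \<beta> * y2 x"], unfold eq)
    fix x
    show "\<alpha> * z x + \<beta> * y x = \<alpha> * z (clamp 0 L x) + \<beta> * y (clamp 0 L x)"
      using z(1)[of x] y(1)[of x] by simp
    assume x: "x \<in> {0..L}"
    show "((\<lambda>x. \<alpha> * z x + \<beta> * y x) has_real_derivative \<alpha> * z1 x + \<beta> * y1 x) (at x within {0..L})"
      by (intro DERIV_add DERIV_cmult z y x)
    show "((\<lambda>x. \<alpha> * z1 x + \<beta> * y1 x) has_real_derivative \<alpha> * z2 x + \<beta> * y2 x) (at x within {0..L})"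
      by (intro DERIV_add DERIV_cmult z y x)
    show "r * (\<alpha> * z x + \<beta> * y x) + p x * (\<alpha> * z x + \<beta> * y x) - \<epsilon> * (\<alpha> * z2 x + \<beta> * y2 x) = \<alpha> * f x + \<beta> * g x"
      unfolding z(6)[OF x, symmetric] y(6)[OF x, symmetric] by (simp add: algebra_simps)
  qed (use z(2,3) y(2,3) in simp_all)
qed

section \<open>Barriers, the resolvent bound and uniqueness\<close>

lemma has_real_derivative_within_Icc_interior:
  assumes "x \<in> {l<..<r}" "(f has_real_derivative f') (at x within {l..r})"
  shows "(f has_real_derivative f') (at x)"
  using assms by (metis at_within_Icc_at greaterThanLessThan_iff)

text \<open>Two kinds of barrier are used: constants for the resolvent bound, and an exponential
  boundary layer for control proportional to the distance from 0.\<close>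

lemma bvp_le_barrier:
  assumes z: "bvp L \<epsilon> p r z f" and L: "0 < L" and \<epsilon>: "0 < \<epsilon>" and r: "0 < r"
    and p: "\<And>x. x \<in> {0..L} \<Longrightarrow> 0 \<le> p x"
    and \<beta>1: "\<And>x. (\<beta> has_real_derivative \<beta>1 x) (at x)" and \<beta>2: "\<And>x. (\<beta>1 has_real_derivative \<beta>2 x) (at x)"
    and bd: "0 \<le> \<beta> 0" "0 \<le> \<beta> L"
    and super: "\<And>x. x \<in> {0..L} \<Longrightarrow> f x \<le> (r + p x) * \<beta> x - \<epsilon> * \<beta>2 x"
    and x: "x \<in> {0..L}"
  shows "z x \<le> \<beta> x"
proof -
  obtain z1 z2 where z0: "\<And>x. z x = z (clamp 0 L x)" and z: "z 0 = 0" "z L = 0"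
    "\<And>x. x \<in> {0..L} \<Longrightarrow> (apply_bcontfun z has_real_derivative z1 x) (at x within {0..L})"
    "\<And>x. x \<in> {0..L} \<Longrightarrow> (z1 has_real_derivative z2 x) (at x within {0..L})"
    "\<And>x. x \<in> {0..L} \<Longrightarrow> r * z x + p x * z x - \<epsilon> * z2 x = f x"
    by (rule bvpE[OF z]) (rule that)
  have "0 \<le> \<beta> x - z x"
  proof (rule elliptic_comparison[where D="\<lambda>x. \<beta> x - z x" and ?D1.0="\<lambda>x. \<beta>1 x - z1 x" and ?D2.0="\<lambda>x. \<beta>2 x - z2 x"
        and k="\<lambda>x. r + p x", OF L \<epsilon> _ _ _ _ _ _ _ x])
    have "continuous_on {0..L} \<beta>"
      by (rule DERIV_continuous_on) (rule has_field_derivative_at_within[OF \<beta>1])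
    then show "continuous_on {0..L} (\<lambda>x. \<beta> x - z x)" by (intro continuous_intros) auto
    fix y assume y: "y \<in> {0<..<L}"
    then have y': "y \<in> {0..L}" by auto
    show "((\<lambda>x. \<beta> x - z x) has_real_derivative \<beta>1 y - z1 y) (at y)"
      by (rule DERIV_diff[OF \<beta>1 has_real_derivative_within_Icc_interior[OF y z(3)[OF y']]])
    show "((\<lambda>x. \<beta>1 x - z1 x) has_real_derivative \<beta>2 y - z2 y) (at y)"
      by (rule DERIV_diff[OF \<beta>2 has_real_derivative_within_Icc_interior[OF y z(4)[OF y']]])
    show "0 < r + p y" using p[OF y'] r by simp
    show "0 \<le> (r + p y) * (\<beta> y - z y) - \<epsilon> * (\<beta>2 y - z2 y)"
      using super[OF y'] unfolding z(5)[OF y', symmetric] by (simp add: algebra_simps)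
  qed (use z(1,2) bd in simp_all)
  then show ?thesis by simp
qed

text \<open>Zero-order terms may be moved into the source. This serves both the change of
  \<open>r\<close> in the resolvent identity and the treatment of \<open>p\<close> as a
  perturbation.\<close>

lemma bvp_shift:
  assumes "bvp L \<epsilon> p r z f"
    and eq: "\<And>x. x \<in> {0..L} \<Longrightarrow> f' x = f x + (r' + p' x - r - p x) * z x"
  shows "bvp L \<epsilon> p' r' z f'"
proof -
  obtain z1 z2 where z: "\<And>x. z x = z (clamp 0 L x)" "z 0 = 0" "z L = 0"
    "\<And>x. x \<in> {0..L} \<Longrightarrow> (apply_bcontfun z has_real_derivative z1 x) (at x within {0..L})"
    "\<And>x. x \<in> {0..L} \<Longrightarrow> (z1 has_real_derivative z2 x) (at x within {0..L})"
    "\<And>x. x \<in> {0..L} \<Longrightarrow> r * z x + p x * z x - \<epsilon> * z2 x = f x"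
    by (rule bvpE[OF assms(1)]) (rule that)
  have "r' * z x + p' x * z x - \<epsilon> * z2 x = f' x" if "x \<in> {0..L}" for x
    unfolding eq[OF that] z(6)[OF that, symmetric] by (simp add: algebra_simps)
  with z(1-5) show ?thesis by (rule bvpI)
qed

lemma bvp_minus: "bvp L \<epsilon> p r z f \<Longrightarrow> bvp L \<epsilon> p r (- z) (\<lambda>x. - f x)"
  using bvp_lincomb[of L \<epsilon> p r z f z f "-1" 0] by simp

text \<open>Since \<open>p\<close> is nonnegative, the constant \<open>F / r\<close> is a barrier.
  The resulting bound \<open>1 / r\<close> is the one that the Yosida approximation
  requires.\<close>

lemma bvp_norm_le:
  assumes z: "bvp L \<epsilon> p r z f" and L: "0 < L" and \<epsilon>: "0 < \<epsilon>" and r: "0 < r"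
    and p: "\<And>x. x \<in> {0..L} \<Longrightarrow> 0 \<le> p x"
    and F: "\<And>x. x \<in> {0..L} \<Longrightarrow> \<bar>f x\<bar> \<le> F"
  shows "norm z \<le> F / r"
proof (rule norm_bound)
  fix x
  define y where "y = clamp 0 L x"
  have y: "y \<in> {0..L}" using clamp_in_interval[of 0 L x] L by (simp add: y_def)
  have F0: "0 \<le> F" using F[of 0] L by auto
  have *: "f x \<le> (r + p x) * (F / r) - \<epsilon> * 0" "- f x \<le> (r + p x) * (F / r) - \<epsilon> * 0" if "x \<in> {0..L}" for x
  proof -
    have "0 \<le> p x * (F / r)" using p[OF that] F0 r by simp
    moreover have "(r + p x) * (F / r) = F + p x * (F / r)" using r by (simp add: field_simps)
    ultimately show "f x \<le> (r + p x) * (F / r) - \<epsilon> * 0" "- f x \<le> (r + p x) * (F / r) - \<epsilon> * 0"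
      using F[OF that] by linarith+
  qed
  have c: "((\<lambda>_. c) has_real_derivative 0) (at y)" for c y :: real by simp
  have Fr: "0 \<le> F / r" using F0 r by simp
  have "z y \<le> F / r"
    by (rule bvp_le_barrier[where \<beta>="\<lambda>_. F / r" and ?\<beta>1.0="\<lambda>_. 0" and ?\<beta>2.0="\<lambda>_. 0", OF z L \<epsilon> r p c c Fr Fr *(1) y])
  moreover have "(- z) y \<le> F / r"
    by (rule bvp_le_barrier[where \<beta>="\<lambda>_. F / r" and ?\<beta>1.0="\<lambda>_. 0" and ?\<beta>2.0="\<lambda>_. 0", OF bvp_minus[OF z] L \<epsilon> r p c c Fr Fr *(2) y])
  moreover have "z x = z y" using z unfolding bvp_def y_def by blast
  ultimately show "norm (z x) \<le> F / r" by simp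
qed

lemma bvp_unique:
  assumes "bvp L \<epsilon> p r z f" "bvp L \<epsilon> p r y f" "0 < L" "0 < \<epsilon>" "0 < r"
    and "\<And>x. x \<in> {0..L} \<Longrightarrow> 0 \<le> p x"
  shows "z = y"
proof -
  have "bvp L \<epsilon> p r (z - y) (\<lambda>x. 0)"
    using bvp_lincomb[OF assms(1,2), of 1 "-1"] by simp
  from bvp_norm_le[OF this assms(3-6), of 0] show ?thesis by simp
qed

text \<open>Variation of constants: \<open>z\<close> is a multiple of \<open>sinh (k * x)\<close>
  minus the convolution of \<open>f\<close> with \<open>c * sinh (k * (x - s))\<close>. The addition
  theorem splits the kernel, so that the integrands of \<open>C\<close> and \<open>S\<close> do not
  depend on \<open>x\<close>.\<close>

lemma bvp_exists_constant:
  assumes L: "0 < L" and \<epsilon>: "0 < \<epsilon>" and r: "0 < r" and f: "continuous_on {0..L} f"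
  shows "\<exists>z. bvp L \<epsilon> (\<lambda>_. 0) r z f"
proof -
  define k where "k = sqrt (r / \<epsilon>)"
  have k: "0 < k" "\<epsilon> * (k * k) = r" using r \<epsilon> by (auto simp: k_def)
  define C where "C x = integral {0..x} (\<lambda>s. cosh (k * s) * f s)" for x
  define S where "S x = integral {0..x} (\<lambda>s. sinh (k * s) * f s)" for x
  have C: "(C has_real_derivative cosh (k * x) * f x) (at x within {0..L})" if "x \<in> {0..L}" for x
    unfolding C_def using that by (intro integral_has_real_derivative continuous_intros f)
  have S: "(S has_real_derivative sinh (k * x) * f x) (at x within {0..L})" if "x \<in> {0..L}" for x
    unfolding S_def using that by (intro integral_has_real_derivative continuous_intros f)
  define c where "c = 1 / (\<epsilon> * k)"
  have c: "c * k * \<epsilon> = 1" using k \<epsilon> by (simp add: c_def)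
  \<comment> \<open>Both parts of \<open>z\<close> vanish at 0; this value of \<alpha> makes
    \<open>z\<close> vanish at \<open>L\<close>.\<close>
  define \<alpha> where "\<alpha> = c * (sinh (k * L) * C L - cosh (k * L) * S L) / sinh (k * L)"
  define z where "z x = \<alpha> * sinh (k * x) - c * (sinh (k * x) * C x - cosh (k * x) * S x)" for x
  define z1 where "z1 x = \<alpha> * k * cosh (k * x) - c * k * (cosh (k * x) * C x - sinh (k * x) * S x)" for x
  define z2 where "z2 x = k * k * z x - c * k * f x" for x
  have cs: "cosh y * cosh y = 1 + sinh y * sinh y" for y :: real
    using cosh_square_eq[of y] by (simp add: power2_eq_square)
  have sh: "((\<lambda>x. sinh (k * x)) has_real_derivative cosh (k * x) * k) (at x within {0..L})" for x
    by (rule derivative_eq_intros refl | simp)+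
  have ch: "((\<lambda>x. cosh (k * x)) has_real_derivative sinh (k * x) * k) (at x within {0..L})" for x
    by (rule derivative_eq_intros refl | simp)+
  have d1: "(z has_real_derivative z1 x) (at x within {0..L})" if "x \<in> {0..L}" for x
    unfolding z_def
    by (rule DERIV_cong[OF DERIV_diff[OF DERIV_cmult[OF sh]
          DERIV_cmult[OF DERIV_diff[OF DERIV_mult[OF sh C[OF that]] DERIV_mult[OF ch S[OF that]]]]]])
      (simp add: z1_def algebra_simps)
  have d2: "(z1 has_real_derivative z2 x) (at x within {0..L})" if "x \<in> {0..L}" for x
  proof -
    have "c * k * f x * (cosh (k * x) * cosh (k * x)) = c * k * f x * (1 + sinh (k * x) * sinh (k * x))"
      by (simp only: cs)
    then show ?thesis
      unfolding z1_def
      by (intro DERIV_cong[OF DERIV_diff[OF DERIV_cmult[OF ch]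
          DERIV_cmult[OF DERIV_diff[OF DERIV_mult[OF ch C[OF that]] DERIV_mult[OF sh S[OF that]]]]]])
        (simp add: z2_def z_def algebra_simps)
  qed
  have cont: "continuous_on {0..L} z" using d1 by (rule DERIV_continuous_on)
  then have "continuous_on (cbox 0 L) z" by simp
  then obtain g :: "real \<Rightarrow>\<^sub>C real" where g: "\<And>x. x \<in> cbox 0 L \<Longrightarrow> g x = z x" "\<And>x. g x = z (clamp 0 L x)"
    by (rule continuous_on_cbox_bcontfunE) (rule that)
  have "bvp L \<epsilon> (\<lambda>_. 0) r g f"
  proof (rule bvpI[where ?z1.0=z1 and ?z2.0=z2])
    fix x
    have "clamp 0 L x \<in> cbox 0 L" using L by (intro clamp_in_interval) simp
    then show "g x = g (clamp 0 L x)" using g by metis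
    have "z 0 = 0" by (simp add: z_def C_def S_def)
    then show "g 0 = 0" using g(1)[of 0] L by simp
    have "sinh (k * L) \<noteq> 0" using k L by simp
    then have "z L = 0" by (simp add: z_def \<alpha>_def)
    then show "g L = 0" using g(1)[of L] L by simp
    assume x: "x \<in> {0..L}"
    show "(apply_bcontfun g has_real_derivative z1 x) (at x within {0..L})"
      by (rule has_field_derivative_transform_within[OF d1[OF x] zero_less_one x]) (use g(1) in auto)
    show "(z1 has_real_derivative z2 x) (at x within {0..L})" by (rule d2[OF x])
    have "\<epsilon> * z2 x = (\<epsilon> * (k * k)) * z x - (c * k * \<epsilon>) * f x"
      by (simp add: z2_def algebra_simps)
    then show "r * g x + 0 * g x - \<epsilon> * z2 x = f x"
      using g(1)[of x] x k c by simp
  qed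
  then show ?thesis by blast
qed

text \<open>With \<open>p * v\<close> moved into the source, the solution map for
  \<open>p = 0\<close> is a contraction with factor \<open>P / r\<close>; hence the restriction
  \<open>P < r\<close> on all resolvents.\<close>

lemma bvp_exists:
  assumes L: "0 < L" and \<epsilon>: "0 < \<epsilon>" and r: "P < r" and f: "continuous_on {0..L} f"
    and p: "continuous_on {0..L} p" "\<And>x. x \<in> {0..L} \<Longrightarrow> 0 \<le> p x" "\<And>x. x \<in> {0..L} \<Longrightarrow> p x \<le> P"
  shows "\<exists>z. bvp L \<epsilon> p r z f"
proof -
  have P0: "0 \<le> P" using p(2,3)[of 0] L by auto
  then have r0: "0 < r" using r by simp
  define \<Phi> where "\<Phi> v = (SOME z. bvp L \<epsilon> (\<lambda>_. 0) r z (\<lambda>x. f x - p x * apply_bcontfun v x))" for v :: "real \<Rightarrow>\<^sub>C real"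
  have \<Phi>: "bvp L \<epsilon> (\<lambda>_. 0) r (\<Phi> v) (\<lambda>x. f x - p x * v x)" for v
    unfolding \<Phi>_def by (rule someI_ex, rule bvp_exists_constant) (auto intro!: L \<epsilon> r0 continuous_intros f p(1))
  have "dist (\<Phi> v) (\<Phi> w) \<le> (P / r) * dist v w" for v w
  proof -
    have "bvp L \<epsilon> (\<lambda>_. 0) r (\<Phi> v - \<Phi> w) (\<lambda>x. (f x - p x * v x) - (f x - p x * w x))"
      using bvp_lincomb[OF \<Phi>[of v] \<Phi>[of w], of 1 "-1"] by simp
    then have "norm (\<Phi> v - \<Phi> w) \<le> (P * norm (v - w)) / r"
    proof (rule bvp_norm_le)
      fix x assume x: "x \<in> {0..L}"
      have "\<bar>(f x - p x * v x) - (f x - p x * w x)\<bar> = p x * \<bar>(v - w) x\<bar>"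
        using p(2)[OF x] by (simp add: abs_mult abs_minus_commute flip: right_diff_distrib)
      also have "\<dots> \<le> P * norm (v - w)"
        using p(2,3)[OF x] P0 norm_bounded[of "v - w" x] by (intro mult_mono) auto
      finally show "\<bar>(f x - p x * v x) - (f x - p x * w x)\<bar> \<le> P * norm (v - w)" .
    qed (use L \<epsilon> r0 in auto)
    then show ?thesis by (simp add: dist_norm)
  qed
  then have "\<exists>!v. \<Phi> v = v"
    using P0 r r0 by (intro banach_fix_type[of "P / r"]) auto
  then obtain v where "\<Phi> v = v" by blast
  with \<Phi>[of v] have "bvp L \<epsilon> (\<lambda>_. 0) r v (\<lambda>x. f x - p x * v x)" by simp
  then have "bvp L \<epsilon> p r v f"
    by (rule bvp_shift) (simp add: algebra_simps)
  then show ?thesis ..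
qed

instance bcontfun :: (metric_space, banach) banach ..

text \<open>Required to form \<open>endo\<close> over this space: adding small nonzero constants
  shows that no element is isolated.\<close>

instance bcontfun :: (metric_space, real_normed_algebra_1) perfect_space
proof
  fix f :: "'a \<Rightarrow>\<^sub>C 'b"
  show "\<not> open {f}"
  proof
    assume "open {f}"
    then obtain e where e: "e > 0" "ball f e \<subseteq> {f}" by (meson insertI1 openE)
    define g :: "'a \<Rightarrow>\<^sub>C 'b" where "g = const_bcontfun ((e / 2) *\<^sub>R 1)"
    have g: "apply_bcontfun g x = (e / 2) *\<^sub>R 1" for x by (simp add: g_def const_bcontfun.rep_eq)
    have "norm g \<le> e / 2" using e by (intro norm_bound) (simp add: g)
    then have "f + g \<in> ball f e" using e by (simp add: dist_norm)
    then have "g = 0" using e by auto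
    then show False using g[of undefined] e by simp
  qed
qed

definition dirichlet_resolvent :: "real \<Rightarrow> real \<Rightarrow> (real \<Rightarrow> real) \<Rightarrow> real \<Rightarrow> (real \<Rightarrow>\<^sub>C real) endo" where
  "dirichlet_resolvent L \<epsilon> p r = Endo (Blinfun (\<lambda>f. THE z. bvp L \<epsilon> p r z (apply_bcontfun f)))"

locale dirichlet =
  fixes L \<epsilon> P :: real and p :: "real \<Rightarrow> real"
  assumes L: "0 < L" and \<epsilon>: "0 < \<epsilon>" and p_cont: "continuous_on {0..L} p"
    and p_nonneg: "\<And>x. x \<in> {0..L} \<Longrightarrow> 0 \<le> p x" and p_le: "\<And>x. x \<in> {0..L} \<Longrightarrow> p x \<le> P"
begin

lemma bound_nonneg: "0 \<le> P"
  using p_nonneg[of 0] p_le[of 0] L by auto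

lemma bvp_resolvent:
  assumes "P < r" shows "bvp L \<epsilon> p r (op_of (dirichlet_resolvent L \<epsilon> p r) f) f"
    and norm_resolvent: "norm (dirichlet_resolvent L \<epsilon> p r) \<le> 1 / r"
proof -
  have r0: "0 < r" using assms bound_nonneg by simp
  define S where "S f = (THE z. bvp L \<epsilon> p r z (apply_bcontfun f))" for f
  have S: "bvp L \<epsilon> p r (S f) f" for f
  proof -
    obtain z where z: "bvp L \<epsilon> p r z f"
      using bvp_exists[OF L \<epsilon> assms _ p_cont p_nonneg p_le, of f] by auto
    show ?thesis
      unfolding S_def
      by (rule theI[where P="\<lambda>z. bvp L \<epsilon> p r z (apply_bcontfun f)" and a=z])
        (rule z, rule bvp_unique[OF _ z L \<epsilon> r0 p_nonneg], assumption)
  qed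
  have S_eq: "S f = z" if "bvp L \<epsilon> p r z (apply_bcontfun f)" for f z
    by (rule bvp_unique[OF S that L \<epsilon> r0 p_nonneg])
  have bnd: "norm (S f) \<le> 1 / r * norm f" for f
    using bvp_norm_le[OF S[of f] L \<epsilon> r0 p_nonneg, of "norm f"] norm_bounded[of f] by simp
  have "bounded_linear S"
  proof (rule bounded_linear_intro[where K="1 / r"])
    show "S (f + g) = S f + S g" for f g
      using bvp_lincomb[OF S[of f] S[of g], of 1 1] by (intro S_eq) simp
    show "S (c *\<^sub>R f) = c *\<^sub>R S f" for f c
      using bvp_lincomb[OF S[of f] S[of f], of c 0] by (intro S_eq) simp
    show "norm (S f) \<le> norm f * (1 / r)" for f using bnd[of f] by (simp add: mult.commute)
  qed
  then have ap: "op_of (dirichlet_resolvent L \<epsilon> p r) f = S f" for f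
    unfolding dirichlet_resolvent_def S_def[symmetric] by (simp add: Endo_inverse bounded_linear_Blinfun_apply)
  then show "bvp L \<epsilon> p r (op_of (dirichlet_resolvent L \<epsilon> p r) f) f" using S by simp
  show "norm (dirichlet_resolvent L \<epsilon> p r) \<le> 1 / r"
    unfolding norm_endo.rep_eq by (rule norm_blinfun_bound) (use r0 bnd ap in auto)
qed

sublocale resolvent_family "dirichlet_resolvent L \<epsilon> p" P
proof
  show "0 \<le> P" by (rule bound_nonneg)
  show "norm (dirichlet_resolvent L \<epsilon> p r) \<le> 1 / r" if "P < r" for r
    by (rule norm_resolvent[OF that])
  fix r s assume r: "P < r" and s: "P < s"
  let ?R = "dirichlet_resolvent L \<epsilon> p"
  have "op_of (?R r - ?R s) f = op_of ((s - r) *\<^sub>R (?R r * ?R s)) f" for f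
  proof -
    \<comment> \<open>By the shift, \<open>u\<close> solves the problem with parameter
      \<open>r\<close> and source \<open>f + (r - s) u\<close>; adding \<open>(s - r)\<close> times
      the resolvent of \<open>u\<close> restores the source \<open>f\<close>.\<close>
    define u where "u = op_of (?R s) f"
    have "bvp L \<epsilon> p s u f" unfolding u_def by (rule bvp_resolvent[OF s])
    then have "bvp L \<epsilon> p r u (\<lambda>x. f x + (r - s) * u x)"
      by (rule bvp_shift) (simp add: algebra_simps)
    from bvp_lincomb[OF this bvp_resolvent(1)[OF r, of u], of 1 "s - r"]
    have "bvp L \<epsilon> p r (u + (s - r) *\<^sub>R op_of (?R r) u) f" by (simp add: algebra_simps)
    from bvp_unique[OF this bvp_resolvent(1)[OF r] L \<epsilon> _ p_nonneg]
    have "u + (s - r) *\<^sub>R op_of (?R r) u = op_of (?R r) f" using r bound_nonneg by simp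
    from this[symmetric] show ?thesis unfolding u_def by simp
  qed
  then show "?R r - ?R s = (s - r) *\<^sub>R (?R r * ?R s)"
    by (metis blinfun_eqI op_of_inject)
qed

end

section \<open>Classical solutions of the adjoint equation\<close>

text \<open>The time derivative is a uniform limit of difference quotients: this yields pointwise
  derivatives for the comparison principle as well as the \<open>L2\<close> limit in
  \<open>adjoint_sol\<close>. The coefficient \<open>c\<close> is kept general, because the
  comparison is done for a shifted one.\<close>

definition classical_sol ::
  "real \<Rightarrow> real \<Rightarrow> real \<Rightarrow> (real \<Rightarrow> real) \<Rightarrow> (real \<Rightarrow> real) \<Rightarrow> (real \<Rightarrow> real \<Rightarrow> real) \<Rightarrow>
     (real \<Rightarrow> real \<Rightarrow> real) \<Rightarrow> (real \<Rightarrow> real \<Rightarrow> real) \<Rightarrow> bool" where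
  "classical_sol L T \<epsilon> a c u u1 u2 \<longleftrightarrow> (\<forall>t\<in>{0..T}. u t 0 = 0 \<and> u t L = 0 \<and> continuous_on {0..L} (u2 t) \<and>
     (\<forall>x\<in>{0..L}. (u t has_real_derivative u1 t x) (at x within {0..L}) \<and>
        (u1 t has_real_derivative u2 t x) (at x within {0..L})) \<and>
     uniform_limit {0..L} (\<lambda>s x. (u s x - u t x) / (s - t))
       (\<lambda>x. \<epsilon> * u2 t x + a x * u1 t x + c x * u t x) (at t within {0..T}))"

section \<open>Existence of classical solutions\<close>

lemma continuous_on_Icc_le:
  fixes f :: "real \<Rightarrow> real"
  assumes "continuous_on {l..r} f"
  obtains B where "0 < B" "\<And>x. x \<in> {l..r} \<Longrightarrow> \<bar>f x\<bar> \<le> B"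
proof -
  have "bounded (f ` {l..r})" by (intro compact_imp_bounded compact_continuous_image assms compact_Icc)
  then obtain B where "0 < B" "\<And>y. y \<in> f ` {l..r} \<Longrightarrow> norm y \<le> B" by (auto simp: bounded_pos)
  then show thesis by (intro that[of B]) auto
qed

lemma bcontfun_of_continuous_on:
  fixes f :: "real \<Rightarrow> real"
  assumes "0 < L" "continuous_on {0..L} f"
  obtains g :: "real \<Rightarrow>\<^sub>C real" where "\<And>x. x \<in> {0..L} \<Longrightarrow> g x = f x" "\<And>x. g x = g (clamp 0 L x)"
proof -
  from assms have "continuous_on (cbox 0 L) f" by simp
  then obtain g :: "real \<Rightarrow>\<^sub>C real" where g: "\<And>x. x \<in> cbox 0 L \<Longrightarrow> g x = f x" "\<And>x. g x = f (clamp 0 L x)"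
    by (rule continuous_on_cbox_bcontfunE) (rule that)
  show thesis
  proof (rule that)
    show "g x = f x" if "x \<in> {0..L}" for x using g(1)[of x] that by simp
    have "clamp 0 L x \<in> cbox 0 L" for x using assms by (intro clamp_in_interval) simp
    then show "g x = g (clamp 0 L x)" for x using g by metis
  qed
qed

lemma has_vector_derivative_imp_uniform_quotient:
  fixes z :: "real \<Rightarrow> real \<Rightarrow>\<^sub>C real"
  assumes "(z has_vector_derivative D) (at t within S)"
  shows "uniform_limit UNIV (\<lambda>s x. (z s x - z t x) / (s - t)) D (at t within S)"
proof (rule uniform_limitI)
  fix e :: real assume e: "0 < e"
  have "((\<lambda>s. norm (z s - z t - (s - t) *\<^sub>R D) / norm (s - t)) \<longlongrightarrow> 0) (at t within S)"
    using assms by (simp add: has_vector_derivative_def has_derivative_iff_norm)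
  from order_tendstoD(2)[OF this e]
  have "\<forall>\<^sub>F s in at t within S. norm (z s - z t - (s - t) *\<^sub>R D) / norm (s - t) < e" .
  moreover have "\<forall>\<^sub>F s in at t within S. s \<noteq> t" by (simp add: eventually_at_filter)
  ultimately show "\<forall>\<^sub>F s in at t within S. \<forall>x\<in>UNIV. dist ((z s x - z t x) / (s - t)) (D x) < e"
  proof eventually_elim
    case (elim s)
    show ?case
    proof
      fix x
      have "(z s x - z t x) / (s - t) - D x = (z s - z t - (s - t) *\<^sub>R D) x / (s - t)"
        using elim by (simp add: field_simps)
      then have "dist ((z s x - z t x) / (s - t)) (D x) = norm ((z s - z t - (s - t) *\<^sub>R D) x) / norm (s - t)"
        by (simp add: dist_real_def)
      also have "\<dots> \<le> norm (z s - z t - (s - t) *\<^sub>R D) / norm (s - t)"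
        by (intro divide_right_mono norm_bounded) auto
      finally show "dist ((z s x - z t x) / (s - t)) (D x) < e" using elim by linarith
    qed
  qed
qed

context dirichlet
begin

text \<open>The third power of the resolvent makes the initial value regular enough for
  \<open>evolution\<close>; for large \<open>r\<close> it is close to \<open>\<zeta>\<close>, and since the defect solves a boundary value
  problem, the barrier \<open>1 - exp (- \<kappa> x)\<close> controls it linearly near the boundary.\<close>

lemma dirichlet_evolution:
  fixes \<zeta> \<zeta>1 \<zeta>2 :: "real \<Rightarrow> real"
  assumes T: "0 \<le> T" and \<delta>: "0 < \<delta>"
    and \<zeta>0: "\<zeta> 0 = 0" "\<zeta> L = 0"
    and \<zeta>1: "\<And>x. x \<in> {0..L} \<Longrightarrow> (\<zeta> has_real_derivative \<zeta>1 x) (at x within {0..L})"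
    and \<zeta>2: "\<And>x. x \<in> {0..L} \<Longrightarrow> (\<zeta>1 has_real_derivative \<zeta>2 x) (at x within {0..L})"
    and \<zeta>2c: "continuous_on {0..L} \<zeta>2"
  obtains r z w where "P < r" "\<And>t. bvp L \<epsilon> p r (z t) (apply_bcontfun (w t))"
    "\<And>t. t \<in> {0..T} \<Longrightarrow> (z has_vector_derivative r *\<^sub>R z t - w t) (at t within {0..T})"
    "\<And>x. x \<in> {0..L} \<Longrightarrow> \<bar>z 0 x - \<zeta> x\<bar> \<le> \<delta> * x"
proof -
  let ?R = "dirichlet_resolvent L \<epsilon> p"
  have cont: "continuous_on {0..L} \<zeta>" using \<zeta>1 by (rule DERIV_continuous_on)
  obtain Z :: "real \<Rightarrow>\<^sub>C real" where Z: "\<And>x. x \<in> {0..L} \<Longrightarrow> Z x = \<zeta> x" "\<And>x. Z x = Z (clamp 0 L x)"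
    by (rule bcontfun_of_continuous_on[OF L cont]) (rule that)
  have "continuous_on {0..L} (\<lambda>x. p x * \<zeta> x - \<epsilon> * \<zeta>2 x)"
    by (intro continuous_intros p_cont cont \<zeta>2c)
  then obtain A :: "real \<Rightarrow>\<^sub>C real" where A: "\<And>x. x \<in> {0..L} \<Longrightarrow> A x = p x * \<zeta> x - \<epsilon> * \<zeta>2 x"
      "\<And>x. A x = A (clamp 0 L x)"
    by (rule bcontfun_of_continuous_on[OF L]) (rule that)
  \<comment> \<open>The source \<open>h\<close> of the defect is a sum of three terms of norm at
    most \<open>norm A\<close>. The barrier for \<open>F\<close> has slope
    \<open>F / sqrt (r * \<epsilon>)\<close> at 0, and \<open>r\<close> is chosen to make this at
    most \<delta>.\<close>
  define F where "F = 3 * norm A"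
  define r where "r = P + 1 + (F / \<delta>)\<^sup>2 / \<epsilon>"
  have r: "P < r" and r1: "(F / \<delta>)\<^sup>2 \<le> r * \<epsilon>"
  proof -
    have "0 \<le> (F / \<delta>)\<^sup>2 / \<epsilon>" using \<epsilon> by simp
    then show "P < r" unfolding r_def by linarith
    have "0 \<le> (P + 1) * \<epsilon>" using \<epsilon> bound_nonneg by simp
    moreover have "r * \<epsilon> = (P + 1) * \<epsilon> + (F / \<delta>)\<^sup>2" using \<epsilon> by (simp add: r_def distrib_right)
    ultimately show "(F / \<delta>)\<^sup>2 \<le> r * \<epsilon>" by linarith
  qed
  have r0: "0 < r" using r bound_nonneg by simp
  define Q where "Q f = r *\<^sub>R op_of (?R r) f" for f
  have lin: "op_of (?R r) (f - h) = op_of (?R r) f - op_of (?R r) h"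
    "op_of (?R r) (f + h) = op_of (?R r) f + op_of (?R r) h"
    "op_of (?R r) (s *\<^sub>R f) = s *\<^sub>R op_of (?R r) f" for f h s
    using bounded_linear_op_of[of "?R r"]
    by (simp_all add: linear_simps)
  have Qle: "norm (Q f) \<le> norm f" for f
  proof -
    have "norm (op_of (?R r) f) \<le> (1 / r) * norm f"
      by (rule order_trans[OF norm_op_of_le mult_right_mono[OF norm_resolvent[OF r]]]) simp
    then have "r * norm (op_of (?R r) f) \<le> r * ((1 / r) * norm f)"
      using r0 by (intro mult_left_mono) auto
    then show ?thesis using r0 by (simp add: Q_def)
  qed
  \<comment> \<open>\<open>A\<close> is minus the generator applied to \<zeta>, so
    \<open>Z - Q Z\<close> is the resolvent of \<open>A\<close>; telescoping to the third power of
    \<open>Q\<close> gives \<open>Z3\<close>.\<close>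
  have "bvp L \<epsilon> p r Z (r *\<^sub>R Z + A)"
  proof (rule bvpI[where ?z1.0=\<zeta>1 and ?z2.0=\<zeta>2])
    fix x assume x: "x \<in> {0..L}"
    show "(apply_bcontfun Z has_real_derivative \<zeta>1 x) (at x within {0..L})"
      by (rule has_field_derivative_transform_within[OF \<zeta>1[OF x] zero_less_one x]) (simp add: Z(1))
    show "r * Z x + p x * Z x - \<epsilon> * \<zeta>2 x = (r *\<^sub>R Z + A) x"
      using Z(1)[OF x] A(1)[OF x] by simp
    show "(\<zeta>1 has_real_derivative \<zeta>2 x) (at x within {0..L})" by (rule \<zeta>2[OF x])
  next
    show "Z x = Z (clamp 0 L x)" for x by (rule Z(2))
    show "Z 0 = 0" "Z L = 0" using Z(1)[of 0] Z(1)[of L] \<zeta>0 L by simp_all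
  qed
  from bvp_unique[OF this bvp_resolvent(1)[OF r] L \<epsilon> r0 p_nonneg]
  have Z_eq: "Z = Q Z + op_of (?R r) A" by (simp add: lin Q_def)
  define h where "h = A + Q A + Q (Q A)"
  have QR: "Q (op_of (?R r) f) = op_of (?R r) (Q f)" for f by (simp add: Q_def lin)
  have Qadd: "Q (f + k) = Q f + Q k" for f k by (simp add: Q_def lin scaleR_add_right)
  have Z3: "Z - Q (Q (Q Z)) = op_of (?R r) h"
  proof -
    have 2: "Q Z = Q (Q Z) + op_of (?R r) (Q A)" using arg_cong[OF Z_eq, of Q] by (simp add: Qadd QR)
    have 3: "Q (Q Z) = Q (Q (Q Z)) + op_of (?R r) (Q (Q A))" using arg_cong[OF 2, of Q] by (simp add: Qadd QR)
    have "z - q3 = b + b' + b''" if "z = q + b" "q = q2 + b'" "q2 = q3 + b''" for z q q2 q3 b b' b'' :: "real \<Rightarrow>\<^sub>C real"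
      unfolding that by simp
    from this[OF Z_eq 2 3] show ?thesis unfolding h_def lin .
  qed
  have hF: "\<bar>h x\<bar> \<le> F" for x
  proof -
    have "norm h \<le> F"
      unfolding h_def F_def using Qle[of A] Qle[of "Q A"] norm_triangle_ineq[of "A + Q A" "Q (Q A)"]
        norm_triangle_ineq[of A "Q A"] by linarith
    then show ?thesis using norm_bounded[of h x] by simp
  qed
  have F0: "0 \<le> F" by (simp add: F_def)
  define \<kappa> where "\<kappa> = sqrt (r / \<epsilon>)"
  have \<kappa>: "0 < \<kappa>" "\<epsilon> * (\<kappa> * \<kappa>) = r" using r0 \<epsilon> by (auto simp: \<kappa>_def)
  define \<beta> where "\<beta> x = F / r * (1 - exp (- \<kappa> * x))" for x
  define \<beta>1 where "\<beta>1 x = F / r * \<kappa> * exp (- \<kappa> * x)" for x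
  define \<beta>2 where "\<beta>2 x = - (F / r * (\<kappa> * \<kappa>) * exp (- \<kappa> * x))" for x
  have d\<beta>: "(\<beta> has_real_derivative \<beta>1 x) (at x)" "(\<beta>1 has_real_derivative \<beta>2 x) (at x)" for x
    unfolding \<beta>_def \<beta>1_def \<beta>2_def by (rule derivative_eq_intros refl | simp)+
  have \<beta>0: "0 \<le> \<beta> 0" "0 \<le> \<beta> L" using F0 r0 \<kappa> L by (auto simp: \<beta>_def)
  have super: "f \<le> (r + p x) * \<beta> x - \<epsilon> * \<beta>2 x" if "x \<in> {0..L}" "f \<le> F" for f x
  proof -
    have "0 \<le> \<beta> x" using that F0 r0 \<kappa> by (auto simp: \<beta>_def)
    then have "0 \<le> p x * \<beta> x" using p_nonneg[OF that(1)] by simp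
    moreover have "r * \<beta> x - \<epsilon> * \<beta>2 x = F"
    proof -
      have "\<epsilon> * \<beta>2 x = - ((\<epsilon> * (\<kappa> * \<kappa>)) * (F / r) * exp (- \<kappa> * x))"
        by (simp add: \<beta>2_def)
      then show ?thesis unfolding \<kappa>(2) using r0 by (simp add: \<beta>_def field_simps)
    qed
    ultimately show ?thesis using that(2) by (simp add: algebra_simps)
  qed
  have b: "bvp L \<epsilon> p r (Z - Q (Q (Q Z))) h" unfolding Z3 by (rule bvp_resolvent(1)[OF r])
  have close: "\<bar>Q (Q (Q Z)) x - \<zeta> x\<bar> \<le> \<delta> * x" if x: "x \<in> {0..L}" for x
  proof -
    have "(Z - Q (Q (Q Z))) x \<le> \<beta> x"
      by (rule bvp_le_barrier[OF b L \<epsilon> r0 p_nonneg d\<beta> \<beta>0 super x]) (use hF in \<open>auto simp: abs_le_iff\<close>)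
    moreover have "(- (Z - Q (Q (Q Z)))) x \<le> \<beta> x"
      by (rule bvp_le_barrier[OF bvp_minus[OF b] L \<epsilon> r0 p_nonneg d\<beta> \<beta>0 super x])
        (use hF in \<open>auto simp: abs_le_iff\<close>)
    ultimately have "\<bar>Q (Q (Q Z)) x - \<zeta> x\<bar> \<le> \<beta> x" using Z(1)[OF x] by auto
    also have "\<beta> x \<le> F / r * (\<kappa> * x)"
      unfolding \<beta>_def using exp_ge_add_one_self[of "- \<kappa> * x"] F0 r0
      by (intro mult_left_mono) auto
    also have "\<dots> = F / sqrt (r * \<epsilon>) * x"
    proof -
      have "sqrt r * sqrt r = r" using r0 by simp
      then show ?thesis using r0 \<epsilon> by (simp add: \<kappa>_def real_sqrt_divide real_sqrt_mult field_simps)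
    qed
    also have "\<dots> \<le> \<delta> * x"
    proof (intro mult_right_mono)
      have "F / \<delta> \<le> sqrt (r * \<epsilon>)" using r1 F0 \<delta> by (intro real_le_rsqrt) auto
      moreover have "0 < sqrt (r * \<epsilon>)" using r0 \<epsilon> by simp
      ultimately show "F / sqrt (r * \<epsilon>) \<le> \<delta>" using \<delta> by (simp add: field_simps)
    qed (use x in auto)
    finally show ?thesis .
  qed
  \<comment> \<open>The factor \<open>r * r * r\<close> turns three resolvents into three
    applications of \<open>Q\<close>.\<close>
  obtain w where w: "continuous_on {0..T} w" "w 0 = op_of (?R r) (op_of (?R r) ((r * r * r) *\<^sub>R Z))"
    "\<And>t. t \<in> {0..T} \<Longrightarrow>
      ((\<lambda>t. op_of (?R r) (w t)) has_vector_derivative r *\<^sub>R op_of (?R r) (w t) - w t) (at t within {0..T})"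
    by (rule evolution[OF r T]) (rule that)
  have "op_of (?R r) (w 0) = Q (Q (Q Z))" by (simp add: w(2) Q_def lin mult.assoc)
  with close have "\<And>x. x \<in> {0..L} \<Longrightarrow> \<bar>op_of (?R r) (w 0) x - \<zeta> x\<bar> \<le> \<delta> * x" by simp
  from that[of r "\<lambda>t. op_of (?R r) (w t)" w, OF r bvp_resolvent(1)[OF r] w(3) this] show thesis .
qed

end

text \<open>The substitution leaves the potential \<open>p\<close>, the sum of
  \<open>(a x)\<^sup>2 / (4 * \<epsilon>)\<close> and \<open>a' x / 2 - c x\<close>;
  \<open>ca\<close> makes it nonnegative.\<close>

theorem classical_sol_exists:
  fixes L T \<epsilon> \<delta> :: real and a a' c g g1 g2 :: "real \<Rightarrow> real"
  assumes L: "0 < L" and \<epsilon>: "0 < \<epsilon>" and T: "0 \<le> T" and \<delta>: "0 < \<delta>"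
    and a: "\<And>x. x \<in> {0..L} \<Longrightarrow> (a has_real_derivative a' x) (at x within {0..L})"
    and a': "continuous_on {0..L} a'" and c: "continuous_on {0..L} c"
    and ca: "\<And>x. x \<in> {0..L} \<Longrightarrow> c x \<le> a' x / 2"
    and g0: "g 0 = 0" "g L = 0"
    and g1: "\<And>x. x \<in> {0..L} \<Longrightarrow> (g has_real_derivative g1 x) (at x within {0..L})"
    and g2: "\<And>x. x \<in> {0..L} \<Longrightarrow> (g1 has_real_derivative g2 x) (at x within {0..L})"
    and g2c: "continuous_on {0..L} g2"
  obtains u u1 u2 where "classical_sol L T \<epsilon> a c u u1 u2" "\<And>x. x \<in> {0..L} \<Longrightarrow> \<bar>u 0 x - g x\<bar> \<le> \<delta> * x"
proof -
  have ac: "continuous_on {0..L} a" using a by (rule DERIV_continuous_on)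
  have gc: "continuous_on {0..L} g" using g1 by (rule DERIV_continuous_on)
  have g1c: "continuous_on {0..L} g1" using g2 by (rule DERIV_continuous_on)
  define p where "p x = (a x)\<^sup>2 / (4 * \<epsilon>) + a' x / 2 - c x" for x
  have pc: "continuous_on {0..L} p" unfolding p_def using \<epsilon> by (intro continuous_intros ac a' c) auto
  have p0: "0 \<le> p x" if "x \<in> {0..L}" for x
  proof -
    have "0 \<le> (a x)\<^sup>2 / (4 * \<epsilon>)" using \<epsilon> by simp
    then show ?thesis using ca[OF that] unfolding p_def by linarith
  qed
  obtain P where "\<And>x. x \<in> {0..L} \<Longrightarrow> \<bar>p x\<bar> \<le> P"
    by (rule continuous_on_Icc_le[OF pc]) (rule that)
  then have P: "p x \<le> P" if "x \<in> {0..L}" for x using that by (meson abs_le_D1)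
  interpret dirichlet L \<epsilon> P p
    by standard (fact L \<epsilon> pc p0 P)+
  define k where "k x = a x / (2 * \<epsilon>)" for x
  define k' where "k' x = a' x / (2 * \<epsilon>)" for x
  have k: "(k has_real_derivative k' x) (at x within {0..L})" if "x \<in> {0..L}" for x
    unfolding k_def k'_def by (rule DERIV_cdivide[OF a[OF that]])
  have kc: "continuous_on {0..L} k" using k by (rule DERIV_continuous_on)
  have k'c: "continuous_on {0..L} k'" unfolding k'_def using \<epsilon> by (intro continuous_intros a') auto
  define \<psi> where "\<psi> x = integral {0..x} k" for x
  have \<psi>: "(\<psi> has_real_derivative k x) (at x within {0..L})" if "x \<in> {0..L}" for x
    unfolding \<psi>_def using that by (intro integral_has_real_derivative kc)
  have \<psi>c: "continuous_on {0..L} \<psi>" using \<psi> by (rule DERIV_continuous_on)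
  define e where "e x = exp (- \<psi> x)" for x
  have e: "(e has_real_derivative - (k x * e x)) (at x within {0..L})" if "x \<in> {0..L}" for x
    unfolding e_def using DERIV_chain2[OF DERIV_exp DERIV_minus[OF \<psi>[OF that]]] by (simp add: mult.commute)
  define f where "f x = exp (\<psi> x)" for x
  have f: "(f has_real_derivative k x * f x) (at x within {0..L})" if "x \<in> {0..L}" for x
    unfolding f_def using DERIV_chain2[OF DERIV_exp \<psi>[OF that]] by (simp add: mult.commute)
  have fc: "continuous_on {0..L} f" unfolding f_def by (intro continuous_intros \<psi>c)
  have e0: "0 < e x" for x by (simp add: e_def)
  have ef: "e x * f x = 1" for x by (simp add: e_def f_def flip: exp_add)
  have ec: "continuous_on {0..L} e" unfolding e_def by (intro continuous_intros \<psi>c)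
  obtain E where E0: "0 < E" and "\<And>x. x \<in> {0..L} \<Longrightarrow> \<bar>e x\<bar> \<le> E"
    by (rule continuous_on_Icc_le[OF ec]) (rule that)
  then have E: "e x \<le> E" if "x \<in> {0..L}" for x using that by (meson abs_le_D1)
  define \<zeta>1 where "\<zeta>1 x = (k x * f x) * g x + g1 x * f x" for x
  define \<zeta>2 where "\<zeta>2 x = ((k' x * f x + (k x * f x) * k x) * g x + g1 x * (k x * f x)) + (g2 x * f x + (k x * f x) * g1 x)" for x
  obtain r z w where zw: "P < r" "\<And>t. bvp L \<epsilon> p r (z t) (apply_bcontfun (w t))"
    "\<And>t. t \<in> {0..T} \<Longrightarrow> (z has_vector_derivative r *\<^sub>R z t - w t) (at t within {0..T})"
    "\<And>x. x \<in> {0..L} \<Longrightarrow> \<bar>z 0 x - f x * g x\<bar> \<le> (\<delta> / E) * x"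
  \<comment> \<open>Going back from \<open>z\<close> to \<open>u\<close> multiplies by
    \<open>e\<close>, which is at most \<open>E\<close>; the division by \<open>E\<close>
    compensates for this.\<close>
  proof (rule dirichlet_evolution[OF T, of "\<delta> / E" "\<lambda>x. f x * g x" \<zeta>1 \<zeta>2])
    show "0 < \<delta> / E" using \<delta> E0 by simp
    show "((\<lambda>x. f x * g x) has_real_derivative \<zeta>1 x) (at x within {0..L})" if "x \<in> {0..L}" for x
      unfolding \<zeta>1_def by (rule DERIV_mult[OF f[OF that] g1[OF that]])
    show "(\<zeta>1 has_real_derivative \<zeta>2 x) (at x within {0..L})" if "x \<in> {0..L}" for x
      unfolding \<zeta>1_def \<zeta>2_def
      by (rule DERIV_add[OF DERIV_mult[OF DERIV_mult[OF k[OF that] f[OF that]] g1[OF that]]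
            DERIV_mult[OF g2[OF that] f[OF that]]])
    show "continuous_on {0..L} \<zeta>2"
      unfolding \<zeta>2_def by (intro continuous_intros kc k'c fc gc g1c g2c)
  qed (use g0 that in auto)
  have "\<forall>t. \<exists>z1 z2. \<forall>x\<in>{0..L}. (apply_bcontfun (z t) has_real_derivative z1 x) (at x within {0..L}) \<and>
        (z1 has_real_derivative z2 x) (at x within {0..L}) \<and> r * z t x + p x * z t x - \<epsilon> * z2 x = w t x"
    using zw(2) unfolding bvp_def by simp
  then obtain z1 z2 where z12: "\<forall>t. \<forall>x\<in>{0..L}. (apply_bcontfun (z t) has_real_derivative z1 t x) (at x within {0..L}) \<and>
        (z1 t has_real_derivative z2 t x) (at x within {0..L}) \<and> r * z t x + p x * z t x - \<epsilon> * z2 t x = w t x"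
    by (simp only: choice_iff) (elim exE, rule that)
  have z1: "(apply_bcontfun (z t) has_real_derivative z1 t x) (at x within {0..L})"
    and z2: "(z1 t has_real_derivative z2 t x) (at x within {0..L})"
    and z_eq: "r * z t x + p x * z t x - \<epsilon> * z2 t x = w t x" if "x \<in> {0..L}" for t x
    using z12 that by simp_all
  have z_bd: "z t 0 = 0" "z t L = 0" for t using zw(2)[of t] unfolding bvp_def by simp_all
  define u where "u t x = e x * z t x" for t x
  define u1 where "u1 t x = - (k x * e x) * z t x + z1 t x * e x" for t x
  define u2 where "u2 t x = (- (k' x * e x + - (k x * e x) * k x) * z t x + z1 t x * - (k x * e x))
      + (z2 t x * e x + - (k x * e x) * z1 t x)" for t x
  have z2c: "continuous_on {0..L} (z2 t)" for t
  proof -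
    have "continuous_on {0..L} (\<lambda>x. (r * z t x + p x * z t x - w t x) / \<epsilon>)"
      using \<epsilon> by (intro continuous_intros pc continuous_on_apply_bcontfun) auto
    moreover have "(r * z t x + p x * z t x - w t x) / \<epsilon> = z2 t x" if "x \<in> {0..L}" for x
      using z_eq[OF that, of t] \<epsilon> by (simp add: field_simps)
    ultimately show ?thesis by (rule continuous_on_eq)
  qed
  have z1c: "continuous_on {0..L} (z1 t)" for t using z2 by (rule DERIV_continuous_on)
  have "classical_sol L T \<epsilon> a c u u1 u2"
    unfolding classical_sol_def
  proof (intro ballI conjI)
    fix t assume t: "t \<in> {0..T}"
    show "u t 0 = 0" "u t L = 0" by (simp_all add: u_def z_bd)
    show "continuous_on {0..L} (u2 t)"
      unfolding u2_def by (intro continuous_intros kc k'c ec z1c z2c continuous_on_apply_bcontfun)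
    have eq: "\<epsilon> * u2 t x + a x * u1 t x + c x * u t x = e x * (r *\<^sub>R z t - w t) x" if x: "x \<in> {0..L}" for x
    proof -
      have ax: "a x = 2 * \<epsilon> * k x" "a' x = 2 * \<epsilon> * k' x" using \<epsilon> by (simp_all add: k_def k'_def)
      have px: "p x = \<epsilon> * (k x * k x) + \<epsilon> * k' x - c x"
        unfolding p_def ax using \<epsilon> by (simp add: power2_eq_square field_simps)
      have "\<epsilon> * u2 t x + a x * u1 t x + c x * u t x = e x * (\<epsilon> * z2 t x - p x * z t x)"
        unfolding px ax(1) u_def u1_def u2_def by (simp add: algebra_simps)
      also have "\<epsilon> * z2 t x - p x * z t x = (r *\<^sub>R z t - w t) x" using z_eq[OF x, of t] by simp
      finally show ?thesis .
    qed
    have bde: "bounded ((r *\<^sub>R z t - w t) ` {0..L})"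
      by (intro compact_imp_bounded compact_continuous_image continuous_on_apply_bcontfun compact_Icc)
    have "uniform_limit {0..L} (\<lambda>s x. (z s x - z t x) / (s - t)) (r *\<^sub>R z t - w t) (at t within {0..T})"
      by (rule uniform_limit_on_subset[OF has_vector_derivative_imp_uniform_quotient[OF zw(3)[OF t]]]) simp
    then have "uniform_limit {0..L} (\<lambda>s x. e x * ((z s x - z t x) / (s - t))) (\<lambda>x. e x * (r *\<^sub>R z t - w t) x) (at t within {0..T})"
      by (intro uniform_lim_mult uniform_limit_const bde compact_imp_bounded compact_continuous_image ec compact_Icc)
    then show "uniform_limit {0..L} (\<lambda>s x. (u s x - u t x) / (s - t))
       (\<lambda>x. \<epsilon> * u2 t x + a x * u1 t x + c x * u t x) (at t within {0..T})"
      by (rule uniform_limit_cong'[THEN iffD1, rotated 2]) (simp add: u_def right_diff_distrib, simp only: eq)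
    fix x assume x: "x \<in> {0..L}"
    show "(u t has_real_derivative u1 t x) (at x within {0..L})"
      unfolding u_def u1_def by (rule DERIV_mult[OF e[OF x] z1[OF x]])
    show "(u1 t has_real_derivative u2 t x) (at x within {0..L})"
      unfolding u1_def u2_def
      by (rule DERIV_add[OF DERIV_mult[OF DERIV_minus[OF DERIV_mult[OF k[OF x] e[OF x]]] z1[OF x]]
            DERIV_mult[OF z2[OF x] e[OF x]]])
  qed
  moreover have "\<bar>u 0 x - g x\<bar> \<le> \<delta> * x" if x: "x \<in> {0..L}" for x
  proof -
    have "u 0 x - g x = e x * (z 0 x - f x * g x)"
      using ef[of x] by (simp add: u_def right_diff_distrib flip: mult.assoc)
    then have "\<bar>u 0 x - g x\<bar> = e x * \<bar>z 0 x - f x * g x\<bar>"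
      using e0[of x] by (simp add: abs_mult)
    also have "\<dots> \<le> E * ((\<delta> / E) * x)"
      using E[OF x] zw(4)[OF x] e0[of x] E0 by (intro mult_mono) auto
    also have "\<dots> = \<delta> * x" using E0 by simp
    finally show ?thesis .
  qed
  ultimately show thesis by (rule that)
qed

section \<open>Comparison principles\<close>

text \<open>Only difference quotients from the left enter, so the final time \<open>m = T\<close> is
  covered.\<close>

lemma has_real_derivative_nonpos_at_min:
  fixes f :: "real \<Rightarrow> real"
  assumes f: "(f has_real_derivative d) (at m within {0..T})" and m: "0 < m" "m \<le> T"
    and min: "\<And>s. s \<in> {0..m} \<Longrightarrow> f m \<le> f s"
  shows "d \<le> 0"
proof -
  have "(f has_real_derivative d) (at_left m)"
    using DERIV_subset[OF f, of "{0..m}"] m by (simp add: at_within_Icc_at_left)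
  then have "((\<lambda>s. (f s - f m) / (s - m)) \<longlongrightarrow> d) (at_left m)"
    by (simp add: has_field_derivative_iff)
  moreover have "\<forall>\<^sub>F s in at_left m. (f s - f m) / (s - m) \<le> 0"
    unfolding eventually_at_left[OF m(1)]
    using m min by (intro exI[of _ 0]) (auto intro!: divide_nonneg_neg)
  ultimately show ?thesis by (rule tendsto_upperbound) simp
qed

lemma has_real_derivative_nonneg_at_left_end:
  fixes f :: "real \<Rightarrow> real"
  assumes f: "(f has_real_derivative d) (at 0 within {0..L})" and r: "0 < r" "r \<le> L"
    and min: "\<And>x. x \<in> {0..r} \<Longrightarrow> f 0 \<le> f x"
  shows "0 \<le> d"
proof -
  have "(f has_real_derivative d) (at_right 0)"
    using DERIV_subset[OF f, of "{0..r}"] r by (simp add: at_within_Icc_at_right)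
  then have "((\<lambda>x. (f x - f 0) / (x - 0)) \<longlongrightarrow> d) (at_right 0)"
    by (simp add: has_field_derivative_iff)
  moreover have "\<forall>\<^sub>F x in at_right 0. 0 \<le> (f x - f 0) / (x - 0)"
    unfolding eventually_at_right[OF r(1)]
    using r min by (intro exI[of _ r]) auto
  ultimately show ?thesis by (rule tendsto_lowerbound) simp
qed

text \<open>At a negative minimum of \<open>D t x + \<eta> * t\<close> over the closed rectangle,
  \<open>D1\<close> vanishes, \<open>D2\<close> and \<open>c * D\<close> are nonnegative, and
  \<open>Dt\<close> is at most \<open>- \<eta>\<close>. The added term turns the weak inequality in
  time into the strict one that contradicts \<open>super\<close>.\<close>

lemma parabolic_comparison:
  fixes D Dt D1 D2 :: "real \<Rightarrow> real \<Rightarrow> real" and a c :: "real \<Rightarrow> real"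
  assumes \<epsilon>: "0 < \<epsilon>"
    and cont: "continuous_on ({0..T} \<times> {l..r}) (\<lambda>(t, x). D t x)"
    and Dt: "\<And>t x. t \<in> {0<..T} \<Longrightarrow> x \<in> {l<..<r} \<Longrightarrow> ((\<lambda>s. D s x) has_real_derivative Dt t x) (at t within {0..T})"
    and D1: "\<And>t x. t \<in> {0<..T} \<Longrightarrow> x \<in> {l<..<r} \<Longrightarrow> (D t has_real_derivative D1 t x) (at x)"
    and D2: "\<And>t x. t \<in> {0<..T} \<Longrightarrow> x \<in> {l<..<r} \<Longrightarrow> (D1 t has_real_derivative D2 t x) (at x)"
    and c: "\<And>x. x \<in> {l<..<r} \<Longrightarrow> c x \<le> 0"
    and super: "\<And>t x. t \<in> {0<..T} \<Longrightarrow> x \<in> {l<..<r} \<Longrightarrow> 0 \<le> Dt t x - \<epsilon> * D2 t x - a x * D1 t x - c x * D t x"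
    and init: "\<And>x. x \<in> {l..r} \<Longrightarrow> 0 \<le> D 0 x"
    and bd: "\<And>t. t \<in> {0..T} \<Longrightarrow> 0 \<le> D t l" "\<And>t. t \<in> {0..T} \<Longrightarrow> 0 \<le> D t r"
    and t: "t \<in> {0..T}" and x: "x \<in> {l..r}"
  shows "0 \<le> D t x"
proof (rule ccontr)
  assume neg: "\<not> 0 \<le> D t x"
  \<comment> \<open>Small enough that \<open>\<eta> * t\<close> uses up at most half of the negative
    value at the given point.\<close>
  define \<eta> where "\<eta> = - D t x / (2 * (T + 1))"
  have T: "0 \<le> T" using t by simp
  have \<eta>: "0 < \<eta>" using neg T by (simp add: \<eta>_def divide_neg_pos)
  have "\<eta> * t \<le> \<eta> * (T + 1)" using \<eta> t by (intro mult_left_mono) auto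
  also have "\<dots> = - D t x / 2" using T by (simp add: \<eta>_def field_simps)
  finally have Etx: "D t x + \<eta> * t < 0" using neg by linarith
  have "continuous_on ({0..T} \<times> {l..r}) (\<lambda>q. D (fst q) (snd q) + \<eta> * fst q)"
    using cont unfolding split_def by (intro continuous_intros)
  from continuous_attains_inf[OF compact_Times[OF compact_Icc compact_Icc] _ this]
  obtain q where "q \<in> {0..T} \<times> {l..r}"
    "\<forall>q'\<in>{0..T} \<times> {l..r}. D (fst q) (snd q) + \<eta> * fst q \<le> D (fst q') (snd q') + \<eta> * fst q'"
    using t x by blast
  then obtain m y where my: "m \<in> {0..T}" "y \<in> {l..r}"
    and min: "\<And>s z. s \<in> {0..T} \<Longrightarrow> z \<in> {l..r} \<Longrightarrow> D m y + \<eta> * m \<le> D s z + \<eta> * s"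
    by (cases q) auto
  have "D m y + \<eta> * m < 0" using min[OF t x] Etx by linarith
  moreover have "0 \<le> \<eta> * m" using my \<eta> by simp
  ultimately have Dneg: "D m y < 0" by linarith
  have "m \<noteq> 0" using Dneg init[OF my(2)] by auto
  moreover have "y \<noteq> l" "y \<noteq> r" using Dneg bd[OF my(1)] by auto
  ultimately have m: "m \<in> {0<..T}" and y: "y \<in> {l<..<r}" using my by auto
  have x1: "D1 m y = 0" and x2: "0 \<le> D2 m y"
    using interior_min_second_derivative[OF y _ D1[OF m] D2[OF m y]] min[OF my(1)] by simp_all
  have "((\<lambda>s. D s y + \<eta> * s) has_real_derivative Dt m y + \<eta> * 1) (at m within {0..T})"
    by (rule DERIV_add[OF Dt[OF m y] DERIV_cmult[OF DERIV_ident]])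
  then have "Dt m y + \<eta> * 1 \<le> 0"
    by (rule has_real_derivative_nonpos_at_min) (use m my min in auto)
  moreover have "0 \<le> c y * D m y" using c[OF y] Dneg by (simp add: mult_nonpos_nonpos)
  moreover have "0 \<le> \<epsilon> * D2 m y" using \<epsilon> x2 by simp
  ultimately show False using super[OF m y] \<eta> x1 by simp
qed

section \<open>Regularity and comparison for classical solutions\<close>

lemma classical_solD:
  assumes "classical_sol L T \<epsilon> a c u u1 u2" "t \<in> {0..T}"
  shows "u t 0 = 0" "u t L = 0" "continuous_on {0..L} (u2 t)"
    "x \<in> {0..L} \<Longrightarrow> (u t has_real_derivative u1 t x) (at x within {0..L})"
    "x \<in> {0..L} \<Longrightarrow> (u1 t has_real_derivative u2 t x) (at x within {0..L})"
    "uniform_limit {0..L} (\<lambda>s x. (u s x - u t x) / (s - t))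
       (\<lambda>x. \<epsilon> * u2 t x + a x * u1 t x + c x * u t x) (at t within {0..T})"
  using assms unfolding classical_sol_def by simp_all

lemma classical_sol_continuous:
  assumes "classical_sol L T \<epsilon> a c u u1 u2" "t \<in> {0..T}"
  shows "continuous_on {0..L} (u t)" "continuous_on {0..L} (u1 t)"
  by (rule DERIV_continuous_on, rule classical_solD(4)[OF assms], assumption)
    (rule DERIV_continuous_on, rule classical_solD(5)[OF assms], assumption)

lemma classical_sol_time_derivative:
  assumes "classical_sol L T \<epsilon> a c u u1 u2" "t \<in> {0..T}" "x \<in> {0..L}"
  shows "((\<lambda>s. u s x) has_real_derivative \<epsilon> * u2 t x + a x * u1 t x + c x * u t x) (at t within {0..T})"
  unfolding has_field_derivative_iff
  by (rule tendsto_uniform_limitI[OF classical_solD(6)[OF assms(1,2)] assms(3)])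

lemma classical_sol_uniform_limit:
  assumes sol: "classical_sol L T \<epsilon> a c u u1 u2" and t: "t \<in> {0..T}"
    and a: "continuous_on {0..L} a" and c: "continuous_on {0..L} c"
  shows "uniform_limit {0..L} u (u t) (at t within {0..T})"
proof -
  let ?D = "\<lambda>x. \<epsilon> * u2 t x + a x * u1 t x + c x * u t x"
  have "bounded (?D ` {0..L})"
    by (intro compact_imp_bounded compact_continuous_image compact_Icc continuous_intros
        a c classical_sol_continuous[OF sol t] classical_solD(3)[OF sol t])
  moreover have "uniform_limit {0..L} (\<lambda>s x. s - t) (\<lambda>x. 0) (at t within {0..T})"
  proof (rule uniform_limitI)
    fix e :: real assume "0 < e"
    then show "\<forall>\<^sub>F s in at t within {0..T}. \<forall>x\<in>{0..L}. dist (s - t) 0 < e"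
      unfolding eventually_at by (intro exI[of _ e]) (auto simp: dist_real_def)
  qed
  moreover have "bounded ((\<lambda>x. 0 :: real) ` {0..L})"
    by (rule bounded_subset[of "{0}"]) auto
  ultimately have "uniform_limit {0..L} (\<lambda>s x. (s - t) * ((u s x - u t x) / (s - t))) (\<lambda>x. 0 * ?D x) (at t within {0..T})"
    by (intro uniform_lim_mult classical_solD(6)[OF sol t])
  then have "uniform_limit {0..L} (\<lambda>s x. (s - t) * ((u s x - u t x) / (s - t)) + u t x) (\<lambda>x. 0 * ?D x + u t x) (at t within {0..T})"
    by (intro uniform_limit_add uniform_limit_const)
  then show ?thesis
  proof (rule uniform_limit_cong[THEN iffD1, rotated 2])
    show "\<forall>\<^sub>F s in at t within {0..T}. \<forall>x\<in>{0..L}. (s - t) * ((u s x - u t x) / (s - t)) + u t x = u s x"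
      unfolding eventually_at by (intro exI[of _ 1]) auto
  qed simp
qed

text \<open>Convergence in time is uniform in space and each \<open>u t\<close> is continuous. Joint
  continuity is what lets the minimum in \<open>parabolic_comparison\<close> be attained.\<close>

lemma classical_sol_jointly_continuous:
  assumes sol: "classical_sol L T \<epsilon> a c u u1 u2"
    and a: "continuous_on {0..L} a" and c: "continuous_on {0..L} c"
  shows "continuous_on ({0..T} \<times> {0..L}) (\<lambda>(t, x). u t x)"
  unfolding continuous_on_iff
proof (intro ballI allI impI)
  fix p and e :: real assume p: "p \<in> {0..T} \<times> {0..L}" and e: "0 < e"
  obtain t x where tx: "p = (t, x)" by (cases p)
  then have t: "t \<in> {0..T}" and x: "x \<in> {0..L}" using p by auto
  obtain d1 where d1: "0 < d1"
    "\<And>s y. s \<in> {0..T} \<Longrightarrow> s \<noteq> t \<Longrightarrow> dist s t < d1 \<Longrightarrow> y \<in> {0..L} \<Longrightarrow> dist (u s y) (u t y) < e / 2"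
    using uniform_limitD[OF classical_sol_uniform_limit[OF sol t a c], of "e / 2"] e
    unfolding eventually_at by auto
  obtain d2 where d2: "0 < d2" "\<And>y. y \<in> {0..L} \<Longrightarrow> dist y x < d2 \<Longrightarrow> dist (u t y) (u t x) < e / 2"
    using classical_sol_continuous(1)[OF sol t] x e unfolding continuous_on_iff by (metis half_gt_zero)
  show "\<exists>d>0. \<forall>q\<in>{0..T} \<times> {0..L}. dist q p < d \<longrightarrow>
      dist (case q of (t, x) \<Rightarrow> u t x) (case p of (t, x) \<Rightarrow> u t x) < e"
  proof (intro exI[of _ "min d1 d2"] conjI ballI impI)
    fix q assume q: "q \<in> {0..T} \<times> {0..L}" "dist q p < min d1 d2"
    obtain s y where sy: "q = (s, y)" by (cases q)
    have "dist s t < d1" "dist y x < d2"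
      using q(2) dist_fst_le[of q p] dist_snd_le[of q p] by (auto simp: sy tx)
    moreover have "s \<in> {0..T}" "y \<in> {0..L}" using q sy by auto
    ultimately have "dist (u s y) (u t y) < e / 2" "dist (u t y) (u t x) < e / 2"
      using d1 d2 e by (cases "s = t"; simp)+
    then show "dist (case q of (t, x) \<Rightarrow> u t x) (case p of (t, x) \<Rightarrow> u t x) < e"
      using dist_triangle[of "u s y" "u t x" "u t y"] by (simp add: sy tx)
  next
    show "0 < min d1 d2" using d1(1) d2(1) by simp
  qed
qed

lemma classical_sol_minus:
  assumes sol: "classical_sol L T \<epsilon> a c u u1 u2"
  shows "classical_sol L T \<epsilon> a c (\<lambda>t x. - u t x) (\<lambda>t x. - u1 t x) (\<lambda>t x. - u2 t x)"
  unfolding classical_sol_def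
proof (intro ballI conjI)
  fix t assume t: "t \<in> {0..T}"
  show "continuous_on {0..L} (\<lambda>x. - u2 t x)" by (intro continuous_intros classical_solD(3)[OF sol t])
  have "uniform_limit {0..L} (\<lambda>s x. - ((u s x - u t x) / (s - t)))
       (\<lambda>x. - (\<epsilon> * u2 t x + a x * u1 t x + c x * u t x)) (at t within {0..T})"
    by (intro uniform_limit_uminus classical_solD(6)[OF sol t])
  then show "uniform_limit {0..L} (\<lambda>s x. (- u s x - - u t x) / (s - t))
       (\<lambda>x. \<epsilon> * - u2 t x + a x * - u1 t x + c x * - u t x) (at t within {0..T})"
    by (rule uniform_limit_cong'[THEN iffD1, rotated 2])
      (simp_all add: minus_divide_left)
qed (use classical_solD[OF sol] in \<open>auto intro!: DERIV_minus\<close>)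

text \<open>The interval \<open>{l..r}\<close> is left free for two uses: \<open>{0..d}\<close> for
  the flux barrier and \<open>{0..L}\<close> for the Gaussians.\<close>

lemma classical_sol_le_supersolution:
  fixes W Wt W1 W2 :: "real \<Rightarrow> real \<Rightarrow> real"
  assumes sol: "classical_sol L T \<epsilon> a c u u1 u2" and \<epsilon>: "0 < \<epsilon>"
    and a: "continuous_on {0..L} a" and c: "continuous_on {0..L} c"
    and c0: "\<And>x. x \<in> {0..L} \<Longrightarrow> c x \<le> 0"
    and lr: "0 \<le> l" "r \<le> L"
    and cont: "continuous_on ({0..T} \<times> {l..r}) (\<lambda>(t, x). W t x)"
    and Wt: "\<And>t x. t \<in> {0..T} \<Longrightarrow> x \<in> {l..r} \<Longrightarrow> ((\<lambda>s. W s x) has_real_derivative Wt t x) (at t within {0..T})"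
    and W1: "\<And>t x. t \<in> {0..T} \<Longrightarrow> x \<in> {l..r} \<Longrightarrow> (W t has_real_derivative W1 t x) (at x)"
    and W2: "\<And>t x. t \<in> {0..T} \<Longrightarrow> x \<in> {l..r} \<Longrightarrow> (W1 t has_real_derivative W2 t x) (at x)"
    and super: "\<And>t x. t \<in> {0..T} \<Longrightarrow> x \<in> {l..r} \<Longrightarrow> 0 \<le> Wt t x - \<epsilon> * W2 t x - a x * W1 t x - c x * W t x"
    and init: "\<And>x. x \<in> {l..r} \<Longrightarrow> u 0 x \<le> W 0 x"
    and bd: "\<And>t. t \<in> {0..T} \<Longrightarrow> u t l \<le> W t l" "\<And>t. t \<in> {0..T} \<Longrightarrow> u t r \<le> W t r"
    and t: "t \<in> {0..T}" and x: "x \<in> {l..r}"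
  shows "u t x \<le> W t x"
proof -
  let ?ut = "\<lambda>t x. \<epsilon> * u2 t x + a x * u1 t x + c x * u t x"
  have lrL: "{l..r} \<subseteq> {0..L}" using lr by auto
  have "0 \<le> W t x - u t x"
  proof (rule parabolic_comparison[where D="\<lambda>t x. W t x - u t x" and Dt="\<lambda>t x. Wt t x - ?ut t x"
        and ?D1.0="\<lambda>t x. W1 t x - u1 t x" and ?D2.0="\<lambda>t x. W2 t x - u2 t x" and a=a and c=c, OF \<epsilon> _ _ _ _ _ _ _ _ _ t x])
    have "continuous_on ({0..T} \<times> {l..r}) (\<lambda>(t, x). u t x)"
      by (rule continuous_on_subset[OF classical_sol_jointly_continuous[OF sol a c]]) (use lr in auto)
    then show "continuous_on ({0..T} \<times> {l..r}) (\<lambda>(t, x). W t x - u t x)"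
      using cont unfolding split_def by (intro continuous_intros)
  next
    fix t x assume "t \<in> {0<..T}" "x \<in> {l<..<r}"
    then have t: "t \<in> {0..T}" and x: "x \<in> {l..r}" "x \<in> {0<..<L}" "x \<in> {0..L}" using lr by auto
    show "((\<lambda>s. W s x - u s x) has_real_derivative Wt t x - ?ut t x) (at t within {0..T})"
      by (rule DERIV_diff[OF Wt[OF t x(1)] classical_sol_time_derivative[OF sol t x(3)]])
    show "((\<lambda>x. W t x - u t x) has_real_derivative W1 t x - u1 t x) (at x)"
      by (rule DERIV_diff[OF W1[OF t x(1)]
            has_real_derivative_within_Icc_interior[OF x(2) classical_solD(4)[OF sol t x(3)]]])
    show "((\<lambda>x. W1 t x - u1 t x) has_real_derivative W2 t x - u2 t x) (at x)"
      by (rule DERIV_diff[OF W2[OF t x(1)]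
            has_real_derivative_within_Icc_interior[OF x(2) classical_solD(5)[OF sol t x(3)]]])
    show "0 \<le> Wt t x - ?ut t x - \<epsilon> * (W2 t x - u2 t x) - a x * (W1 t x - u1 t x) - c x * (W t x - u t x)"
      using super[OF t x(1)] by (simp add: algebra_simps)
  next
    show "c x \<le> 0" if "x \<in> {l<..<r}" for x using that lr by (intro c0) auto
    show "0 \<le> W 0 x - u 0 x" if "x \<in> {l..r}" for x using init[OF that] by simp
    show "0 \<le> W t l - u t l" "0 \<le> W t r - u t r" if "t \<in> {0..T}" for t
      using bd[OF that] by simp_all
  qed
  then show ?thesis by simp
qed

text \<open>The barrier \<open>1 - exp (- k x / \<epsilon>)\<close> is a stationary supersolution as soon as \<open>k\<close> exceeds the
  drift; its slope \<open>k / \<epsilon>\<close> at \<open>0\<close> is exactly compensated by the factor \<open>\<epsilon>\<close> of the flux.\<close>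

lemma classical_sol_flux_upper:
  assumes sol: "classical_sol L T \<epsilon> a c u u1 u2" and \<epsilon>: "0 < \<epsilon>"
    and a: "continuous_on {0..L} a" and c: "continuous_on {0..L} c"
    and c0: "\<And>x. x \<in> {0..L} \<Longrightarrow> c x \<le> 0"
    and d: "0 < d" "d \<le> L" and k: "0 < k" "\<And>x. x \<in> {0..L} \<Longrightarrow> a x \<le> k" and \<epsilon>k: "\<epsilon> \<le> k * d"
    and m: "0 \<le> m" "\<And>t. t \<in> {0..T} \<Longrightarrow> u t d \<le> m"
    and init: "\<And>x. x \<in> {0..d} \<Longrightarrow> u 0 x \<le> m * x / d"
    and t: "t \<in> {0..T}"
  shows "\<epsilon> * u1 t 0 \<le> 2 * k * m"
proof -
  define q where "q = k / \<epsilon>"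
  have q: "0 < q" "\<epsilon> * q = k" using k \<epsilon> by (auto simp: q_def)
  define B where "B x = 2 * m * (1 - exp (- q * x))" for x
  define B1 where "B1 x = 2 * m * q * exp (- q * x)" for x
  define B2 where "B2 x = - (2 * m * q * q * exp (- q * x))" for x
  have dB: "(B has_real_derivative B1 x) (at x)" "(B1 has_real_derivative B2 x) (at x)" for x
    unfolding B_def B1_def B2_def by (rule derivative_eq_intros refl | simp)+
  \<comment> \<open>From \<open>1 - exp (- y) \<ge> y / (1 + y)\<close> with
    \<open>y = k x / \<epsilon>\<close>, and \<open>\<epsilon> \<le> k * d\<close>, the bracket in
    \<open>B\<close> is at least \<open>x / (2 * d)\<close>; the factor 2 in \<open>B\<close> makes
    up for the loss.\<close>
  have Bge: "m * x / d \<le> B x" if x: "x \<in> {0..d}" for x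
  proof -
    define y where "y = q * x"
    have y: "0 \<le> y" using q x by (simp add: y_def)
    have "1 + y \<le> exp y" by (rule exp_ge_add_one_self)
    then have "exp (- y) * (1 + y) \<le> exp (- y) * exp y" by (intro mult_left_mono) auto
    then have e: "exp (- y) \<le> 1 / (1 + y)" using y by (simp add: field_simps flip: exp_add)
    have "x / (2 * d) \<le> y / (1 + y)"
    proof -
      have "\<epsilon> * y = k * x" using q by (simp add: y_def flip: mult.assoc)
      have "k * x \<le> k * d" using x k(1) by (intro mult_left_mono) auto
      then have "\<epsilon> + k * x \<le> 2 * (k * d)" using \<epsilon>k by linarith
      then have "x * (\<epsilon> + k * x) \<le> x * (2 * (k * d))" using x by (intro mult_left_mono) auto
      then have "x * (\<epsilon> + \<epsilon> * y) \<le> 2 * d * (\<epsilon> * y)"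
        using \<open>\<epsilon> * y = k * x\<close> by (simp add: algebra_simps)
      then have "\<epsilon> * (x * (1 + y)) \<le> \<epsilon> * (2 * d * y)" by (simp add: algebra_simps)
      then have "x * (1 + y) \<le> 2 * d * y" using \<epsilon> by simp
      then show ?thesis using y d by (simp add: field_simps)
    qed
    also have "\<dots> = 1 - 1 / (1 + y)" using y by (simp add: field_simps)
    also have "\<dots> \<le> 1 - exp (- y)" using e by simp
    finally have "2 * m * (x / (2 * d)) \<le> 2 * m * (1 - exp (- y))" using m by (intro mult_left_mono) auto
    then show ?thesis by (simp add: B_def y_def)
  qed
  have le: "u t x \<le> B x" if x: "x \<in> {0..d}" for x
  proof (rule classical_sol_le_supersolution[where W="\<lambda>_. B" and Wt="\<lambda>_ _. 0" and ?W1.0="\<lambda>_. B1" and ?W2.0="\<lambda>_. B2",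
        OF sol \<epsilon> a c c0 order_refl d(2) _ _ dB _ _ _ _ t x])
    show "continuous_on ({0..T} \<times> {0..d}) (\<lambda>(t, x). B x)"
      unfolding split_def B_def by (intro continuous_intros)
    show "((\<lambda>s. B x) has_real_derivative 0) (at t within {0..T})" for t x by simp
    show "0 \<le> 0 - \<epsilon> * B2 x - a x * B1 x - c x * B x" if x: "x \<in> {0..d}" for x
    proof -
      have xL: "x \<in> {0..L}" using x d by auto
      have "0 \<le> m * x / d" using m x d by simp
      then have "0 \<le> B x" using Bge[OF x] by linarith
      then have 1: "0 \<le> - c x * B x" using c0[OF xL] by (intro mult_nonneg_nonneg) auto
      have "- \<epsilon> * B2 x = k * B1 x" unfolding q(2)[symmetric] by (simp add: B1_def B2_def)
      moreover have "0 \<le> B1 x" using m q by (simp add: B1_def)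
      then have "a x * B1 x \<le> k * B1 x" using k(2)[OF xL] by (intro mult_right_mono)
      ultimately show ?thesis using 1 by simp
    qed
    show "u 0 x \<le> B x" if "x \<in> {0..d}" for x using init[OF that] Bge[OF that] by linarith
    show "u t 0 \<le> B 0" if "t \<in> {0..T}" for t using classical_solD(1)[OF sol that] by (simp add: B_def)
    show "u t d \<le> B d" if "t \<in> {0..T}" for t using Bge[of d] m(2)[OF that] d by simp
  qed
  \<comment> \<open>\<open>B - u t\<close> vanishes at 0 and is nonnegative on
    \<open>{0..d}\<close>, so the slopes at 0 are ordered like the functions.\<close>
  have "((\<lambda>x. B x - u t x) has_real_derivative B1 0 - u1 t 0) (at 0 within {0..L})"
    using d by (intro DERIV_diff has_field_derivative_at_within[OF dB(1)] classical_solD(4)[OF sol t]) auto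
  then have "0 \<le> B1 0 - u1 t 0"
    by (rule has_real_derivative_nonneg_at_left_end[OF _ d])
      (use le classical_solD(1)[OF sol t] in \<open>simp add: B_def\<close>)
  then have "u1 t 0 \<le> 2 * m * q" by (simp add: B1_def)
  then have "\<epsilon> * u1 t 0 \<le> \<epsilon> * (2 * m * q)" using \<epsilon> by (intro mult_left_mono) auto
  also have "\<dots> = 2 * k * m" unfolding q(2)[symmetric] by simp
  finally show ?thesis .
qed

lemma classical_sol_flux:
  assumes sol: "classical_sol L T \<epsilon> a c u u1 u2" and \<epsilon>: "0 < \<epsilon>"
    and a: "continuous_on {0..L} a" and c: "continuous_on {0..L} c"
    and c0: "\<And>x. x \<in> {0..L} \<Longrightarrow> c x \<le> 0"
    and d: "0 < d" "d \<le> L" and k: "0 < k" "\<And>x. x \<in> {0..L} \<Longrightarrow> a x \<le> k" and \<epsilon>k: "\<epsilon> \<le> k * d"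
    and m: "0 \<le> m" "\<And>t. t \<in> {0..T} \<Longrightarrow> \<bar>u t d\<bar> \<le> m"
    and init: "\<And>x. x \<in> {0..d} \<Longrightarrow> \<bar>u 0 x\<bar> \<le> m * x / d"
    and t: "t \<in> {0..T}"
  shows "\<bar>\<epsilon> * u1 t 0\<bar> \<le> 2 * k * m"
proof -
  have "\<epsilon> * u1 t 0 \<le> 2 * k * m"
    by (rule classical_sol_flux_upper[OF sol \<epsilon> a c c0 d k \<epsilon>k m(1) _ _ t])
      (use m init in \<open>auto simp: abs_le_iff\<close>)
  moreover have "\<epsilon> * - u1 t 0 \<le> 2 * k * m"
    by (rule classical_sol_flux_upper[OF classical_sol_minus[OF sol] \<epsilon> a c c0 d k \<epsilon>k m(1) _ _ t])
      (use m init in \<open>auto simp: abs_le_iff\<close>)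
  ultimately show ?thesis by simp
qed

section \<open>Gaussian profiles along a characteristic\<close>

text \<open>The centre is \<open>X t\<close>, the variance is \<open>s * exp (m * t)\<close>, and
  \<open>K\<close> is a rate of decay in time. The sign of \<open>m\<close> decides whether the
  profile spreads or contracts.\<close>

definition gauss :: "real \<Rightarrow> real \<Rightarrow> real \<Rightarrow> real \<Rightarrow> (real \<Rightarrow> real) \<Rightarrow> real \<Rightarrow> real \<Rightarrow> real" where
  "gauss C K m s X t x = C * exp (- (K * t) - (x - X t)\<^sup>2 / 2 * (exp (- (m * t)) / s))"

lemma gauss_has_derivatives:
  assumes "(X has_real_derivative X') (at t within S)"
  shows "((\<lambda>t. gauss C K m s X t x) has_real_derivative gauss C K m s X t x *
      (- K + (x - X t) * X' * (exp (- (m * t)) / s) + (x - X t)\<^sup>2 / 2 * m * (exp (- (m * t)) / s))) (at t within S)"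
    and "(gauss C K m s X t has_real_derivative gauss C K m s X t x * - ((x - X t) * (exp (- (m * t)) / s))) (at x)"
    and "((\<lambda>x. gauss C K m s X t x * - ((x - X t) * (exp (- (m * t)) / s))) has_real_derivative
      gauss C K m s X t x * (((x - X t) * (exp (- (m * t)) / s))\<^sup>2 - exp (- (m * t)) / s)) (at x)"
proof -
  have "((\<lambda>t. exp (- (m * t))) has_real_derivative exp (- (m * t)) * - m) (at t within S)"
    by (rule derivative_eq_intros refl | simp)+
  from DERIV_cdivide[OF this, of s]
  have q: "((\<lambda>t. exp (- (m * t)) / s) has_real_derivative - m * (exp (- (m * t)) / s)) (at t within S)"
    by (simp add: mult.commute)
  have z: "((\<lambda>t. (x - X t)\<^sup>2 / 2) has_real_derivative - ((x - X t) * X')) (at t within S)"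
    by (rule derivative_eq_intros assms refl | simp)+
  have "((\<lambda>t. - (K * t) - (x - X t)\<^sup>2 / 2 * (exp (- (m * t)) / s)) has_real_derivative
      - (K * 1) - (- ((x - X t) * X') * (exp (- (m * t)) / s) + - m * (exp (- (m * t)) / s) * ((x - X t)\<^sup>2 / 2)))
      (at t within S)"
    by (intro DERIV_diff DERIV_minus DERIV_cmult DERIV_ident DERIV_mult q z)
  from DERIV_cmult[OF DERIV_chain2[OF DERIV_exp this], of C]
  show "((\<lambda>t. gauss C K m s X t x) has_real_derivative gauss C K m s X t x *
      (- K + (x - X t) * X' * (exp (- (m * t)) / s) + (x - X t)\<^sup>2 / 2 * m * (exp (- (m * t)) / s))) (at t within S)"
    unfolding gauss_def by (rule DERIV_cong) (simp add: algebra_simps)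
  define Q where "Q = exp (- (m * t)) / s"
  have w: "((\<lambda>x. gauss C K m s X t x) has_real_derivative gauss C K m s X t x * - ((x - X t) * Q)) (at x)" for x
    unfolding gauss_def Q_def[symmetric] by (rule derivative_eq_intros refl | simp)+
  then show "(gauss C K m s X t has_real_derivative gauss C K m s X t x * - ((x - X t) * (exp (- (m * t)) / s))) (at x)"
    by (simp add: Q_def)
  have l: "((\<lambda>x. - ((x - X t) * Q)) has_real_derivative - Q) (at x)"
    by (rule derivative_eq_intros refl | simp)+
  show "((\<lambda>x. gauss C K m s X t x * - ((x - X t) * (exp (- (m * t)) / s))) has_real_derivative
      gauss C K m s X t x * (((x - X t) * (exp (- (m * t)) / s))\<^sup>2 - exp (- (m * t)) / s)) (at x)"
    using DERIV_mult[OF w l] unfolding Q_def[symmetric]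
    by (rule DERIV_cong) (simp add: algebra_simps power2_eq_square)
qed

lemma gauss_continuous_on:
  assumes "continuous_on {0..T} X" "s \<noteq> 0"
  shows "continuous_on ({0..T} \<times> {l..r}) (\<lambda>(t, x). gauss C K m s X t x)"
proof -
  have "continuous_on ({0..T} \<times> {l..r}) (\<lambda>q. X (fst q))"
    by (rule continuous_on_compose2[OF assms(1) continuous_on_fst]) (auto intro: continuous_on_id)
  then show ?thesis
    unfolding gauss_def split_def using assms(2) by (intro continuous_intros) auto
qed

context
  fixes L T \<epsilon> \<Lambda> d s :: real and a c X :: "real \<Rightarrow> real" and u u1 u2 :: "real \<Rightarrow> real \<Rightarrow> real"
  assumes sol: "classical_sol L T \<epsilon> a c u u1 u2" and \<epsilon>: "0 < \<epsilon>"
    and a: "continuous_on {0..L} a" and c: "continuous_on {0..L} c"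
    and c0: "\<And>x. x \<in> {0..L} \<Longrightarrow> c x \<le> 0"
    and lip: "\<And>x y. x \<in> {0..L} \<Longrightarrow> y \<in> {0..L} \<Longrightarrow> \<bar>a x - a y\<bar> \<le> \<Lambda> * \<bar>x - y\<bar>"
    and \<Lambda>: "1 \<le> \<Lambda>" and d: "0 < d" and s: "0 < s"
    and X: "\<And>t. t \<in> {0..T} \<Longrightarrow> (X has_real_derivative - a (X t)) (at t within {0..T})"
    and Xr: "\<And>t. t \<in> {0..T} \<Longrightarrow> X t \<in> {d..L - d}"
begin

text \<open>In the frame moving with \<open>X\<close> only the difference
  \<open>a x - a (X t)\<close> of the drift survives. By the Lipschitz bound its effect is quadratic
  in the distance from the centre, the same order as that of a changing width.\<close>

lemma drift_bounds:
  assumes t: "t \<in> {0..T}" and x: "x \<in> {0..L}" and q: "0 \<le> q"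
  shows "- (\<Lambda> * (x - X t)\<^sup>2 * q) \<le> (x - X t) * (a x - a (X t)) * q"
    "(x - X t) * (a x - a (X t)) * q \<le> \<Lambda> * (x - X t)\<^sup>2 * q"
proof -
  have "X t \<in> {0..L}" using Xr[OF t] d by auto
  have "\<bar>(x - X t) * (a x - a (X t))\<bar> \<le> \<bar>x - X t\<bar> * (\<Lambda> * \<bar>x - X t\<bar>)"
    unfolding abs_mult by (intro mult_left_mono lip x \<open>X t \<in> {0..L}\<close>) auto
  also have "\<dots> = \<Lambda> * (x - X t)\<^sup>2" by (simp add: power2_eq_square flip: abs_mult)
  finally have "- (\<Lambda> * (x - X t)\<^sup>2) \<le> (x - X t) * (a x - a (X t))" "(x - X t) * (a x - a (X t)) \<le> \<Lambda> * (x - X t)\<^sup>2"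
    by (auto simp: abs_le_iff)
  from this[THEN mult_right_mono[OF _ q]]
  show "- (\<Lambda> * (x - X t)\<^sup>2 * q) \<le> (x - X t) * (a x - a (X t)) * q"
    "(x - X t) * (a x - a (X t)) * q \<le> \<Lambda> * (x - X t)\<^sup>2 * q" by simp_all
qed

text \<open>The parabolic operator applied to a Gaussian, with the Gaussian factored out and the
  bracket sorted into shear, change of width, diffusion and zero-order terms; only the sign of the
  bracket remains to be checked.\<close>

lemma gauss_operator:
  fixes C K m t x :: real
  defines "q \<equiv> exp (- (m * t)) / s"
  shows "gauss C K m s X t x * (- K + (x - X t) * - a (X t) * q + (x - X t)\<^sup>2 / 2 * m * q)
    - \<epsilon> * (gauss C K m s X t x * (((x - X t) * q)\<^sup>2 - q)) - a x * (gauss C K m s X t x * - ((x - X t) * q))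
    - c x * gauss C K m s X t x
    = gauss C K m s X t x * (- K + (x - X t) * (a x - a (X t)) * q + m / 2 * ((x - X t)\<^sup>2 * q)
        - \<epsilon> * q * ((x - X t)\<^sup>2 * q) + \<epsilon> * q - c x)"
  by (simp add: algebra_simps power2_eq_square add_divide_distrib diff_divide_distrib)

text \<open>The width \<open>s exp (4 \<Lambda> t)\<close> grows fast enough to absorb both the shear of the drift and the
  diffusion, whereas for \<open>s exp (- 2 \<Lambda> t)\<close> below the shear has the right sign for a subsolution.\<close>

lemma classical_sol_le_gauss:
  assumes \<epsilon>s: "\<epsilon> \<le> s" and \<delta>: "0 \<le> \<delta>"
    and init: "\<And>x. x \<in> {0..L} \<Longrightarrow> u 0 x \<le> gauss 1 0 (4 * \<Lambda>) s X 0 x + \<delta>"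
    and t: "t \<in> {0..T}" and x: "x \<in> {0..L}"
  shows "u t x \<le> gauss 1 0 (4 * \<Lambda>) s X t x + \<delta>"
proof -
  let ?W = "gauss 1 0 (4 * \<Lambda>) s X"
  let ?q = "\<lambda>t. exp (- (4 * \<Lambda> * t)) / s"
  have Xc: "continuous_on {0..T} X" using X by (rule DERIV_continuous_on)
  have W0: "0 \<le> ?W t x" for t x by (simp add: gauss_def)
  show ?thesis
  proof (rule classical_sol_le_supersolution[where W="\<lambda>t x. ?W t x + \<delta>"
        and Wt="\<lambda>t x. ?W t x * (- 0 + (x - X t) * - a (X t) * ?q t + (x - X t)\<^sup>2 / 2 * (4 * \<Lambda>) * ?q t) + 0"
        and ?W1.0="\<lambda>t x. ?W t x * - ((x - X t) * ?q t) + 0"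
        and ?W2.0="\<lambda>t x. ?W t x * (((x - X t) * ?q t)\<^sup>2 - ?q t) + 0",
        OF sol \<epsilon> a c c0 order_refl order_refl _ _ _ _ _ init _ _ t x])
    show "continuous_on ({0..T} \<times> {0..L}) (\<lambda>(t, x). ?W t x + \<delta>)"
      using gauss_continuous_on[OF Xc, of s 0 L 1 0 "4 * \<Lambda>"] s
      unfolding split_def by (intro continuous_intros) auto
    show "u t 0 \<le> ?W t 0 + \<delta>" "u t L \<le> ?W t L + \<delta>" if "t \<in> {0..T}" for t
      using classical_solD(1,2)[OF sol that] W0[of t 0] W0[of t L] \<delta> by simp_all
  next
    fix t x assume t: "t \<in> {0..T}" and x: "x \<in> {0..L}"
    show "((\<lambda>t. ?W t x + \<delta>) has_real_derivative ?W t x *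
      (- 0 + (x - X t) * - a (X t) * ?q t + (x - X t)\<^sup>2 / 2 * (4 * \<Lambda>) * ?q t) + 0) (at t within {0..T})"
      by (rule DERIV_add[OF gauss_has_derivatives(1)[OF X[OF t]] DERIV_const])
    show "((\<lambda>x. ?W t x + \<delta>) has_real_derivative ?W t x * - ((x - X t) * ?q t) + 0) (at x)"
      by (rule DERIV_add[OF gauss_has_derivatives(2)[OF X[OF t]] DERIV_const])
    show "((\<lambda>x. ?W t x * - ((x - X t) * ?q t) + 0) has_real_derivative
        ?W t x * (((x - X t) * ?q t)\<^sup>2 - ?q t) + 0) (at x)"
      by (rule DERIV_add[OF gauss_has_derivatives(3)[OF X[OF t]] DERIV_const])
    define q where "q = ?q t"
    have q0: "0 < q" using s by (simp add: q_def)
    \<comment> \<open>In units of \<open>\<Lambda> * ((x - X t)\<^sup>2 * q)\<close>, the growing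
      width contributes 2, while shear and diffusion take at most 1 each, the latter because
      \<open>\<epsilon> * q \<le> 1 \<le> \<Lambda>\<close>. This is the origin of
      \<open>4 * \<Lambda>\<close>.\<close>
    have "q \<le> 1 / s"
      unfolding q_def using t \<Lambda> s by (intro divide_right_mono) auto
    then have "\<epsilon> * q \<le> s * (1 / s)" using \<epsilon>s \<epsilon> q0 s by (intro mult_mono) auto
    then have "\<epsilon> * q \<le> \<Lambda>" using s \<Lambda> by simp
    then have "\<epsilon> * q * ((x - X t)\<^sup>2 * q) \<le> \<Lambda> * ((x - X t)\<^sup>2 * q)" using q0 by (intro mult_right_mono) auto
    then have "0 \<le> - 0 + (x - X t) * (a x - a (X t)) * q + (4 * \<Lambda>) / 2 * ((x - X t)\<^sup>2 * q)
        - \<epsilon> * q * ((x - X t)\<^sup>2 * q) + \<epsilon> * q - c x"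
      using drift_bounds(1)[OF t x less_imp_le[OF q0]] c0[OF x] mult_pos_pos[OF \<epsilon> q0] by (simp add: mult.assoc)
    then have "0 \<le> ?W t x * (- 0 + (x - X t) * (a x - a (X t)) * q + (4 * \<Lambda>) / 2 * ((x - X t)\<^sup>2 * q)
        - \<epsilon> * q * ((x - X t)\<^sup>2 * q) + \<epsilon> * q - c x)"
      by (intro mult_nonneg_nonneg W0)
    then have "0 \<le> ?W t x * (- 0 + (x - X t) * - a (X t) * ?q t + (x - X t)\<^sup>2 / 2 * (4 * \<Lambda>) * ?q t)
      - \<epsilon> * (?W t x * (((x - X t) * ?q t)\<^sup>2 - ?q t)) - a x * (?W t x * - ((x - X t) * ?q t)) - c x * ?W t x"
      unfolding gauss_operator q_def .
    moreover have "0 \<le> - c x * \<delta>" using c0[OF x] \<delta> by (intro mult_nonneg_nonneg) auto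
    ultimately show "0 \<le> ?W t x * (- 0 + (x - X t) * - a (X t) * ?q t + (x - X t)\<^sup>2 / 2 * (4 * \<Lambda>) * ?q t) + 0
      - \<epsilon> * (?W t x * (((x - X t) * ?q t)\<^sup>2 - ?q t) + 0) - a x * (?W t x * - ((x - X t) * ?q t) + 0)
      - c x * (?W t x + \<delta>)"
      unfolding distrib_left add_0_right by linarith
  qed
qed

lemma gauss_le_classical_sol:
  assumes \<epsilon>s: "\<epsilon> * exp (2 * \<Lambda> * T) \<le> s" and \<eta>: "0 \<le> \<eta>" and \<kappa>: "\<eta> * exp (- (d\<^sup>2 / (2 * s))) \<le> \<kappa>"
    and C0: "\<And>x. x \<in> {0..L} \<Longrightarrow> - c x \<le> C0"
    and init: "\<And>x. x \<in> {0..L} \<Longrightarrow> gauss \<eta> (1 + C0) (- 2 * \<Lambda>) s X 0 x - \<kappa> \<le> u 0 x"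
    and t: "t \<in> {0..T}" and x: "x \<in> {0..L}"
  shows "gauss \<eta> (1 + C0) (- 2 * \<Lambda>) s X t x - \<kappa> \<le> u t x"
proof -
  \<comment> \<open>The decay rate pays for the terms without a quadratic factor: 1 for
    \<open>\<epsilon> * q\<close> and \<open>C0\<close> for \<open>- c x\<close>.\<close>
  let ?K = "1 + C0"
  let ?W = "gauss \<eta> ?K (- 2 * \<Lambda>) s X"
  let ?q = "\<lambda>t. exp (- (- 2 * \<Lambda> * t)) / s"
  have Xc: "continuous_on {0..T} X" using X by (rule DERIV_continuous_on)
  have W0: "0 \<le> ?W t x" for t x using \<eta> by (simp add: gauss_def)
  have \<kappa>0: "0 \<le> \<kappa>" using \<kappa> \<eta> by (meson exp_ge_zero mult_nonneg_nonneg order_trans)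
  have "0 \<le> C0" using C0[OF x] c0[OF x] by linarith
  \<comment> \<open>The Gaussian is positive at the boundary, where the solution vanishes;
    subtracting \<kappa> repairs this. As the profile contracts, its initial width gives the worst
    bound.\<close>
  have bd: "?W t x \<le> \<kappa>" if t: "t \<in> {0..T}" and x: "d \<le> \<bar>x - X t\<bar>" for t x
  proof -
    have "d\<^sup>2 \<le> (x - X t)\<^sup>2" using d x by (simp add: abs_le_square_iff[symmetric])
    moreover have "1 / s \<le> ?q t" using t \<Lambda> s by (intro divide_right_mono) auto
    ultimately have "d\<^sup>2 / 2 * (1 / s) \<le> (x - X t)\<^sup>2 / 2 * ?q t"
      using s by (intro mult_mono) auto
    moreover have "0 \<le> ?K * t" using \<open>0 \<le> C0\<close> t by simp
    ultimately have "- (?K * t) - (x - X t)\<^sup>2 / 2 * ?q t \<le> - (d\<^sup>2 / (2 * s))" by simp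
    then have "?W t x \<le> \<eta> * exp (- (d\<^sup>2 / (2 * s)))"
      unfolding gauss_def using \<eta> by (intro mult_left_mono) auto
    then show ?thesis using \<kappa> by linarith
  qed
  have "- u t x \<le> - ?W t x + \<kappa>"
  proof (rule classical_sol_le_supersolution[where W="\<lambda>t x. - ?W t x + \<kappa>"
        and Wt="\<lambda>t x. - (?W t x * (- ?K + (x - X t) * - a (X t) * ?q t + (x - X t)\<^sup>2 / 2 * (- 2 * \<Lambda>) * ?q t)) + 0"
        and ?W1.0="\<lambda>t x. - (?W t x * - ((x - X t) * ?q t)) + 0"
        and ?W2.0="\<lambda>t x. - (?W t x * (((x - X t) * ?q t)\<^sup>2 - ?q t)) + 0",
        OF classical_sol_minus[OF sol] \<epsilon> a c c0 order_refl order_refl _ _ _ _ _ _ _ _ t x])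
    show "continuous_on ({0..T} \<times> {0..L}) (\<lambda>(t, x). - ?W t x + \<kappa>)"
      using gauss_continuous_on[OF Xc, of s 0 L \<eta> ?K "- 2 * \<Lambda>"] s
      unfolding split_def by (intro continuous_intros) auto
    show "- u t 0 \<le> - ?W t 0 + \<kappa>" "- u t L \<le> - ?W t L + \<kappa>" if t: "t \<in> {0..T}" for t
      using classical_solD(1,2)[OF sol t] bd[OF t, of 0] bd[OF t, of L] Xr[OF t] by auto
    show "- u 0 x \<le> - ?W 0 x + \<kappa>" if "x \<in> {0..L}" for x using init[OF that] by simp
  next
    fix t x assume t: "t \<in> {0..T}" and x: "x \<in> {0..L}"
    show "((\<lambda>t. - ?W t x + \<kappa>) has_real_derivative - (?W t x *
      (- ?K + (x - X t) * - a (X t) * ?q t + (x - X t)\<^sup>2 / 2 * (- 2 * \<Lambda>) * ?q t)) + 0) (at t within {0..T})"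
      by (rule DERIV_add[OF DERIV_minus[OF gauss_has_derivatives(1)[OF X[OF t]]] DERIV_const])
    show "((\<lambda>x. - ?W t x + \<kappa>) has_real_derivative - (?W t x * - ((x - X t) * ?q t)) + 0) (at x)"
      by (rule DERIV_add[OF DERIV_minus[OF gauss_has_derivatives(2)[OF X[OF t]]] DERIV_const])
    show "((\<lambda>x. - (?W t x * - ((x - X t) * ?q t)) + 0) has_real_derivative
        - (?W t x * (((x - X t) * ?q t)\<^sup>2 - ?q t)) + 0) (at x)"
      by (rule DERIV_add[OF DERIV_minus[OF gauss_has_derivatives(3)[OF X[OF t]]] DERIV_const])
    define q where "q = ?q t"
    have q0: "0 < q" using s by (simp add: q_def)
    have "q \<le> exp (2 * \<Lambda> * T) / s"
      unfolding q_def using t \<Lambda> s by (intro divide_right_mono) auto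
    then have "\<epsilon> * q \<le> \<epsilon> * (exp (2 * \<Lambda> * T) / s)" using \<epsilon> by (intro mult_left_mono) auto
    also have "\<dots> \<le> 1" using \<epsilon>s s by (simp add: field_simps)
    finally have \<epsilon>q: "\<epsilon> * q \<le> 1" .
    have "0 \<le> \<epsilon> * q * ((x - X t)\<^sup>2 * q)" using \<epsilon> q0 by (intro mult_nonneg_nonneg) auto
    then have "- ?K + (x - X t) * (a x - a (X t)) * q + (- 2 * \<Lambda>) / 2 * ((x - X t)\<^sup>2 * q)
        - \<epsilon> * q * ((x - X t)\<^sup>2 * q) + \<epsilon> * q - c x \<le> 0"
      using drift_bounds(2)[OF t x less_imp_le[OF q0]] C0[OF x] \<epsilon>q by (simp add: mult.assoc)
    then have "?W t x * (- ?K + (x - X t) * (a x - a (X t)) * q + (- 2 * \<Lambda>) / 2 * ((x - X t)\<^sup>2 * q)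
        - \<epsilon> * q * ((x - X t)\<^sup>2 * q) + \<epsilon> * q - c x) \<le> 0"
      by (intro mult_nonneg_nonpos W0)
    then have "?W t x * (- ?K + (x - X t) * - a (X t) * ?q t + (x - X t)\<^sup>2 / 2 * (- 2 * \<Lambda>) * ?q t)
      - \<epsilon> * (?W t x * (((x - X t) * ?q t)\<^sup>2 - ?q t)) - a x * (?W t x * - ((x - X t) * ?q t)) - c x * ?W t x \<le> 0"
      unfolding gauss_operator q_def .
    moreover have "0 \<le> - c x * \<kappa>" using c0[OF x] \<kappa>0 by (intro mult_nonneg_nonneg) auto
    ultimately show "0 \<le> - (?W t x * (- ?K + (x - X t) * - a (X t) * ?q t + (x - X t)\<^sup>2 / 2 * (- 2 * \<Lambda>) * ?q t)) + 0
      - \<epsilon> * (- (?W t x * (((x - X t) * ?q t)\<^sup>2 - ?q t)) + 0) - a x * (- (?W t x * - ((x - X t) * ?q t)) + 0)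
      - c x * (- ?W t x + \<kappa>)"
      unfolding distrib_left add_0_right by (simp only: mult_minus_right mult_minus_left)
  qed
  then show ?thesis by simp
qed

end

section \<open>Classical solutions solve the adjoint problem\<close>

text \<open>Passes between the coefficient \<open>a' - b\<close> of the adjoint equation and the
  nonpositive coefficient needed for comparison.\<close>

lemma classical_sol_exp:
  assumes sol: "classical_sol L T \<epsilon> a c u u1 u2" and a: "continuous_on {0..L} a" and c: "continuous_on {0..L} c"
  shows "classical_sol L T \<epsilon> a (\<lambda>x. c x + \<omega>) (\<lambda>t x. exp (\<omega> * t) * u t x)
    (\<lambda>t x. exp (\<omega> * t) * u1 t x) (\<lambda>t x. exp (\<omega> * t) * u2 t x)"
  unfolding classical_sol_def
proof (intro ballI conjI)
  fix t assume t: "t \<in> {0..T}"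
  let ?D = "\<lambda>x. \<epsilon> * u2 t x + a x * u1 t x + c x * u t x"
  let ?F = "at t within {0..T}"
  show "exp (\<omega> * t) * u t 0 = 0" "exp (\<omega> * t) * u t L = 0" using classical_solD(1,2)[OF sol t] by simp_all
  show "continuous_on {0..L} (\<lambda>x. exp (\<omega> * t) * u2 t x)"
    by (intro continuous_intros classical_solD(3)[OF sol t])
  show "((\<lambda>x. exp (\<omega> * t) * u t x) has_real_derivative exp (\<omega> * t) * u1 t x) (at x within {0..L})"
    "((\<lambda>x. exp (\<omega> * t) * u1 t x) has_real_derivative exp (\<omega> * t) * u2 t x) (at x within {0..L})"
    if "x \<in> {0..L}" for x
    by (rule DERIV_cmult[OF classical_solD(4)[OF sol t that]] DERIV_cmult[OF classical_solD(5)[OF sol t that]])+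
  have bD: "bounded (?D ` {0..L})"
    by (intro compact_imp_bounded compact_continuous_image compact_Icc continuous_intros
        a c classical_sol_continuous[OF sol t] classical_solD(3)[OF sol t])
  have bu: "bounded (u t ` {0..L})"
    by (intro compact_imp_bounded compact_continuous_image compact_Icc classical_sol_continuous[OF sol t])
  have unif: "uniform_limit {0..L} (\<lambda>s x. h s) (\<lambda>x. l) ?F" if "(h \<longlongrightarrow> l) ?F" for h and l :: real
  proof (rule uniform_limitI)
    show "\<forall>\<^sub>F s in ?F. \<forall>x\<in>{0..L}. dist (h s) l < e" if "0 < e" for e
      using tendstoD[OF \<open>(h \<longlongrightarrow> l) ?F\<close> that] by (rule eventually_mono) simp
  qed
  have bc: "bounded ((\<lambda>x. k) ` {0..L})" for k :: real
    by (rule bounded_subset[of "{k}"]) auto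
  have ed: "((\<lambda>s. exp (\<omega> * s)) has_real_derivative \<omega> * exp (\<omega> * t)) ?F"
    by (rule derivative_eq_intros refl | simp)+
  have e1: "((\<lambda>s. (exp (\<omega> * s) - exp (\<omega> * t)) / (s - t)) \<longlongrightarrow> \<omega> * exp (\<omega> * t)) ?F"
    using ed by (simp add: has_field_derivative_iff)
  have e2: "((\<lambda>s. exp (\<omega> * s)) \<longlongrightarrow> exp (\<omega> * t)) ?F" by (intro tendsto_intros)
  \<comment> \<open>The product rule at the level of difference quotients, so that uniformity in
    \<open>x\<close> is kept.\<close>
  have "uniform_limit {0..L} (\<lambda>s x. exp (\<omega> * s) * ((u s x - u t x) / (s - t))
        + ((exp (\<omega> * s) - exp (\<omega> * t)) / (s - t)) * u t x)
      (\<lambda>x. exp (\<omega> * t) * ?D x + (\<omega> * exp (\<omega> * t)) * u t x) ?F"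
    by (intro uniform_limit_add uniform_lim_mult unif e1 e2 classical_solD(6)[OF sol t] uniform_limit_const bc bD bu)
  then show "uniform_limit {0..L} (\<lambda>s x. (exp (\<omega> * s) * u s x - exp (\<omega> * t) * u t x) / (s - t))
      (\<lambda>x. \<epsilon> * (exp (\<omega> * t) * u2 t x) + a x * (exp (\<omega> * t) * u1 t x) + (c x + \<omega>) * (exp (\<omega> * t) * u t x)) ?F"
  proof (rule uniform_limit_cong'[THEN iffD1, rotated 2])
    show "exp (\<omega> * s) * ((u s x - u t x) / (s - t)) + ((exp (\<omega> * s) - exp (\<omega> * t)) / (s - t)) * u t x
      = (exp (\<omega> * s) * u s x - exp (\<omega> * t) * u t x) / (s - t)" for s x
      by (simp add: algebra_simps diff_divide_distrib)
    show "exp (\<omega> * t) * ?D x + (\<omega> * exp (\<omega> * t)) * u t x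
      = \<epsilon> * (exp (\<omega> * t) * u2 t x) + a x * (exp (\<omega> * t) * u1 t x) + (c x + \<omega>) * (exp (\<omega> * t) * u t x)" for x
      by (simp add: algebra_simps)
  qed
qed

section \<open>From uniform to square-integrable and weak notions\<close>

lemma continuous_on_imp_L2: "continuous_on {a..b} f \<Longrightarrow> f \<in> L2 a b"
  unfolding L2_def
  by (simp add: continuous_imp_integrable_real continuous_on_power borel_measurable_integrable)

lemma L2_nrm_le:
  assumes L: "0 \<le> L" and B: "\<And>x. x \<in> {0..L} \<Longrightarrow> \<bar>f x\<bar> \<le> B" "0 \<le> B"
  shows "L2_nrm 0 L f \<le> sqrt L * B"
proof -
  have "L2_ip 0 L f f \<le> L * B\<^sup>2"
  proof (cases "integrable (lebesgue_on {0..L}) (\<lambda>x. f x * f x)")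
    case True
    have "L2_ip 0 L f f \<le> (LINT x|lebesgue_on {0..L}. B\<^sup>2)"
      unfolding L2_ip_def
    proof (rule integral_mono[OF True])
      show "integrable (lebesgue_on {0..L}) (\<lambda>x. B\<^sup>2)" by (intro continuous_imp_integrable_real continuous_intros)
      fix x assume "x \<in> space (lebesgue_on {0..L})"
      then have "\<bar>f x\<bar> \<le> B" using B by (simp add: space_restrict_space)
      then have "\<bar>f x\<bar>\<^sup>2 \<le> B\<^sup>2" by (intro power_mono) auto
      then show "f x * f x \<le> B\<^sup>2" by (simp add: power2_eq_square)
    qed
    also have "\<dots> = L * B\<^sup>2" using L by (simp add: measure_restrict_space)
    finally show ?thesis .
  next
    case False
    \<comment> \<open>A non-integrable square has integral 0 by convention.\<close>
    then show ?thesis using L by (simp add: L2_ip_def not_integrable_integral_eq)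
  qed
  then have "sqrt (L2_ip 0 L f f) \<le> sqrt (L * B\<^sup>2)" by simp
  then show ?thesis unfolding L2_nrm_def using B by (simp add: real_sqrt_mult)
qed

lemma L2_nrm_nonneg: "0 \<le> L2_nrm a b f"
  unfolding L2_nrm_def L2_ip_def by (intro real_sqrt_ge_zero integral_nonneg_AE) simp

lemma L2_nrm_tendsto_0:
  assumes L: "0 \<le> L" and f: "uniform_limit {0..L} f (\<lambda>x. 0) F"
  shows "((\<lambda>s. L2_nrm 0 L (f s)) \<longlongrightarrow> 0) F"
proof (rule tendstoI)
  fix e :: real assume e: "0 < e"
  define e' where "e' = e / (sqrt L + 1)"
  have s: "0 \<le> sqrt L" using L by simp
  have e': "0 < e'" "sqrt L * e' < e"
  proof -
    show "0 < e'" using e s by (simp add: e'_def add_nonneg_pos)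
    then have "sqrt L * e' < (sqrt L + 1) * e'" by (simp add: distrib_right)
    also have "\<dots> = e" using s by (simp add: e'_def add_nonneg_eq_0_iff)
    finally show "sqrt L * e' < e" .
  qed
  from uniform_limitD[OF f e'(1)] show "\<forall>\<^sub>F s in F. dist (L2_nrm 0 L (f s)) 0 < e"
  proof eventually_elim
    case (elim s)
    then have "L2_nrm 0 L (f s) \<le> sqrt L * e'"
      using e' L by (intro L2_nrm_le) (auto simp: dist_real_def less_imp_le)
    then show ?case using e' L2_nrm_nonneg[of 0 L "f s"] by (simp add: dist_real_def)
  qed
qed

lemma weak_derivI:
  assumes L: "0 < L" and f: "\<And>x. x \<in> {0..L} \<Longrightarrow> (f has_real_derivative g x) (at x within {0..L})"
    and g: "continuous_on {0..L} g"
  shows "weak_deriv L f g"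
  unfolding weak_deriv_def
proof (intro conjI allI impI)
  have fc: "continuous_on {0..L} f" using f by (rule DERIV_continuous_on)
  show "f \<in> L2 0 L" "g \<in> L2 0 L" by (intro continuous_on_imp_L2 fc g)+
  fix \<phi> assume \<phi>: "test_fun L \<phi>"
  have d: "(\<phi> has_real_derivative deriv \<phi> x) (at x)" for x
    using \<phi> field_differentiable_derivI[of \<phi> x] unfolding test_fun_def by (metis funpow_0)
  have "deriv \<phi> field_differentiable at x" for x
    using \<phi> unfolding test_fun_def by (metis funpow_0 funpow_simps_right(2) o_apply One_nat_def)
  then have dc: "continuous_on {0..L} (deriv \<phi>)"
    by (intro continuous_at_imp_continuous_on ballI field_differentiable_imp_continuous_at)
  have \<phi>c: "continuous_on {0..L} \<phi>"
    by (rule DERIV_continuous_on) (rule has_field_derivative_at_within[OF d])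
  have \<phi>0: "\<phi> 0 = 0" "\<phi> L = 0" using \<phi> unfolding test_fun_def by force+
  have "((\<lambda>x. g x * \<phi> x + deriv \<phi> x * f x) has_integral f L * \<phi> L - f 0 * \<phi> 0) {0..L}"
  proof (rule fundamental_theorem_of_calculus)
    fix x assume x: "x \<in> {0..L}"
    show "((\<lambda>x. f x * \<phi> x) has_vector_derivative g x * \<phi> x + deriv \<phi> x * f x) (at x within {0..L})"
      using DERIV_mult[OF f[OF x] has_field_derivative_at_within[OF d]]
      by (simp add: has_real_derivative_iff_has_vector_derivative)
  qed (use L in simp)
  then have "integral {0..L} (\<lambda>x. g x * \<phi> x + deriv \<phi> x * f x) = 0" by (simp add: \<phi>0 integral_unique)
  moreover have i1: "integrable (lebesgue_on {0..L}) (\<lambda>x. g x * \<phi> x)"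
    by (intro continuous_imp_integrable_real continuous_intros g \<phi>c)
  moreover have i2: "integrable (lebesgue_on {0..L}) (\<lambda>x. f x * deriv \<phi> x)"
    by (intro continuous_imp_integrable_real continuous_intros fc dc)
  ultimately have "(LINT x|lebesgue_on {0..L}. g x * \<phi> x + f x * deriv \<phi> x) = 0"
    by (subst lebesgue_integral_eq_integral) (auto simp: mult.commute intro: Bochner_Integration.integrable_add)
  then show "L2_ip 0 L f (deriv \<phi>) = - L2_ip 0 L g \<phi>"
    unfolding L2_ip_def using i1 i2 by simp
qed

lemma classical_sol_H1_0:
  assumes L: "0 < L" and sol: "classical_sol L T \<epsilon> a c u u1 u2" and t: "t \<in> {0..T}"
  shows "u t \<in> H1_0 L" "weak_deriv L (u t) (u1 t)"
proof -
  show wd: "weak_deriv L (u t) (u1 t)"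
    by (rule weak_derivI[OF L classical_solD(4)[OF sol t] classical_sol_continuous(2)[OF sol t]])
  show "u t \<in> H1_0 L"
    unfolding H1_0_def using classical_sol_continuous(1)[OF sol t] wd classical_solD(1,2)[OF sol t] by auto
qed

text \<open>On a bounded interval uniform limits are limits in \<open>L2\<close>, and classical
  derivatives are weak ones, so \<open>u2 t\<close> serves as the witness for the second
  derivative.\<close>

lemma classical_sol_imp_adjoint_sol:
  assumes L: "0 < L" and sol: "classical_sol L T \<epsilon> a (\<lambda>x. a' x - b x) u u1 u2"
    and a: "continuous_on {0..L} a" and c: "continuous_on {0..L} (\<lambda>x. a' x - b x)"
  shows "adjoint_sol L a a' b T \<epsilon> (u 0) u u1"
proof -
  note cont = classical_sol_continuous[OF sol]
  have wd2: "weak_deriv L (u1 t) (u2 t)" if "t \<in> {0..T}" for t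
    by (rule weak_derivI[OF L classical_solD(5)[OF sol that] classical_solD(3)[OF sol that]])
  have sub: "uniform_limit {0..L} (\<lambda>s x. f s x - l x) (\<lambda>x. 0) F"
    if "uniform_limit {0..L} f l F" for f :: "real \<Rightarrow> real \<Rightarrow> real" and l F
    using uniform_limit_minus[OF that uniform_limit_const[where c=l]] by simp
  have "C0_L2 T L u"
    unfolding C0_L2_def
    using continuous_on_imp_L2[OF cont(1)]
      L2_nrm_tendsto_0[OF less_imp_le[OF L] sub[OF classical_sol_uniform_limit[OF sol _ a c]]]
    by simp
  moreover have "\<exists>w. weak_deriv L (u1 t) w \<and>
       ((\<lambda>s. L2_nrm 0 L (\<lambda>x. (u s x - u t x) / (s - t)
            - (a x * u1 t x + (a' x - b x) * u t x + \<epsilon> * w x))) \<longlongrightarrow> 0) (at t within {0..T})" if t: "t \<in> {0..T}" for t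
  proof (intro exI[of _ "u2 t"] conjI wd2 t)
    have "((\<lambda>s. L2_nrm 0 L (\<lambda>x. (u s x - u t x) / (s - t)
            - (\<epsilon> * u2 t x + a x * u1 t x + (a' x - b x) * u t x))) \<longlongrightarrow> 0) (at t within {0..T})"
      by (rule L2_nrm_tendsto_0[OF less_imp_le[OF L] sub[OF classical_solD(6)[OF sol t]]])
    then show "((\<lambda>s. L2_nrm 0 L (\<lambda>x. (u s x - u t x) / (s - t)
            - (a x * u1 t x + (a' x - b x) * u t x + \<epsilon> * u2 t x))) \<longlongrightarrow> 0) (at t within {0..T})"
      by (simp add: add.commute add.left_commute)
  qed
  ultimately show ?thesis
    unfolding adjoint_sol_def using classical_sol_H1_0[OF L sol] cont(2) by simp
qed

section \<open>Characteristics staying inside the interval\<close>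

text \<open>The transport time may be infinite because of zeros of \<open>a\<close> at the ends.
  Monotone convergence along the exhausting intervals \<open>A n\<close> yields a compact one inside
  \<open>{0<..<L}\<close> whose crossing time is finite and still exceeds \<open>T\<close>.\<close>

lemma transport_time_compact_subinterval:
  assumes L: "0 < L" and a: "continuous_on {0..L} a" and nz: "\<And>x. x \<in> {0<..<L} \<Longrightarrow> a x \<noteq> 0"
    and T: "ennreal T < transport_time L a" "0 \<le> T"
  obtains l r where "0 < l" "l < r" "r < L" "T < integral {l..r} (\<lambda>x. 1 / \<bar>a x\<bar>)"
proof -
  let ?f = "\<lambda>x. 1 / ennreal \<bar>a x\<bar>"
  let ?M = "lebesgue_on {0..L}"
  \<comment> \<open>The summand 3 keeps \<open>l n\<close> below a third of \<open>L\<close>, so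
    every \<open>A n\<close> is nondegenerate.\<close>
  define l where "l n = L / (real n + 3)" for n :: nat
  define A where "A n = {l n..L - l n}" for n :: nat
  have l: "0 < l n" "3 * l n \<le> L" for n
  proof -
    show "0 < l n" using L by (simp add: l_def)
    have "3 * L \<le> L * (real n + 3)" using L by (simp add: algebra_simps)
    then show "3 * l n \<le> L" by (simp add: l_def field_simps)
  qed
  have l_mono: "l n \<le> l m" if "m \<le> n" for m n
    unfolding l_def using L that by (intro divide_left_mono) auto
  have A_mono: "A m \<subseteq> A n" if "m \<le> n" for m n
    unfolding A_def using l_mono[OF that] by auto
  have [measurable]: "a \<in> borel_measurable ?M"
    using continuous_imp_integrable_real[OF a] by (rule borel_measurable_integrable)
  have A_sets [measurable]: "A n \<in> sets ?M" for n
  proof -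
    have "A n \<subseteq> {0..L}" using l[of n] by (auto simp: A_def)
    then show ?thesis by (simp add: sets_restrict_space_iff A_def)
  qed
  have "transport_time L a \<le> (\<integral>\<^sup>+x. (SUP n. ?f x * indicator (A n) x) \<partial>?M)"
    unfolding transport_time_def
  proof (rule nn_integral_mono_AE)
    have "negligible {0, L}" by simp
    then have "{0, L} \<in> null_sets lebesgue" by (simp add: negligible_iff_null_sets)
    then have "{0, L} \<in> null_sets ?M" using L by (simp add: null_sets_restrict_space)
    then have "AE x in ?M. x \<notin> {0, L}" by (rule AE_not_in)
    moreover have "AE x in ?M. x \<in> {0..L}" by (rule AE_I2) (simp add: space_restrict_space)
    ultimately show "AE x in ?M. ?f x \<le> (SUP n. ?f x * indicator (A n) x)"
    proof eventually_elim
      case (elim x)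
      then have x: "0 < x" "x < L" by auto
      define \<mu> where "\<mu> = min x (L - x)"
      have \<mu>: "0 < \<mu>" using x by (simp add: \<mu>_def)
      obtain n :: nat where "L / \<mu> < n" using reals_Archimedean2 by blast
      then have "L < real n * \<mu>" using \<mu> by (simp add: divide_less_eq)
      then have "L < (real n + 3) * \<mu>" using \<mu> unfolding distrib_right by linarith
      then have "l n \<le> min x (L - x)" by (simp add: l_def field_simps flip: \<mu>_def)
      then have "x \<in> A n" by (auto simp: A_def)
      then have "?f x = ?f x * indicator (A n) x" by simp
      also have "\<dots> \<le> (SUP n. ?f x * indicator (A n) x)" by (rule SUP_upper) simp
      finally show ?case .
    qed
  qed
  also have "\<dots> = (SUP n. \<integral>\<^sup>+x. ?f x * indicator (A n) x \<partial>?M)"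
  proof (rule nn_integral_monotone_convergence_SUP)
    show "incseq (\<lambda>n x. ?f x * indicator (A n) x)"
      unfolding incseq_def le_fun_def
    proof (intro allI impI mult_left_mono)
      show "indicator (A m) x \<le> (indicator (A n) x :: ennreal)" if "m \<le> n" for m n x
        using A_mono[OF that] by (auto simp: indicator_def)
    qed simp
  qed measurable
  finally have "ennreal T < (SUP n. \<integral>\<^sup>+x. ?f x * indicator (A n) x \<partial>?M)"
    using T(1) by (rule less_le_trans[rotated])
  then obtain n where n: "ennreal T < (\<integral>\<^sup>+x. ?f x * indicator (A n) x \<partial>?M)"
    unfolding less_SUP_iff by blast
  have nzA: "a x \<noteq> 0" if "x \<in> A n" for x using that l[of n] by (intro nz) (auto simp: A_def)
  have cont: "continuous_on (A n) (\<lambda>x. 1 / \<bar>a x\<bar>)"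
    using nzA l[of n] by (intro continuous_intros continuous_on_subset[OF a]) (auto simp: A_def)
  then have int: "integrable (lebesgue_on (A n)) (\<lambda>x. 1 / \<bar>a x\<bar>)"
    unfolding A_def by (rule continuous_imp_integrable_real)
  have "(\<integral>\<^sup>+x. ?f x * indicator (A n) x \<partial>?M) = (\<integral>\<^sup>+x. ?f x * indicator (A n) x * indicator {0..L} x \<partial>lebesgue)"
    by (rule nn_integral_restrict_space) simp
  also have "\<dots> = (\<integral>\<^sup>+x. ?f x * indicator (A n) x \<partial>lebesgue)"
    using l[of n] by (intro nn_integral_cong) (auto simp: A_def indicator_def)
  also have "\<dots> = (\<integral>\<^sup>+x. ?f x \<partial>lebesgue_on (A n))"
    by (rule nn_integral_restrict_space[symmetric]) (simp add: A_def)
  also have "\<dots> = (\<integral>\<^sup>+x. ennreal (1 / \<bar>a x\<bar>) \<partial>lebesgue_on (A n))"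
  proof (rule nn_integral_cong)
    fix x assume "x \<in> space (lebesgue_on (A n))"
    then have "0 < \<bar>a x\<bar>" using nzA by (simp add: space_restrict_space)
    then show "?f x = ennreal (1 / \<bar>a x\<bar>)" by (simp add: divide_ennreal flip: ennreal_1)
  qed
  also have "\<dots> = ennreal (integral\<^sup>L (lebesgue_on (A n)) (\<lambda>x. 1 / \<bar>a x\<bar>))"
    by (rule nn_integral_eq_integral[OF int]) simp
  also have "integral\<^sup>L (lebesgue_on (A n)) (\<lambda>x. 1 / \<bar>a x\<bar>) = integral (A n) (\<lambda>x. 1 / \<bar>a x\<bar>)"
    by (rule lebesgue_integral_eq_integral[OF int]) (simp add: A_def)
  finally have "T < integral {l n..L - l n} (\<lambda>x. 1 / \<bar>a x\<bar>)"
    using n T(2) by (simp add: A_def ennreal_less_iff)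
  with l[of n] L show thesis by (intro that[of "l n" "L - l n"]) auto
qed

text \<open>Separation of variables: \<open>G\<close> measures the travel time, and its inverse,
  shifted by \<open>G l\<close>, moves with speed \<open>inverse (\<beta> (H y))\<close>.\<close>

lemma inverse_antiderivative:
  fixes \<beta> :: "real \<Rightarrow> real"
  assumes lr: "l < r" and \<beta>: "continuous_on {l..r} \<beta>" "\<And>x. x \<in> {l..r} \<Longrightarrow> 0 < \<beta> x"
  obtains H where "\<And>y. y \<in> {0..integral {l..r} \<beta>} \<Longrightarrow> H y \<in> {l..r} \<and> (H has_real_derivative inverse (\<beta> (H y))) (at y)"
proof -
  \<comment> \<open>Extending \<beta> by clamping makes \<open>l\<close> and \<open>r\<close>
    interior points, so that two-sided derivatives of the inverse exist there too.\<close>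
  define b where "b x = \<beta> (clamp l r x)" for x
  have b_cont: "continuous_on S b" for S
    unfolding b_def using \<beta>(1) by (intro clamp_continuous_on) simp
  have b_pos: "0 < b x" for x
    unfolding b_def using \<beta>(2) clamp_in_interval[of l r x] lr by simp
  have b_eq: "b x = \<beta> x" if "x \<in> {l..r}" for x unfolding b_def using that by simp
  define G where "G x = integral {l - 1..x} b" for x
  let ?J = "{l - 1<..<r + 1}"
  have G: "(G has_real_derivative b x) (at x)" if "x \<in> ?J" for x
    unfolding G_def
    by (rule has_real_derivative_within_Icc_interior[OF that integral_has_real_derivative[OF b_cont]])
      (use that in auto)
  have G_mono: "G x < G y" if "x \<in> ?J" "y \<in> ?J" "x < y" for x y
  proof (rule DERIV_pos_imp_increasing[OF that(3)])
    fix z assume "x \<le> z" "z \<le> y"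
    then have "z \<in> ?J" using that by auto
    then show "\<exists>d. (G has_real_derivative d) (at z) \<and> 0 < d" using G b_pos by blast
  qed
  have inj: "inj_on G ?J"
  proof (rule inj_onI)
    fix x y assume "x \<in> ?J" "y \<in> ?J" "G x = G y"
    then show "x = y" using G_mono[of x y] G_mono[of y x] by (cases x y rule: linorder_cases) auto
  qed
  define g where "g = inv_into ?J G"
  have gG: "g (G x) = x" if "x \<in> ?J" for x unfolding g_def by (rule inv_into_f_f[OF inj that])
  have Glr: "G r - G l = integral {l..r} \<beta>"
  proof -
    have "integral {l - 1..l} b + integral {l..r} b = integral {l - 1..r} b"
      using lr by (intro Henstock_Kurzweil_Integration.integral_combine integrable_continuous_real b_cont) auto
    moreover have "integral {l..r} b = integral {l..r} \<beta>" by (rule integral_cong) (rule b_eq)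
    ultimately show ?thesis by (simp add: G_def)
  qed
  \<comment> \<open>Used with \<open>\<eta> = 0\<close> to find the point belonging to
    \<open>y\<close> in \<open>{l..r}\<close>, and with \<open>\<eta> = 1 / 2\<close> to invert
    \<open>G\<close> near its value.\<close>
  have hit: "\<exists>x. l - \<eta> \<le> x \<and> x \<le> r + \<eta> \<and> G x = y"
    if \<eta>: "0 \<le> \<eta>" "\<eta> < 1" and y: "G (l - \<eta>) \<le> y" "y \<le> G (r + \<eta>)" for \<eta> y
  proof (rule IVT[where f=G and a="l - \<eta>" and b="r + \<eta>", OF y])
    show "l - \<eta> \<le> r + \<eta>" using lr \<eta> by simp
    show "\<forall>x. l - \<eta> \<le> x \<and> x \<le> r + \<eta> \<longrightarrow> isCont G x"
      using \<eta> by (auto intro!: DERIV_isCont[OF G])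
  qed
  show thesis
  proof (rule that)
    fix y assume y: "y \<in> {0..integral {l..r} \<beta>}"
    have "\<exists>x. l - 0 \<le> x \<and> x \<le> r + 0 \<and> G x = G l + y"
      using y Glr by (intro hit) auto
    then obtain x where x: "x \<in> {l..r}" "G x = G l + y" by auto
    then have xJ: "x \<in> ?J" by auto
    have gy: "g (G l + y) = x" using gG[OF xJ] x by simp
    have "isCont g (G x)"
    proof (rule isCont_inverse_function[where d="1 / 2" and f=G])
      fix z assume "\<bar>z - x\<bar> \<le> 1 / 2"
      then have "x - 1 / 2 \<le> z" "z \<le> x + 1 / 2" by linarith+
      then have z: "z \<in> ?J" using x by auto
      show "g (G z) = z" by (rule gG[OF z])
      show "isCont G z" by (rule DERIV_isCont[OF G[OF z]])
    qed simp
    then have cont: "isCont g (G l + y)" using x by simp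
    have der: "(G has_real_derivative b x) (at (g (G l + y)))" unfolding gy by (rule G[OF xJ])
    have "(g has_real_derivative inverse (b x)) (at (G l + y))"
    proof (rule DERIV_inverse_function[OF der _ _ _ _ cont])
      show "b x \<noteq> 0" using b_pos[of x] by simp
      show "G (l - 1 / 2) < G l + y" "G l + y < G (r + 1 / 2)"
        using G_mono[of "l - 1 / 2" x] G_mono[of x "r + 1 / 2"] x by auto
      fix z assume "G (l - 1 / 2) < z" "z < G (r + 1 / 2)"
      then obtain v where "l - 1 / 2 \<le> v" "v \<le> r + 1 / 2" "G v = z" using hit[of "1 / 2" z] by auto
      then show "G (g z) = z" using gG[of v] by auto
    qed
    then have "((\<lambda>z. g (z + G l)) has_real_derivative inverse (b x)) (at y)"
      by (simp only: DERIV_shift[symmetric] add.commute)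
    then show "g (y + G l) \<in> {l..r} \<and> ((\<lambda>z. g (z + G l)) has_real_derivative inverse (\<beta> (g (y + G l)))) (at y)"
      using gy x b_eq[OF x(1)] by (simp add: add.commute)
  qed
qed

text \<open>An interior zero of \<open>a\<close> is a stationary characteristic. Otherwise
  \<open>a\<close> keeps its sign on a compact subinterval that takes longer than \<open>T\<close>
  to cross, and the equation can be solved by separation of variables.\<close>

lemma characteristic_exists:
  assumes L: "0 < L" and T: "0 \<le> T" "ennreal T < transport_time L a" and a: "continuous_on {0..L} a"
  obtains X d where "0 < d" "\<And>t. t \<in> {0..T} \<Longrightarrow> X t \<in> {d..L - d}"
    "\<And>t. t \<in> {0..T} \<Longrightarrow> (X has_real_derivative - a (X t)) (at t within {0..T})"
proof (cases "\<exists>z\<in>{0<..<L}. a z = 0")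
  case True
  then obtain z where "z \<in> {0<..<L}" "a z = 0" by blast
  then show thesis by (intro that[of "min z (L - z)" "\<lambda>_. z"]) auto
next
  case False
  then obtain l r where lr: "0 < l" "l < r" "r < L" and Tlr: "T < integral {l..r} (\<lambda>x. 1 / \<bar>a x\<bar>)"
    using transport_time_compact_subinterval[OF L a _ T(2,1)] by metis
  have ac: "continuous_on {l..r} a" using lr by (intro continuous_on_subset[OF a]) auto
  have nz: "a x \<noteq> 0" if "x \<in> {l..r}" for x using False that lr by auto
  let ?I = "integral {l..r} (\<lambda>x. 1 / \<bar>a x\<bar>)"
  obtain H where H: "\<And>y. y \<in> {0..?I} \<Longrightarrow> H y \<in> {l..r} \<and> (H has_real_derivative inverse (1 / \<bar>a (H y)\<bar>)) (at y)"
  proof (rule inverse_antiderivative[OF lr(2), of "\<lambda>x. 1 / \<bar>a x\<bar>"])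
    show "continuous_on {l..r} (\<lambda>x. 1 / \<bar>a x\<bar>)" using nz by (intro continuous_intros ac) auto
    show "0 < 1 / \<bar>a x\<bar>" if "x \<in> {l..r}" for x using nz[OF that] by simp
  qed (rule that)
  define d where "d = min l (L - r)"
  have d: "0 < d" "{l..r} \<subseteq> {d..L - d}" using lr by (auto simp: d_def)
  have conn: "connected (a ` {l..r})" by (intro connected_continuous_image ac connected_Icc)
  have "(\<forall>x\<in>{l..r}. a x < 0) \<or> (\<forall>x\<in>{l..r}. 0 < a x)"
  proof (rule ccontr)
    assume "\<not> ?thesis"
    then obtain x y where "x \<in> {l..r}" "y \<in> {l..r}" "\<not> a x < 0" "\<not> 0 < a y" by blast
    then have "0 \<in> a ` {l..r}" using connectedD_interval[OF conn, of "a y" "a x" 0] by auto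
    then show False using nz by auto
  qed
  then consider "\<forall>x\<in>{l..r}. a x < 0" | "\<forall>x\<in>{l..r}. 0 < a x" by blast
  then show thesis
  proof cases
    case 1
    show thesis
    proof (rule that[OF d(1)])
      fix t assume "t \<in> {0..T}"
      then have t: "t \<in> {0..?I}" using Tlr by auto
      show "H t \<in> {d..L - d}" using H[OF t] d by auto
      have "inverse (1 / \<bar>a (H t)\<bar>) = - a (H t)" using 1[rule_format, of "H t"] H[OF t] by simp
      then show "(H has_real_derivative - a (H t)) (at t within {0..T})"
        using has_field_derivative_at_within[OF conjunct2[OF H[OF t]]] by simp
    qed
  next
    case 2
    show thesis
    proof (rule that[OF d(1)])
      fix t assume "t \<in> {0..T}"
      \<comment> \<open>\<open>H\<close> moves to the right with speed \<open>a\<close>; running it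
        backwards in time gives the motion to the left that \<open>- a\<close> demands.\<close>
      then have t: "T - t \<in> {0..?I}" using Tlr by auto
      show "H (T - t) \<in> {d..L - d}" using H[OF t] d by auto
      have eq: "\<bar>a (H (T - t))\<bar> = a (H (T - t))" using 2[rule_format, of "H (T - t)"] H[OF t] by simp
      have s: "((\<lambda>t. T - t) has_real_derivative - 1) (at t within {0..T})"
        by (rule derivative_eq_intros refl | simp)+
      show "((\<lambda>t. H (T - t)) has_real_derivative - a (H (T - t))) (at t within {0..T})"
        using DERIV_chain2[OF conjunct2[OF H[OF t]] s] by (simp add: eq)
    qed
  qed
qed

section \<open>Lower bound for the cost\<close>

text \<open>Based on \<open>2 \<bar>h\<bar> \<le> 1 + h\<^sup>2\<close> instead of the Cauchy--Schwarz inequality.  If the integrand on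
  the left is not integrable, the integral is \<open>0\<close> by convention.\<close>

lemma abs_integral_reflected_le:
  assumes T: "0 \<le> T" and h: "h \<in> L2 0 T" and F: "\<And>t. t \<in> {0..T} \<Longrightarrow> \<bar>F t\<bar> \<le> \<Phi>"
  shows "\<bar>LINT t|lebesgue_on {0..T}. F t * h (T - t)\<bar> \<le> \<Phi> * (T + (L2_nrm 0 T h)\<^sup>2) / 2"
proof -
  let ?M = "lebesgue_on {0..T}"
  have \<Phi>: "0 \<le> \<Phi>" using F[of 0] T by auto
  define I where "I = L2_ip 0 T h h"
  have I0: "0 \<le> I" unfolding I_def L2_ip_def by (intro integral_nonneg_AE) simp
  then have I: "I = (L2_nrm 0 T h)\<^sup>2" by (simp add: L2_nrm_def I_def)
  have "integrable ?M (\<lambda>x. h x * h x)" using h by (simp add: L2_def power2_eq_square)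
  then have "((\<lambda>x. h x * h x) has_integral I) (cbox 0 T)"
    unfolding I_def L2_ip_def using has_integral_integral_lebesgue_on by fastforce
  \<comment> \<open>The reflection is carried out for the gauge integral; nonnegativity of the
    square then brings back Lebesgue integrability.\<close>
  from has_integral_affinity[OF this, of "-1" T]
  have "((\<lambda>x. h (T - x) * h (T - x)) has_integral I) ((\<lambda>x. T - x) ` {0..T})" by simp
  also have "(\<lambda>x. T - x) ` {0..T} = {0..T}" by simp
  finally have hi: "((\<lambda>x. h (T - x) * h (T - x)) has_integral I) {0..T}" .
  then have "(\<lambda>x. h (T - x) * h (T - x)) absolutely_integrable_on {0..T}"
    by (intro nonnegative_absolutely_integrable_1) auto
  then have int: "integrable ?M (\<lambda>x. h (T - x) * h (T - x))"
    by (rule absolutely_integrable_imp_integrable) simp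
  have I': "integral\<^sup>L ?M (\<lambda>x. h (T - x) * h (T - x)) = I"
    using hi lebesgue_integral_eq_integral[OF int] by (simp add: integral_unique)
  have int1: "integrable ?M (\<lambda>x. 1 :: real)" by (intro continuous_imp_integrable_real continuous_intros)
  have int2: "integrable ?M (\<lambda>x. \<Phi> / 2 * (1 + h (T - x) * h (T - x)))" using int int1 by simp
  have "\<bar>LINT t|?M. F t * h (T - t)\<bar> \<le> (LINT t|?M. \<Phi> / 2 * (1 + h (T - t) * h (T - t)))"
  proof (cases "integrable ?M (\<lambda>t. F t * h (T - t))")
    case True
    have "\<bar>LINT t|?M. F t * h (T - t)\<bar> \<le> (LINT t|?M. \<bar>F t * h (T - t)\<bar>)" by (rule integral_abs_bound)
    also have "\<dots> \<le> (LINT t|?M. \<Phi> / 2 * (1 + h (T - t) * h (T - t)))"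
    proof (rule integral_mono[OF _ int2])
      show "integrable ?M (\<lambda>t. \<bar>F t * h (T - t)\<bar>)" using True by simp
      fix t assume "t \<in> space ?M"
      then have "\<bar>F t\<bar> \<le> \<Phi>" using F by (simp add: space_restrict_space)
      then have "\<bar>F t * h (T - t)\<bar> \<le> \<Phi> * \<bar>h (T - t)\<bar>" unfolding abs_mult by (intro mult_right_mono) auto
      also have "\<bar>h (T - t)\<bar> \<le> (1 + h (T - t) * h (T - t)) / 2"
        using zero_le_power2[of "\<bar>h (T - t)\<bar> - 1"] by (simp add: power2_eq_square algebra_simps flip: abs_mult)
      finally show "\<bar>F t * h (T - t)\<bar> \<le> \<Phi> / 2 * (1 + h (T - t) * h (T - t))" using \<Phi> by (simp add: mult_left_mono)
    qed
    finally show ?thesis .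
  next
    case False
    have "0 \<le> (LINT t|?M. \<Phi> / 2 * (1 + h (T - t) * h (T - t)))"
      using \<Phi> by (intro integral_nonneg_AE) simp
    then show ?thesis using False by (simp add: not_integrable_integral_eq)
  qed
  also have "\<dots> = \<Phi> / 2 * (T + I)"
    using int int1 T by (simp add: I' measure_restrict_space)
  finally show ?thesis by (simp add: I)
qed

text \<open>For a null control the identity at time \<open>T\<close> equates the pairing of
  \<open>u T\<close> and \<open>y0\<close> with minus the flux integral, and \<open>large\<close>
  says that a control of norm at most \<open>M\<close> cannot make that integral big enough.\<close>

lemma control_cost_ge:
  assumes T: "0 \<le> T" and M: "0 \<le> M"
    and u: "adjoint_sol L a a' b T \<epsilon> u0 u v" and u0: "u0 \<in> H1_0 L"
    and y0: "y0 \<in> L2 0 L" "L2_nrm 0 L y0 \<le> 1"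
    and flux: "\<And>t. t \<in> {0..T} \<Longrightarrow> \<bar>\<epsilon> * v t 0\<bar> \<le> \<Phi>"
    and large: "\<Phi> * (T + M\<^sup>2) / 2 < L2_ip 0 L (u T) y0"
  shows "ennreal M \<le> control_cost L a a' b T \<epsilon>"
proof -
  have "ennreal M \<le> (INF h\<in>null_controls L a a' b T \<epsilon> y0. ennreal (L2_nrm 0 T h))"
  proof (rule INF_greatest)
    fix h assume "h \<in> null_controls L a a' b T \<epsilon> y0"
    then obtain y where h: "h \<in> L2 0 T" and y: "transposition_sol L a a' b T \<epsilon> y0 h y"
      and yT: "AE x in lebesgue_on {0..L}. y T x = 0"
      unfolding null_controls_def by auto
    have "L2_ip 0 L (u T) y0 - L2_ip 0 L u0 (y T)
          + (LINT t|lebesgue_on {0..T}. \<epsilon> * v t 0 * h (T - t)) = 0"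
      using y u u0 T unfolding transposition_sol_def by (meson atLeastAtMost_iff order_refl)
    moreover have "L2_ip 0 L u0 (y T) = 0"
      unfolding L2_ip_def by (rule integral_eq_zero_AE) (use yT in \<open>auto elim: eventually_mono\<close>)
    ultimately have "L2_ip 0 L (u T) y0 \<le> \<bar>LINT t|lebesgue_on {0..T}. \<epsilon> * v t 0 * h (T - t)\<bar>" by simp
    also have "\<dots> \<le> \<Phi> * (T + (L2_nrm 0 T h)\<^sup>2) / 2"
      by (rule abs_integral_reflected_le[OF T h flux])
    finally have "\<Phi> * (T + M\<^sup>2) < \<Phi> * (T + (L2_nrm 0 T h)\<^sup>2)" using large by simp
    moreover have "0 \<le> \<Phi>" using flux[of 0] T by auto
    ultimately have "M\<^sup>2 < (L2_nrm 0 T h)\<^sup>2"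
      by (metis add_le_cancel_left mult_left_mono not_le)
    then have "M \<le> L2_nrm 0 T h" using L2_nrm_nonneg power2_less_imp_less by fastforce
    then show "ennreal M \<le> ennreal (L2_nrm 0 T h)" by (rule ennreal_leI)
  qed
  also have "\<dots> \<le> control_cost L a a' b T \<epsilon>"
    unfolding control_cost_def using y0 by (intro SUP_upper) simp
  finally show ?thesis .
qed

text \<open>\<open>exp (- (\<gamma> / s))\<close> is at most \<open>s / \<gamma>\<close>, hence of
  higher order than \<open>sqrt s\<close>. With \<open>s = r\<^sup>2\<close> each requirement
  becomes an upper bound on \<open>r\<close>, one for each entry of the minimum.\<close>

lemma small_width_exists:
  fixes \<gamma> d E \<eta> C1 C2 :: real
  assumes "0 < \<gamma>" "0 < d" "0 < E" "0 < \<eta>" "0 < C1" "0 \<le> C2"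
  obtains s where "0 < s" "sqrt s * E \<le> d" "2 * exp (- (\<gamma> / s)) \<le> \<eta>" "C2 * exp (- (\<gamma> / s)) < C1 * sqrt s"
proof -
  define r where "r = min 1 (min (d / E) (min (\<eta> * \<gamma> / 2) (C1 * \<gamma> / (C2 + 1))))"
  have "0 < r" using assms by (simp add: r_def)
  moreover have "r \<le> 1" "r \<le> d / E" "r \<le> \<eta> * \<gamma> / 2" "r \<le> C1 * \<gamma> / (C2 + 1)"
    by (simp_all only: r_def min_le_iff_disj order_refl simp_thms)
  ultimately have r: "0 < r" "r \<le> 1" "r \<le> d / E" "r \<le> \<eta> * \<gamma> / 2" "r \<le> C1 * \<gamma> / (C2 + 1)" .
  define s where "s = r\<^sup>2"
  have s: "0 < s" "sqrt s = r" using r by (auto simp: s_def)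
  have e: "exp (- (\<gamma> / s)) \<le> r\<^sup>2 / \<gamma>"
  proof -
    have "\<gamma> / s \<le> exp (\<gamma> / s)" using exp_ge_add_one_self[of "\<gamma> / s"] by linarith
    then have "inverse (exp (\<gamma> / s)) \<le> inverse (\<gamma> / s)" using assms s by (intro le_imp_inverse_le) auto
    then show ?thesis by (simp add: s_def exp_minus)
  qed
  show thesis
  proof (rule that[OF s(1)])
    show "sqrt s * E \<le> d" using r(3) assms by (simp add: s field_simps)
    have "r\<^sup>2 \<le> r" using r by (simp add: power2_eq_square mult_left_le)
    then have "r\<^sup>2 / \<gamma> \<le> (\<eta> * \<gamma> / 2) / \<gamma>" using r(4) assms by (intro divide_right_mono) auto
    also have "\<dots> = \<eta> / 2" using assms by simp
    finally show "2 * exp (- (\<gamma> / s)) \<le> \<eta>" using e by linarith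
    have "C2 * r < (C2 + 1) * r" using r by simp
    also have "\<dots> \<le> (C2 + 1) * (C1 * \<gamma> / (C2 + 1))" using r(5) assms by (intro mult_left_mono) auto
    also have "\<dots> = C1 * \<gamma>" using assms by simp
    finally have "C2 * r / \<gamma> < C1" using assms by (simp add: divide_less_eq)
    then have "C2 * r / \<gamma> * r < C1 * r" using r(1) by (rule mult_strict_right_mono)
    moreover have "C2 * exp (- (\<gamma> / s)) \<le> C2 * (r\<^sup>2 / \<gamma>)" using e assms by (intro mult_left_mono) auto
    ultimately show "C2 * exp (- (\<gamma> / s)) < C1 * sqrt s" by (simp add: s power2_eq_square)
  qed
qed

text \<open>Dividing by \<open>sqrt L\<close> instead of the exact norm loses only a power of the
  interval length, which is harmless against an exponentially small flux.\<close>

lemma L2_ip_indicator_ge: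
  assumes f: "continuous_on {0..L} f" and lr: "0 \<le> l" "l \<le> r" "r \<le> L" and L: "0 < L"
    and ge: "\<And>x. x \<in> {l..r} \<Longrightarrow> \<eta> \<le> f x"
  shows "(\<lambda>x. indicator {l..r} x / sqrt L) \<in> L2 0 L"
    and "L2_nrm 0 L (\<lambda>x. indicator {l..r} x / sqrt L) \<le> 1"
    and "\<eta> * (r - l) / sqrt L \<le> L2_ip 0 L f (\<lambda>x. indicator {l..r} x / sqrt L)"
proof -
  let ?M = "lebesgue_on {0..L}"
  have sets [measurable]: "{l..r} \<in> sets ?M" using lr by (auto simp: sets_restrict_space_iff)
  have int: "integrable ?M (\<lambda>x. indicator {l..r} x * h x)" if "continuous_on {0..L} h" for h :: "real \<Rightarrow> real"
    using integrable_mult_indicator[OF sets continuous_imp_integrable_real[OF that]] by simp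
  have sq: "(indicator {l..r} x / sqrt L)\<^sup>2 = indicator {l..r} x * (1 / L)" for x :: real
    using L by (simp add: indicator_def power_divide)
  show "(\<lambda>x. indicator {l..r} x / sqrt L) \<in> L2 0 L"
    unfolding L2_def mem_Collect_eq sq by (intro conjI int continuous_intros) measurable
  have "L2_nrm 0 L (\<lambda>x. indicator {l..r} x / sqrt L) \<le> sqrt L * (1 / sqrt L)"
    using L by (intro L2_nrm_le) (auto simp: indicator_def)
  then show "L2_nrm 0 L (\<lambda>x. indicator {l..r} x / sqrt L) \<le> 1" using L by simp
  have "(LINT x|?M. indicator {l..r} x * (\<eta> / sqrt L)) \<le> (LINT x|?M. indicator {l..r} x * (f x / sqrt L))"
    using ge L by (intro integral_mono int continuous_intros f)
      (auto simp: indicator_def intro!: divide_right_mono)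
  also have "(LINT x|?M. indicator {l..r} x * (\<eta> / sqrt L)) = measure ?M {l..r} * (\<eta> / sqrt L)"
    using sets lr by (simp add: max_absorb1 min_absorb1)
  also have "measure ?M {l..r} = r - l"
    using lr by (simp add: measure_restrict_space)
  finally show "\<eta> * (r - l) / sqrt L \<le> L2_ip 0 L f (\<lambda>x. indicator {l..r} x / sqrt L)"
    unfolding L2_ip_def by (simp add: mult.commute)
qed

text \<open>Every constant except \<open>\<epsilon>0\<close> is fixed before \<epsilon> is
  introduced, and \<open>s3\<close> is the final inequality between flux and pairing, secured in
  advance by the choice of \<open>s\<close>.\<close>

lemma control_cost_ge_small_viscosity:
  fixes L T M :: real and a a' b :: "real \<Rightarrow> real"
  assumes L: "0 < L"
    and a: "\<And>x. x \<in> {0..L} \<Longrightarrow> (a has_real_derivative a' x) (at x within {0..L})"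
    and a': "continuous_on {0..L} a'" and b: "continuous_on {0..L} b"
    and T: "0 < T" "ennreal T < transport_time L a" and M: "0 \<le> M"
  obtains \<epsilon>0 where "0 < \<epsilon>0" "\<And>\<epsilon>. 0 < \<epsilon> \<Longrightarrow> \<epsilon> < \<epsilon>0 \<Longrightarrow> ennreal M \<le> control_cost L a a' b T \<epsilon>"
proof -
  have ac: "continuous_on {0..L} a" using a by (rule DERIV_continuous_on)
  obtain X d' where d': "0 < d'" and X': "\<And>t. t \<in> {0..T} \<Longrightarrow> X t \<in> {d'..L - d'}"
    and X: "\<And>t. t \<in> {0..T} \<Longrightarrow> (X has_real_derivative - a (X t)) (at t within {0..T})"
    by (rule characteristic_exists[OF L less_imp_le[OF T(1)] T(2) ac]) (rule that)
  \<comment> \<open>Half the distance, so that all points of \<open>{0..d}\<close> are still at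
    distance at least \<open>d\<close> from the characteristic.\<close>
  define d where "d = d' / 2"
  have d: "0 < d" using d' by (simp add: d_def)
  have X2: "2 * d \<le> X t" "X t \<le> L - 2 * d" if "t \<in> {0..T}" for t using X'[OF that] by (auto simp: d_def)
  have Xr: "X t \<in> {d..L - d}" if "t \<in> {0..T}" for t using X2[OF that] d by auto
  have T0: "0 \<in> {0..T}" "T \<in> {0..T}" using T by auto
  have dL: "4 * d \<le> L" using X2[OF T0(1)] by linarith
  obtain A1 where A1: "0 < A1" "\<And>x. x \<in> {0..L} \<Longrightarrow> \<bar>a' x\<bar> \<le> A1"
    by (rule continuous_on_Icc_le[OF a']) (rule that)
  obtain B1 where B1: "0 < B1" "\<And>x. x \<in> {0..L} \<Longrightarrow> \<bar>b x\<bar> \<le> B1"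
    by (rule continuous_on_Icc_le[OF b]) (rule that)
  obtain k where k: "0 < k" "\<And>x. x \<in> {0..L} \<Longrightarrow> \<bar>a x\<bar> \<le> k"
    by (rule continuous_on_Icc_le[OF ac]) (rule that)
  define \<Lambda> where "\<Lambda> = A1 + 1"
  have \<Lambda>: "1 \<le> \<Lambda>" using A1 by (simp add: \<Lambda>_def)
  have lip: "\<bar>a x - a y\<bar> \<le> \<Lambda> * \<bar>x - y\<bar>" if xy: "x \<in> {0..L}" "y \<in> {0..L}" for x y
  proof -
    have "norm (a x - a y) \<le> A1 * norm (x - y)"
      by (rule field_differentiable_bound[where S="{0..L}" and f'=a']) (use a A1 xy in auto)
    also have "\<dots> \<le> \<Lambda> * norm (x - y)" by (intro mult_right_mono) (auto simp: \<Lambda>_def)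
    finally show ?thesis by simp
  qed
  \<comment> \<open>Large enough for both sign conditions on \<open>c\<close>: nonpositive for
    comparison, at most \<open>a' / 2\<close> for existence.\<close>
  define \<omega> where "\<omega> = A1 + B1"
  define c where "c x = a' x - b x - \<omega>" for x
  have cc: "continuous_on {0..L} c" unfolding c_def by (intro continuous_intros a' b)
  have c0: "c x \<le> 0" and ca: "c x \<le> a' x / 2" and cC: "- c x \<le> 2 * \<omega>" if "x \<in> {0..L}" for x
    using A1(2)[OF that] B1(2)[OF that] by (auto simp: c_def \<omega>_def abs_le_iff)
  have \<omega>: "0 < \<omega>" using A1 B1 by (simp add: \<omega>_def)
  define K where "K = 1 + 2 * \<omega>"
  \<comment> \<open>The minimum over \<open>{d..L - d}\<close> of the parabola \<open>P\<close>
    introduced below.\<close>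
  define \<eta>0 where "\<eta>0 = 4 * d * (L - d) / L\<^sup>2"
  have bump: "4 * x * (L - x) / L\<^sup>2 \<le> 1" for x
  proof -
    have "0 \<le> (L - 2 * x)\<^sup>2" by simp
    then have "4 * x * (L - x) \<le> L\<^sup>2" by (simp add: power2_eq_square algebra_simps)
    then show ?thesis using L by (simp add: divide_le_eq)
  qed
  have \<eta>0: "0 < \<eta>0" "\<eta>0 \<le> 1" using d dL L bump[of d] by (auto simp: \<eta>0_def)
  \<comment> \<open>Half the height of the lower Gaussian at time \<open>T\<close>, one standard
    deviation from its centre; the other half absorbs the error \<open>2 * \<kappa>\<close>.\<close>
  define \<eta>1 where "\<eta>1 = \<eta>0 * exp (- (K * T) - 1 / 2) / 2"
  have \<eta>1: "0 < \<eta>1" using \<eta>0 by (simp add: \<eta>1_def)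
  \<comment> \<open>The exponent of the spreading Gaussian at distance \<open>d\<close>, multiplied
    by \<open>s\<close> and taken at the worst time \<open>T\<close>.\<close>
  define \<gamma> where "\<gamma> = d\<^sup>2 / 2 * exp (- (4 * \<Lambda> * T))"
  have \<gamma>: "0 < \<gamma>" "\<gamma> \<le> d\<^sup>2 / 2" using d \<Lambda> T by (auto simp: \<gamma>_def mult_left_le)
  define E where "E = exp (- (\<Lambda> * T))"
  obtain s where s: "0 < s" and s1: "sqrt s * E \<le> d" and s2: "2 * exp (- (\<gamma> / s)) \<le> \<eta>1"
    and s3: "exp (\<omega> * T) * (4 * k) * (T + M\<^sup>2) / 2 * exp (- (\<gamma> / s)) < \<eta>1 * (2 * E) / sqrt L * sqrt s"
    by (rule small_width_exists[of \<gamma> d E \<eta>1 "\<eta>1 * (2 * E) / sqrt L" "exp (\<omega> * T) * (4 * k) * (T + M\<^sup>2) / 2"])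
      (use \<gamma> d \<eta>1 L k T in \<open>auto simp: E_def\<close>)
  define \<kappa> where "\<kappa> = exp (- (\<gamma> / s))"
  have \<kappa>: "0 < \<kappa>" by (simp add: \<kappa>_def)
  define \<delta> where "\<delta> = \<kappa> / (1 + L)"
  have \<delta>: "0 < \<delta>" "\<delta> * x \<le> \<kappa>" if "x \<le> L" for x
  proof -
    show "0 < \<delta>" using \<kappa> L by (simp add: \<delta>_def)
    then have "\<delta> * x \<le> \<delta> * (1 + L)" using that by (intro mult_left_mono) auto
    also have "\<dots> = \<kappa>" using L by (simp add: \<delta>_def)
    finally show "\<delta> * x \<le> \<kappa>" .
  qed
  define \<rho> where "\<rho> = sqrt s * E"
  have \<rho>: "0 < \<rho>" "\<rho> \<le> d" using s s1 by (auto simp: \<rho>_def E_def)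
  have far: "exp (- (z\<^sup>2 / (2 * s))) \<le> \<kappa>" if "d \<le> \<bar>z\<bar>" for z
  proof -
    have "d\<^sup>2 \<le> z\<^sup>2" using that d by (simp add: abs_le_square_iff[symmetric])
    then have "\<gamma> / s \<le> (z\<^sup>2 / 2) / s" using \<gamma>(2) s by (intro divide_right_mono) auto
    then show ?thesis by (simp add: \<kappa>_def)
  qed

  define G where "G x = exp (- ((x - X 0)\<^sup>2 / (2 * s)))" for x
  \<comment> \<open>The cutoff of the initial Gaussian: it vanishes at both ends, is at most 1, and
    is at most \<open>x / d\<close> near 0, as the flux barrier requires.\<close>
  define P where "P x = 4 * x * (L - x) / L\<^sup>2" for x
  define P1 where "P1 x = (4 * L - 8 * x) / L\<^sup>2" for x
  define l where "l x = - ((x - X 0) / s)" for x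
  have dG: "(G has_real_derivative G x * l x) (at x within S)" for x S
    unfolding G_def l_def using s by (auto intro!: derivative_eq_intros simp: field_simps)
  have dP: "(P has_real_derivative P1 x) (at x within S)" for x S
    unfolding P_def P1_def using L by (auto intro!: derivative_eq_intros simp: field_simps)
  have dP1: "(P1 has_real_derivative - 8 / L\<^sup>2) (at x within S)" for x S
    unfolding P1_def using L by (auto intro!: derivative_eq_intros simp: field_simps)
  have dl: "(l has_real_derivative - (1 / s)) (at x within S)" for x S
    unfolding l_def using s by (auto intro!: derivative_eq_intros simp: field_simps)
  define g where "g x = G x * P x" for x
  define g1 where "g1 x = (G x * l x) * P x + P1 x * G x" for x
  define g2 where "g2 x = (((G x * l x) * l x + - (1 / s) * G x) * P x + P1 x * (G x * l x))
      + (- 8 / L\<^sup>2 * G x + (G x * l x) * P1 x)" for x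
  have dg: "(g has_real_derivative g1 x) (at x within S)" for x S
    unfolding g_def g1_def by (rule DERIV_mult[OF dG dP])
  have dg1: "(g1 has_real_derivative g2 x) (at x within S)" for x S
    unfolding g1_def g2_def by (rule DERIV_add[OF DERIV_mult[OF DERIV_mult[OF dG dl] dP] DERIV_mult[OF dP1 dG]])
  have g2c: "continuous_on {0..L} g2"
    unfolding g2_def
    by (intro continuous_intros DERIV_continuous_on[OF dG] DERIV_continuous_on[OF dl]
        DERIV_continuous_on[OF dP] DERIV_continuous_on[OF dP1])
  have g0: "g 0 = 0" "g L = 0" by (simp_all add: g_def P_def)
  have P01: "0 \<le> P x" "P x \<le> 1" if "x \<in> {0..L}" for x
    using that bump[of x] by (auto simp: P_def)
  have G0: "0 < G x" for x by (simp add: G_def)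
  have gG: "0 \<le> g x" "g x \<le> G x" if "x \<in> {0..L}" for x
    using P01[OF that] G0[of x] by (auto simp: g_def mult_left_le)
  have G_far: "G x \<le> \<kappa>" if "d \<le> \<bar>x - X 0\<bar>" for x unfolding G_def by (rule far[OF that])
  \<comment> \<open>The cutoff spoils a pure Gaussian lower bound only near the boundary, where
    \<open>G\<close> is at most \<kappa>.\<close>
  have g_ge: "\<eta>0 * G x - \<kappa> \<le> g x" if x: "x \<in> {0..L}" for x
  proof (cases "x \<in> {d..L - d}")
    case True
    then have "0 \<le> (x - d) * (L - d - x)" by (intro mult_nonneg_nonneg) auto
    then have "d * (L - d) \<le> x * (L - x)" by (simp add: algebra_simps)
    then have "\<eta>0 \<le> P x" unfolding \<eta>0_def P_def by (intro divide_right_mono) auto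
    then have "\<eta>0 * G x \<le> g x" unfolding g_def using G0[of x] by (simp add: mult.commute mult_left_mono)
    then show ?thesis using \<kappa> by linarith
  next
    case False
    then have "G x \<le> \<kappa>" using X2[OF T0(1)] x d by (intro G_far) auto
    moreover have "\<eta>0 * G x \<le> G x" using \<eta>0 G0[of x] by (simp add: mult_right_le_one_le mult.commute)
    ultimately show ?thesis using gG(1)[OF x] by linarith
  qed

  \<comment> \<open>The first entry serves the two Gaussians, the second the flux barrier.\<close>
  define \<epsilon>0 where "\<epsilon>0 = min (s * exp (- (2 * \<Lambda> * T))) (k * d)"
  show thesis
  proof (rule that)
    show "0 < \<epsilon>0" using s k d by (simp add: \<epsilon>0_def)
    fix \<epsilon> assume \<epsilon>: "0 < \<epsilon>" and "\<epsilon> < \<epsilon>0"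
    then have \<epsilon>k: "\<epsilon> \<le> k * d" and "\<epsilon> \<le> s * exp (- (2 * \<Lambda> * T))" by (auto simp: \<epsilon>0_def)
    then have "\<epsilon> * exp (2 * \<Lambda> * T) \<le> s * exp (- (2 * \<Lambda> * T)) * exp (2 * \<Lambda> * T)" by (intro mult_right_mono) auto
    then have \<epsilon>s: "\<epsilon> * exp (2 * \<Lambda> * T) \<le> s" by (simp add: mult.assoc flip: exp_add)
    have "\<epsilon> * 1 \<le> \<epsilon> * exp (2 * \<Lambda> * T)" using \<epsilon> \<Lambda> T by (intro mult_left_mono) auto
    then have \<epsilon>s': "\<epsilon> \<le> s" using \<epsilon>s by linarith
    obtain u u1 u2 where sol: "classical_sol L T \<epsilon> a c u u1 u2"
      and close: "\<And>x. x \<in> {0..L} \<Longrightarrow> \<bar>u 0 x - g x\<bar> \<le> \<delta> * x"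
      by (rule classical_sol_exists[OF L \<epsilon> less_imp_le[OF T(1)] \<delta>(1)[OF order_refl] a a' cc ca g0 dg dg1 g2c]) (assumption+, rule that)
    have u0: "\<bar>u 0 x - g x\<bar> \<le> \<kappa>" if "x \<in> {0..L}" for x
      using close[OF that] \<delta>(2)[of x] that by auto
    note setting = \<epsilon> ac cc c0 lip \<Lambda> d s X Xr
    have gauss_0: "gauss C K' m s X 0 x = C * G x" for C K' m x
      by (simp add: gauss_def G_def)
    have upper: "\<bar>u t x\<bar> \<le> gauss 1 0 (4 * \<Lambda>) s X t x + \<kappa>" if t: "t \<in> {0..T}" and x: "x \<in> {0..L}" for t x
    proof -
      have "u 0 x \<le> gauss 1 0 (4 * \<Lambda>) s X 0 x + \<kappa>" "- u 0 x \<le> gauss 1 0 (4 * \<Lambda>) s X 0 x + \<kappa>"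
        if "x \<in> {0..L}" for x
        using u0[OF that] gG[OF that] G0[of x] by (auto simp: gauss_0 abs_le_iff)
      then have "u t x \<le> gauss 1 0 (4 * \<Lambda>) s X t x + \<kappa>" "- u t x \<le> gauss 1 0 (4 * \<Lambda>) s X t x + \<kappa>"
        by (intro classical_sol_le_gauss[OF sol setting \<epsilon>s' less_imp_le[OF \<kappa>] _ t x]
              classical_sol_le_gauss[OF classical_sol_minus[OF sol] setting \<epsilon>s' less_imp_le[OF \<kappa>] _ t x]; simp)+
      then show ?thesis by (simp add: abs_le_iff)
    qed
    have at_d: "\<bar>u t d\<bar> \<le> 2 * \<kappa>" if t: "t \<in> {0..T}" for t
    proof -
      have "d\<^sup>2 \<le> (d - X t)\<^sup>2" using X2[OF t] d by (simp add: abs_le_square_iff[symmetric])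
      moreover have "exp (- (4 * \<Lambda> * T)) \<le> exp (- (4 * \<Lambda> * t))" using t \<Lambda> by simp
      ultimately have "\<gamma> \<le> (d - X t)\<^sup>2 / 2 * exp (- (4 * \<Lambda> * t))"
        unfolding \<gamma>_def by (intro mult_mono) auto
      then have "\<gamma> / s \<le> (d - X t)\<^sup>2 / 2 * exp (- (4 * \<Lambda> * t)) / s" using s by (intro divide_right_mono) auto
      then have "gauss 1 0 (4 * \<Lambda>) s X t d \<le> \<kappa>" by (simp add: gauss_def \<kappa>_def)
      then show ?thesis using upper[OF t, of d] d dL by simp
    qed
    \<comment> \<open>A bound by \<kappa> alone would not do: the barrier vanishes at 0, so the
      initial defect must be proportional to \<open>x\<close> as well.\<close>
    have near_0: "\<bar>u 0 x\<bar> \<le> (2 * \<kappa>) * x / d" if x: "x \<in> {0..d}" for x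
    proof -
      have xL: "x \<in> {0..L}" using x d dL by auto
      have "G x \<le> \<kappa>" using X2[OF T0(1)] x by (intro G_far) auto
      moreover have "P x \<le> x / d"
      proof -
        have "4 * x * (L - x) * d \<le> x * L\<^sup>2"
        proof -
          have "(L - x) * (4 * d) \<le> L * L" using x d dL L by (intro mult_mono) auto
          then have "x * ((L - x) * (4 * d)) \<le> x * (L * L)" using x by (intro mult_left_mono) auto
          then show ?thesis by (simp add: power2_eq_square algebra_simps)
        qed
        then show ?thesis using L d by (simp add: P_def field_simps)
      qed
      ultimately have "g x \<le> \<kappa> * (x / d)"
        unfolding g_def using P01[OF xL] \<kappa> by (intro mult_mono) auto
      moreover have "\<delta> * x \<le> \<kappa> * (x / d)"
      proof -
        have "\<delta> * d * x \<le> \<kappa> * x" using \<delta>(2)[of d] d dL x by (intro mult_right_mono) auto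
        then show ?thesis using d by (simp add: field_simps)
      qed
      ultimately show ?thesis using close[OF xL] gG(1)[OF xL] by (auto simp: abs_le_iff)
    qed
    have flux: "\<bar>\<epsilon> * u1 t 0\<bar> \<le> 2 * k * (2 * \<kappa>)" if t: "t \<in> {0..T}" for t
      by (rule classical_sol_flux[OF sol \<epsilon> ac cc c0 d _ k(1) _ \<epsilon>k _ at_d near_0 t])
        (use d dL k \<kappa> in \<open>auto simp: abs_le_iff\<close>)
    have lower: "\<eta>1 \<le> u T x" if x: "x \<in> {X T - \<rho>..X T + \<rho>}" for x
    proof -
      have xL: "x \<in> {0..L}" using x X2[OF T0(2)] \<rho> d by auto
      have "gauss \<eta>0 (1 + 2 * \<omega>) (- 2 * \<Lambda>) s X T x - 2 * \<kappa> \<le> u T x"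
      proof (rule gauss_le_classical_sol[OF sol setting \<epsilon>s less_imp_le[OF \<eta>0(1)] _ cC _ T0(2) xL])
        have "\<eta>0 * exp (- (d\<^sup>2 / (2 * s))) \<le> 1 * \<kappa>" using \<eta>0 d by (intro mult_mono far) auto
        then show "\<eta>0 * exp (- (d\<^sup>2 / (2 * s))) \<le> 2 * \<kappa>" using \<kappa> by simp
        show "gauss \<eta>0 (1 + 2 * \<omega>) (- 2 * \<Lambda>) s X 0 x - 2 * \<kappa> \<le> u 0 x" if "x \<in> {0..L}" for x
          using g_ge[OF that] u0[OF that] by (auto simp: gauss_0 abs_le_iff)
      qed
      moreover have "2 * \<eta>1 \<le> gauss \<eta>0 (1 + 2 * \<omega>) (- 2 * \<Lambda>) s X T x"
      proof -
        have "\<bar>x - X T\<bar> \<le> \<rho>" using x by (auto simp: abs_le_iff)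
        then have "(x - X T)\<^sup>2 \<le> \<rho>\<^sup>2" using \<rho> by (simp add: abs_le_square_iff[symmetric])
        also have "\<rho>\<^sup>2 = s * exp (- (2 * \<Lambda> * T))"
          using s by (simp add: \<rho>_def E_def power_mult_distrib flip: exp_of_nat_mult)
        finally have "(x - X T)\<^sup>2 / 2 * (exp (2 * \<Lambda> * T) / s) \<le> s * exp (- (2 * \<Lambda> * T)) / 2 * (exp (2 * \<Lambda> * T) / s)"
          using s by (intro mult_right_mono divide_right_mono) auto
        also have "\<dots> = 1 / 2" using s by (simp add: exp_minus field_simps)
        finally have "- (K * T) - 1 / 2 \<le> - (K * T) - (x - X T)\<^sup>2 / 2 * (exp (2 * \<Lambda> * T) / s)" by simp
        then have "\<eta>0 * exp (- (K * T) - 1 / 2) \<le> \<eta>0 * exp (- (K * T) - (x - X T)\<^sup>2 / 2 * (exp (2 * \<Lambda> * T) / s))"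
          using \<eta>0 by (intro mult_left_mono) auto
        then show ?thesis by (simp add: \<eta>1_def gauss_def K_def)
      qed
      ultimately show ?thesis using s2 by (simp add: \<kappa>_def)
    qed

    \<comment> \<open>Undoing the shift by \<omega> restores the coefficient
      \<open>a' - b\<close>.\<close>
    define U where "U t x = exp (\<omega> * t) * u t x" for t x
    define V where "V t x = exp (\<omega> * t) * u1 t x" for t x
    have "(\<lambda>x. c x + \<omega>) = (\<lambda>x. a' x - b x)" by (simp add: c_def)
    with classical_sol_exp[OF sol ac cc, of \<omega>]
    have solU: "classical_sol L T \<epsilon> a (\<lambda>x. a' x - b x) U V (\<lambda>t x. exp (\<omega> * t) * u2 t x)"
      unfolding U_def V_def by simp
    have adj: "adjoint_sol L a a' b T \<epsilon> (U 0) U V"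
      by (rule classical_sol_imp_adjoint_sol[OF L solU ac]) (intro continuous_intros a' b)
    define y0 where "y0 x = indicator {X T - \<rho>..X T + \<rho>} x / sqrt L" for x
    have UT: "\<eta>1 \<le> U T x" if "x \<in> {X T - \<rho>..X T + \<rho>}" for x
    proof -
      have "1 * \<eta>1 \<le> exp (\<omega> * T) * u T x" using lower[OF that] \<eta>1 \<omega> T by (intro mult_mono) auto
      then show ?thesis by (simp add: U_def)
    qed
    have y0: "y0 \<in> L2 0 L" "L2_nrm 0 L y0 \<le> 1" "\<eta>1 * (2 * \<rho>) / sqrt L \<le> L2_ip 0 L (U T) y0"
      using L2_ip_indicator_ge[OF classical_sol_continuous(1)[OF solU T0(2)], of "X T - \<rho>" "X T + \<rho>" \<eta>1]
        X2[OF T0(2)] \<rho> d L UT unfolding y0_def by auto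
    show "ennreal M \<le> control_cost L a a' b T \<epsilon>"
    proof (rule control_cost_ge[OF less_imp_le[OF T(1)] M adj classical_sol_H1_0(1)[OF L solU T0(1)] y0(1,2)])
      show "\<bar>\<epsilon> * V t 0\<bar> \<le> exp (\<omega> * T) * (2 * k * (2 * \<kappa>))" if t: "t \<in> {0..T}" for t
      proof -
        have "\<bar>\<epsilon> * V t 0\<bar> = exp (\<omega> * t) * \<bar>\<epsilon> * u1 t 0\<bar>" by (simp add: V_def abs_mult)
        also have "\<dots> \<le> exp (\<omega> * T) * (2 * k * (2 * \<kappa>))"
          using flux[OF t] t \<omega> by (intro mult_mono) auto
        finally show ?thesis .
      qed
      have "exp (\<omega> * T) * (2 * k * (2 * \<kappa>)) * (T + M\<^sup>2) / 2 < \<eta>1 * (2 * \<rho>) / sqrt L"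
        using s3 by (simp add: \<kappa>_def \<rho>_def mult_ac)
      then show "exp (\<omega> * T) * (2 * k * (2 * \<kappa>)) * (T + M\<^sup>2) / 2 < L2_ip 0 L (U T) y0"
        using y0(3) by linarith
    qed
  qed
qed

theorem proposition1p4:
  fixes L T :: real and a a' b :: "real \<Rightarrow> real"
  assumes "L > 0"
    and "\<And>x. x \<in> {0..L} \<Longrightarrow> (a has_real_derivative a' x) (at x within {0..L})"
    and "continuous_on {0..L} a'"
    and "continuous_on {0..L} b"
    and "T > 0"
    and "ennreal T < transport_time L a"
  shows "Liminf (at_right 0) (\<lambda>\<epsilon>. control_cost L a a' b T \<epsilon>) = \<infinity>"
proof -
  have "ennreal M \<le> Liminf (at_right 0) (\<lambda>\<epsilon>. control_cost L a a' b T \<epsilon>)" if M: "0 \<le> M" for M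
  proof (rule Liminf_bounded)
    obtain \<epsilon>0 where "0 < \<epsilon>0" "\<And>\<epsilon>. 0 < \<epsilon> \<Longrightarrow> \<epsilon> < \<epsilon>0 \<Longrightarrow> ennreal M \<le> control_cost L a a' b T \<epsilon>"
      by (rule control_cost_ge_small_viscosity[OF assms M]) (assumption, rule that)
    then show "\<forall>\<^sub>F \<epsilon> in at_right 0. ennreal M \<le> control_cost L a a' b T \<epsilon>"
      unfolding eventually_at_right_field by blast
  qed
  note ge = this
  show ?thesis
  proof (cases "Liminf (at_right 0) (\<lambda>\<epsilon>. control_cost L a a' b T \<epsilon>)")
    case (real r)
    \<comment> \<open>A finite value \<open>r\<close> would have to be at least
      \<open>r + 1\<close>.\<close>
    then show ?thesis using ge[of "r + 1"] by simp
  qed simp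
qed

end
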